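(* Let $K\in\mathbb N$ and $\varepsilon>0$. There exists $\kappa=\kappa(K,\varepsilon)>0$ such that for every $\alpha\in\mathcal{BT}_K$ the following holds. The set of maps $f\in\mathcal D_\varepsilon$ such that $f$ is analytically conjugate to $R_\alpha$ in $\Pi_{\varepsilon/2}$ and whose distance to $R_\alpha$ in $\mathcal D_\varepsilon$ is bounded by $\kappa$ forms an embedded analytic submanifold of $\mathcal D_\varepsilon$ at $R_\alpha$ of (complex) codimension $1$.
   Context: For $\alpha\in\mathbb R$, $R_\alpha(z)=z+\alpha\bmod\mathbb Z$ is the rotation of $\mathbb C/\mathbb Z$. For $\varepsilon>0$, $\Pi_\varepsilon=\{|\operatorname{Im} z|<\varepsilon\}/\mathbb Z\subset\mathbb C/\mathbb Z$. $\mathcal D_\varepsilon$ is the affine (complex) Banach space of bounded analytic maps $\Pi_\varepsilon\to\mathbb C/\mathbb Z$ which extend continuously to the boundary, with the sup-norm. Maps in $\mathcal D_\varepsilon$ are not assumed to preserve the circle $\mathbb R/\mathbb Z$. For $K\in\mathbb N$, $\mathcal{BT}_K$ is the set of all irrational $\alpha\in(0,1)$ whose continued fraction expansion $\alpha=\cfrac{1}{a_0+\cfrac{1}{a_1+\cdots}}$, with positive integers $a_i$, satisfies $\sup_i a_i\le K$. "$f$ is analytically conjugate to $R_\alpha$ in $\Pi_{\varepsilon/2}$" means that there is an injective holomorphic map $\xi:\Pi_{\varepsilon/2}\to\Pi_\varepsilon$ with $f\circ\xi=\xi\circ R_\alpha$ on $\Pi_{\varepsilon/2}$. *)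

theory Defs
  imports "HOL-Complex_Analysis.Complex_Analysis" "HOL-Library.Function_Algebras"
begin

section \<open>The cylinder \<open>\<complex>/\<int>\<close>\<close>

quotient_type cyl = complex / "\<lambda>z w. z - w \<in> \<int>"
proof (rule equivpI)
  show "reflp (\<lambda>z w::complex. z - w \<in> \<int>)"
    by (simp add: reflp_def)
  show "symp (\<lambda>z w::complex. z - w \<in> \<int>)"
    by (metis (no_types, lifting) Ints_minus minus_diff_eq sympI)
  show "transp (\<lambda>z w::complex. z - w \<in> \<int>)"
  proof (rule transpI)
    fix x y z :: complex
    assume "x - y \<in> \<int>" "y - z \<in> \<int>"
    from Ints_add[OF this] show "x - z \<in> \<int>" by simp
  qed
qed

lift_definition cyl_of :: "complex \<Rightarrow> cyl" is "\<lambda>z. z" .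

lift_definition Im_cyl :: "cyl \<Rightarrow> real" is Im
  by (auto simp: complex_is_Int_iff)

instantiation cyl :: ab_group_add
begin

lift_definition zero_cyl :: cyl is 0 .

lift_definition plus_cyl :: "cyl \<Rightarrow> cyl \<Rightarrow> cyl" is "(+)"
  by (simp add: Ints_add add_diff_add)

lift_definition uminus_cyl :: "cyl \<Rightarrow> cyl" is uminus
  by (metis Ints_minus minus_diff_minus)

lift_definition minus_cyl :: "cyl \<Rightarrow> cyl \<Rightarrow> cyl" is "(-)"
proof -
  fix a b c d :: complex
  assume "a - b \<in> \<int>" "c - d \<in> \<int>"
  from Ints_diff[OF this] show "(a - c) - (b - d) \<in> \<int>"
    by (simp add: algebra_simps)
qed

instance
  by standard (transfer, simp add: algebra_simps)+

end

lemma infdist_Ints_add: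
  fixes z n :: complex
  assumes "n \<in> \<int>"
  shows "infdist (z + n) \<int> = infdist z \<int>"
proof -
  have le: "infdist (w + m) \<int> \<le> infdist w \<int>" if m: "m \<in> \<int>" for w m :: complex
  proof -
    have "infdist (w + m) \<int> \<le> dist w a" if "a \<in> \<int>" for a
    proof -
      have "infdist (w + m) \<int> \<le> dist (w + m) (a + m)"
        using m that by (intro infdist_le Ints_add)
      then show ?thesis by simp
    qed
    then show ?thesis
      unfolding infdist_def[of w] by (auto intro!: cINF_greatest)
  qed
  have "infdist z \<int> \<le> infdist (z + n) \<int>"
    using le[of "-n" "z + n"] assms by simp
  with le[OF assms, of z] show ?thesis by simp
qed

lemma infdist_Ints_minus: "infdist (- z) \<int> = infdist (z::complex) \<int>"
proof -
  have le: "infdist (- w) \<int> \<le> infdist w \<int>" for w :: complex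
  proof -
    have "infdist (- w) \<int> \<le> dist w a" if "a \<in> \<int>" for a
      using infdist_le[of "- a" \<int> "- w"] that by (simp add: dist_minus)
    then show ?thesis
      unfolding infdist_def[of w] by (auto intro!: cINF_greatest)
  qed
  show ?thesis using le[of z] le[of "- z"] by simp
qed

lemma infdist_Ints_triangle:
  "infdist (z + w) \<int> \<le> infdist z \<int> + infdist (w::complex) \<int>"
proof -
  have "infdist (z + w) \<int> - infdist z \<int> \<le> dist w a" if "a \<in> \<int>" for a
  proof -
    have "infdist (z + w) \<int> \<le> infdist (z + a) \<int> + dist (z + w) (z + a)"
      by (rule infdist_triangle)
    then show ?thesis using infdist_Ints_add[OF that, of z] by simp
  qed
  then have "infdist (z + w) \<int> - infdist z \<int> \<le> infdist w \<int>"
    unfolding infdist_def[of w] by (auto intro!: cINF_greatest)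
  then show ?thesis by simp
qed

text \<open>The flat metric: the distance of two classes is the least distance of
  representatives.  It induces the quotient topology.\<close>

instantiation cyl :: metric_space
begin

lift_definition dist_cyl :: "cyl \<Rightarrow> cyl \<Rightarrow> real" is "\<lambda>z w. infdist (z - w) \<int>"
proof -
  fix a b c d :: complex
  assume "a - b \<in> \<int>" "c - d \<in> \<int>"
  from infdist_Ints_add[OF Ints_diff[OF this], of "b - d"]
  show "infdist (a - c) \<int> = infdist (b - d) \<int>"
    by (simp add: algebra_simps)
qed

definition uniformity_cyl :: "(cyl \<times> cyl) filter"
  where "uniformity_cyl = (INF e\<in>{0<..}. principal {(x, y). dist x y < e})"

definition open_cyl :: "cyl set \<Rightarrow> bool"
  where "open_cyl U = (\<forall>x\<in>U. eventually (\<lambda>(x', y). x' = x \<longrightarrow> y \<in> U) uniformity)"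

instance
proof
  fix x y z :: cyl
  show "dist x y = 0 \<longleftrightarrow> x = y"
  proof transfer
    fix x y :: complex
    have "(\<int> :: complex set) \<noteq> {}" using Ints_0 by blast
    from in_closed_iff_infdist_zero[OF closed_Ints this, of "x - y"]
    show "infdist (x - y) \<int> = 0 \<longleftrightarrow> x - y \<in> \<int>" by simp
  qed
  show "dist x y \<le> dist x z + dist y z"
  proof (transfer)
    fix x y z :: complex
    show "infdist (x - y) \<int> \<le> infdist (x - z) \<int> + infdist (y - z) \<int>"
      using infdist_Ints_triangle[of "x - z" "z - y"] infdist_Ints_minus[of "y - z"] by simp
  qed
qed (simp_all add: uniformity_cyl_def open_cyl_def)

end

section \<open>Annuli and holomorphic maps on them\<close>

definition annulus :: "real \<Rightarrow> cyl set"
  where "annulus \<epsilon> = {p. \<bar>Im_cyl p\<bar> < \<epsilon>}"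

definition closed_annulus :: "real \<Rightarrow> cyl set"
  where "closed_annulus \<epsilon> = {p. \<bar>Im_cyl p\<bar> \<le> \<epsilon>}"

text \<open>Holomorphy in the charts of the Riemann surface \<open>\<complex>/\<int>\<close>, i.e. local inverses
  of \<^const>\<open>cyl_of\<close>.  Intended for open \<open>A\<close>.\<close>

definition cyl_holomorphic_on :: "(cyl \<Rightarrow> cyl) \<Rightarrow> cyl set \<Rightarrow> bool"
  where "cyl_holomorphic_on f A \<longleftrightarrow>
    (\<forall>z. cyl_of z \<in> A \<longrightarrow>
      (\<exists>r>0. \<exists>g. g holomorphic_on ball z r \<and>
        (\<forall>w\<in>ball z r. cyl_of w \<in> A \<and> f (cyl_of w) = cyl_of (g w))))"

definition rotation :: "real \<Rightarrow> cyl \<Rightarrow> cyl"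
  where "rotation \<alpha> p = p + cyl_of (of_real \<alpha>)"

section \<open>The space of maps\<close>

text \<open>Maps on the annulus are represented by functions that are \<^const>\<open>undefined\<close>
  outside of it, so that equality is equality of maps.\<close>

definition map_space :: "real \<Rightarrow> (cyl \<Rightarrow> cyl) set"
  where "map_space \<epsilon> = {f \<in> extensional (annulus \<epsilon>).
    cyl_holomorphic_on f (annulus \<epsilon>) \<and> bounded (f ` annulus \<epsilon>) \<and>
    (\<exists>g. continuous_on (closed_annulus \<epsilon>) g \<and> (\<forall>p\<in>annulus \<epsilon>. g p = f p))}"

definition map_dist :: "real \<Rightarrow> (cyl \<Rightarrow> cyl) \<Rightarrow> (cyl \<Rightarrow> cyl) \<Rightarrow> real"
  where "map_dist \<epsilon> f g = (SUP p\<in>annulus \<epsilon>. dist (f p) (g p))"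

definition rotation_map :: "real \<Rightarrow> real \<Rightarrow> cyl \<Rightarrow> cyl"
  where "rotation_map \<epsilon> \<alpha> = restrict (rotation \<alpha>) (annulus \<epsilon>)"

text \<open>The model Banach space: bounded holomorphic functions on the annulus with continuous
  extension to the boundary.  They are represented by functions vanishing outside of the
  annulus, so that the vector space operations are the pointwise ones.\<close>

definition model_space :: "real \<Rightarrow> (cyl \<Rightarrow> complex) set"
  where "model_space \<epsilon> = {\<phi>. (\<forall>p. p \<notin> annulus \<epsilon> \<longrightarrow> \<phi> p = 0) \<and>
    (\<lambda>z. \<phi> (cyl_of z)) holomorphic_on {z. \<bar>Im z\<bar> < \<epsilon>} \<and> bounded (\<phi> ` annulus \<epsilon>) \<and>
    (\<exists>g. continuous_on (closed_annulus \<epsilon>) g \<and> (\<forall>p\<in>annulus \<epsilon>. g p = \<phi> p))}"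

definition model_norm :: "real \<Rightarrow> (cyl \<Rightarrow> complex) \<Rightarrow> real"
  where "model_norm \<epsilon> \<phi> = (SUP p\<in>annulus \<epsilon>. norm (\<phi> p))"

text \<open>The affine structure: \<open>f + \<phi> mod \<int>\<close>.  For \<open>0 < r \<le> 1/4\<close> the map
  \<open>\<phi> \<mapsto> displace \<epsilon> f \<phi>\<close> is an isometry of the \<open>r\<close>-ball around \<open>0\<close> in the model
  space onto the \<open>r\<close>-ball around \<open>f\<close> in the space of maps; these are the affine charts.\<close>

definition displace :: "real \<Rightarrow> (cyl \<Rightarrow> cyl) \<Rightarrow> (cyl \<Rightarrow> complex) \<Rightarrow> cyl \<Rightarrow> cyl"
  where "displace \<epsilon> f \<phi> = restrict (\<lambda>p. f p + cyl_of (\<phi> p)) (annulus \<epsilon>)"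

section \<open>Holomorphic maps and codimension one submanifolds\<close>

text \<open>A complex Banach space depending on a real parameter is not a type; the following
  notions are therefore relative to a linear space \<open>E\<close> of complex functions and a
  norm \<open>N\<close> on it.\<close>

definition cscale :: "complex \<Rightarrow> ('p \<Rightarrow> complex) \<Rightarrow> 'p \<Rightarrow> complex"
  where "cscale c \<phi> = (\<lambda>p. c * \<phi> p)"

definition norm_open :: "('p \<Rightarrow> complex) set \<Rightarrow> (('p \<Rightarrow> complex) \<Rightarrow> real) \<Rightarrow>
    ('p \<Rightarrow> complex) set \<Rightarrow> bool"
  where "norm_open E N U \<longleftrightarrow>
    U \<subseteq> E \<and> (\<forall>\<phi>\<in>U. \<exists>r>0. \<forall>\<psi>\<in>E. N (\<psi> - \<phi>) < r \<longrightarrow> \<psi> \<in> U)"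

definition bounded_clinear_on :: "('p \<Rightarrow> complex) set \<Rightarrow> (('p \<Rightarrow> complex) \<Rightarrow> real) \<Rightarrow>
    (('p \<Rightarrow> complex) \<Rightarrow> ('p \<Rightarrow> complex)) \<Rightarrow> bool"
  where "bounded_clinear_on E N L \<longleftrightarrow>
    (\<forall>\<phi>\<in>E. L \<phi> \<in> E) \<and>
    (\<forall>\<phi>\<in>E. \<forall>\<psi>\<in>E. L (\<phi> + \<psi>) = L \<phi> + L \<psi>) \<and>
    (\<forall>c. \<forall>\<phi>\<in>E. L (cscale c \<phi>) = cscale c (L \<phi>)) \<and>
    (\<exists>B. \<forall>\<phi>\<in>E. N (L \<phi>) \<le> B * N \<phi>)"

text \<open>On an open set of a complex Banach space, analyticity is the same as complex
  Frechet differentiability at every point; the latter is taken as definition, as in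
  \<^const>\<open>holomorphic_on\<close>.\<close>

definition frechet_holomorphic_on :: "('p \<Rightarrow> complex) set \<Rightarrow> (('p \<Rightarrow> complex) \<Rightarrow> real) \<Rightarrow>
    (('p \<Rightarrow> complex) \<Rightarrow> ('p \<Rightarrow> complex)) \<Rightarrow> ('p \<Rightarrow> complex) set \<Rightarrow> bool"
  where "frechet_holomorphic_on E N \<Psi> U \<longleftrightarrow>
    (\<forall>\<phi>\<in>U. \<Psi> \<phi> \<in> E \<and>
      (\<exists>L. bounded_clinear_on E N L \<and>
        (\<forall>e>0. \<exists>d>0. \<forall>h\<in>E. \<phi> + h \<in> U \<and> N h < d \<longrightarrow>
          N (\<Psi> (\<phi> + h) - \<Psi> \<phi> - L h) \<le> e * N h)))"

definition biholomorphic_between :: "('p \<Rightarrow> complex) set \<Rightarrow> (('p \<Rightarrow> complex) \<Rightarrow> real) \<Rightarrow>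
    (('p \<Rightarrow> complex) \<Rightarrow> ('p \<Rightarrow> complex)) \<Rightarrow> ('p \<Rightarrow> complex) set \<Rightarrow> ('p \<Rightarrow> complex) set \<Rightarrow> bool"
  where "biholomorphic_between E N \<Psi> U V \<longleftrightarrow>
    norm_open E N U \<and> norm_open E N V \<and> bij_betw \<Psi> U V \<and>
    frechet_holomorphic_on E N \<Psi> U \<and> frechet_holomorphic_on E N (inv_into U \<Psi>) V"

definition closed_hyperplane :: "('p \<Rightarrow> complex) set \<Rightarrow> (('p \<Rightarrow> complex) \<Rightarrow> real) \<Rightarrow>
    ('p \<Rightarrow> complex) set \<Rightarrow> bool"
  where "closed_hyperplane E N H \<longleftrightarrow>
    H \<subseteq> E \<and> norm_open E N (E - H) \<and>
    0 \<in> H \<and> (\<forall>\<phi>\<in>H. \<forall>\<psi>\<in>H. \<phi> + \<psi> \<in> H) \<and> (\<forall>c. \<forall>\<phi>\<in>H. cscale c \<phi> \<in> H) \<and>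
    (\<exists>v\<in>E - H. \<forall>\<phi>\<in>E. \<exists>c. \<exists>\<psi>\<in>H. \<phi> = \<psi> + cscale c v)"

text \<open>Every point has a neighbourhood in which a biholomorphic change of the affine
  coordinate \<open>\<phi>\<close> straightens the set to a closed complex hyperplane.\<close>

definition embedded_analytic_hypersurface :: "real \<Rightarrow> (cyl \<Rightarrow> cyl) set \<Rightarrow> bool"
  where "embedded_analytic_hypersurface \<epsilon> S \<longleftrightarrow>
    S \<subseteq> map_space \<epsilon> \<and>
    (\<forall>f\<in>S. \<exists>U V \<Psi> H. 0 \<in> U \<and>
      biholomorphic_between (model_space \<epsilon>) (model_norm \<epsilon>) \<Psi> U V \<and>
      closed_hyperplane (model_space \<epsilon>) (model_norm \<epsilon>) H \<and>
      \<Psi> ` {\<phi>\<in>U. displace \<epsilon> f \<phi> \<in> S} = V \<inter> H)"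

section \<open>Rotation numbers of bounded type and conjugacy\<close>

text \<open>\<open>cf_convergent n a\<close> is \<open>1/(a 0 + 1/(a 1 + \<dots> + 1/a (n - 1)))\<close>.\<close>

primrec cf_convergent :: "nat \<Rightarrow> (nat \<Rightarrow> nat) \<Rightarrow> real"
  where
    "cf_convergent 0 a = 0"
  | "cf_convergent (Suc n) a = 1 / (real (a 0) + cf_convergent n (\<lambda>i. a (Suc i)))"

definition is_cf_expansion :: "(nat \<Rightarrow> nat) \<Rightarrow> real \<Rightarrow> bool"
  where "is_cf_expansion a \<alpha> \<longleftrightarrow> (\<forall>i. a i > 0) \<and> (\<lambda>n. cf_convergent n a) \<longlonglongrightarrow> \<alpha>"

definition bounded_type :: "nat \<Rightarrow> real set"
  where "bounded_type K =
    {\<alpha>\<in>{0<..<1} - \<rat>. \<exists>a. is_cf_expansion a \<alpha> \<and> (\<forall>i. a i \<le> K)}"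

definition analytically_conjugate :: "real \<Rightarrow> (cyl \<Rightarrow> cyl) \<Rightarrow> real \<Rightarrow> bool"
  where "analytically_conjugate \<epsilon> f \<alpha> \<longleftrightarrow>
    (\<exists>\<xi>. cyl_holomorphic_on \<xi> (annulus (\<epsilon> / 2)) \<and> inj_on \<xi> (annulus (\<epsilon> / 2)) \<and>
      \<xi> ` annulus (\<epsilon> / 2) \<subseteq> annulus \<epsilon> \<and>
      (\<forall>p\<in>annulus (\<epsilon> / 2). f (\<xi> p) = \<xi> (rotation \<alpha> p)))"

end

theory Submission imports Defs begin

text \<open>
  Write a map near the rotation as \<open>z + \<alpha> + \<phi> z + l\<close> with a constant \<open>l\<close>, and look for a conjugacy
  \<open>h = id + g\<close>. Differentiating the conjugacy equation and taking logarithms gives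
  \<open>ln h' (z + \<alpha>) - ln h' z = \<psi> (h z)\<close> with \<open>\<psi> = ln (1 + \<phi>')\<close> (Herman's trick). For bounded type \<open>\<alpha>\<close> the
  small divisors cost exactly one derivative, which is regained on integrating \<open>h'\<close>, so in the weighted
  Wiener algebra on a strip this is a contracting fixed-point equation without loss of domain. Its
  solution determines a unique counterterm \<open>l = \<lambda>(\<phi>)\<close>. Writing the difference of two conjugacies as
  \<open>h' \<cdot> Y\<close> linearises the equation up to a quadratic error on the real line and shows that \<open>\<lambda>\<close> is complex
  differentiable. The conjugate maps are then the graph \<open>mean \<phi> = \<lambda>(\<phi> - mean \<phi>)\<close> over a hyperplane.

  Conversely, an injective conjugacy has degree one, because \<open>\<alpha>\<close> and \<open>2 \<alpha>\<close> are not close to integers, and is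
  close to a translation, possibly an imaginary one; uniqueness of the fixed point on a narrow strip
  inside its domain identifies its counterterm with \<open>\<lambda>(\<phi>)\<close>.
\<close>

section \<open>Fourier series of periodic functions on strips\<close>

text \<open>The choice of norm is forced by the small divisors. A Fourier multiplier with bounded
  symbol need not be bounded for the sup norm on a strip, but it is bounded, on the same strip, for
  the sum of coefficient moduli times weights; this norm is also submultiplicative, so exponentials
  and compositions can be estimated term by term. The only operation that consumes width is
  composition with the given data, and these are known on a wider strip from the start, so nothing
  is lost under iteration.

  All widths are multiples of \<delta> = \<epsilon>/16. The map lives on 16\<delta>; two Cauchy
  estimates, for \<phi>' and for the derivative of its logarithm, lead to 14\<delta>; the fixed
  point is sought on 10\<delta>. This exceeds \<epsilon>/2 = 8\<delta>, so that id + g is a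
  conjugacy on the required annulus, and it leaves room for the comparison with a conjugacy
  displaced in the imaginary direction.

  The rotation number enters the estimates only through the constant of its small divisor bound,
  which is why one \<kappa> serves all of \<open>bounded_type K\<close>.\<close>

definition strip :: "real \<Rightarrow> complex set" where "strip b = {z. \<bar>Im z\<bar> < b}"

lemma strip_iff: "z \<in> strip b \<longleftrightarrow> \<bar>Im z\<bar> < b"
  by (simp add: strip_def)

lemma strip_pos: "z \<in> strip b \<Longrightarrow> 0 < b"
  by (auto simp: strip_iff)

lemma strip_mono: "z \<in> strip b \<Longrightarrow> b \<le> c \<Longrightarrow> z \<in> strip c"
  by (auto simp: strip_iff)

lemma strip_subset: "b \<le> c \<Longrightarrow> strip b \<subseteq> strip c"
  by (auto simp: strip_iff)

lemma strip_add_real: "Im w = 0 \<Longrightarrow> z + w \<in> strip b \<longleftrightarrow> z \<in> strip b"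
  by (auto simp: strip_iff)

lemma strip_add: "z \<in> strip b \<Longrightarrow> norm w \<le> r \<Longrightarrow> z + w \<in> strip (b + r)"
  using abs_Im_le_cmod[of w] by (auto simp: strip_iff)

lemma strip_of_real [simp]: "0 < b \<Longrightarrow> complex_of_real x \<in> strip b"
  by (simp add: strip_iff)

lemma open_strip: "open (strip b)"
proof -
  have "strip b = Im -` {-b<..<b}" by (auto simp: strip_def)
  then show ?thesis by (simp add: open_vimage continuous_on_Im continuous_on_id)
qed

lemma convex_strip: "convex (strip b)"
proof -
  have "strip b = {z. Im z < b} \<inter> {z. Im z > - b}" by (auto simp: strip_def)
  then show ?thesis by (simp add: convex_Int convex_halfspace_Im_lt convex_halfspace_Im_gt)
qed

section \<open>Characters of the circle and their weights on strips\<close>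

definition ee :: "int \<Rightarrow> complex \<Rightarrow> complex"
  where "ee n z = exp (2 * of_real pi * \<i> * of_int n * z)"

text \<open>For positive \<open>\<rho>\<close> this is the supremum of the norm of
  \<open>ee n\<close> over \<open>strip \<rho>\<close>. Negative \<open>\<rho>\<close> occurs as
  well: \<open>wt (- b) n\<close> is the decay of the Fourier coefficients of a bounded function on
  \<open>strip b\<close>, and \<open>wt_add\<close> lets gains and losses of width cancel.\<close>

definition wt :: "real \<Rightarrow> int \<Rightarrow> real"
  where "wt \<rho> n = exp (2 * pi * \<rho> * \<bar>of_int n\<bar>)"

lemma ee_add: "ee (m + n) z = ee m z * ee n z"
  by (simp add: ee_def algebra_simps flip: exp_add)

lemma ee_add_arg: "ee n (z + w) = ee n z * ee n w"
  by (simp add: ee_def algebra_simps flip: exp_add)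

lemma ee_0 [simp]: "ee 0 z = 1" "ee n 0 = 1"
  by (simp_all add: ee_def)

lemma ee_minus: "ee (- n) z = inverse (ee n z)"
  by (simp add: ee_def exp_minus)

lemma ee_nz [simp]: "ee n z \<noteq> 0"
  by (simp add: ee_def)

lemma ee_eq_1_iff: "ee n z = 1 \<longleftrightarrow> of_int n * z \<in> \<int>"
proof -
  have "ee n z = 1 \<longleftrightarrow> (\<exists>m::int. 2 * of_real pi * \<i> * of_int n * z = of_int (2 * m) * of_real pi * \<i>)"
    unfolding ee_def using exp_eq[of "2 * of_real pi * \<i> * of_int n * z" 0] by simp
  also have "\<dots> \<longleftrightarrow> (\<exists>m::int. of_int n * z = of_int m)"
    by (intro arg_cong[where f=Ex] ext) (auto simp: field_simps)
  also have "\<dots> \<longleftrightarrow> of_int n * z \<in> \<int>" by (auto simp: Ints_def)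
  finally show ?thesis .
qed

lemma ee_eq_iff: "ee 1 z = ee 1 w \<longleftrightarrow> z - w \<in> \<int>"
proof -
  have "ee 1 z = ee 1 (z - w) * ee 1 w" by (simp flip: ee_add_arg)
  then show ?thesis using ee_eq_1_iff[of 1 "z - w"] by auto
qed

lemma ee_of_int [simp]: "ee n (of_int m) = 1"
  using ee_eq_1_iff[of n "of_int m"] by (metis Ints_of_int of_int_mult)

lemma ee_one [simp]: "ee n 1 = 1"
  using ee_of_int[of n 1] by simp

lemma norm_ee: "norm (ee n z) = exp (- (2 * pi * of_int n * Im z))"
  by (simp add: ee_def)

lemma wt_pos [simp]: "0 < wt \<rho> n" "0 \<le> wt \<rho> n" "wt \<rho> n \<noteq> 0"
  by (simp_all add: wt_def)

lemma wt_ge1: "0 \<le> \<rho> \<Longrightarrow> 1 \<le> wt \<rho> n"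
  by (simp add: wt_def)

lemma wt_add: "wt (a + b) n = wt a n * wt b n"
  by (simp add: wt_def algebra_simps flip: exp_add)

lemma wt_mono: "a \<le> b \<Longrightarrow> wt a n \<le> wt b n"
  unfolding wt_def by (intro iffD2[OF exp_le_cancel_iff] mult_right_mono mult_left_mono) auto

lemma wt_add_le: "0 \<le> \<rho> \<Longrightarrow> wt \<rho> (m + n) \<le> wt \<rho> m * wt \<rho> n"
  unfolding wt_def exp_add[symmetric] distrib_left[symmetric]
  by (auto intro!: mult_left_mono)

lemma norm_ee_le: "\<bar>Im z\<bar> \<le> \<rho> \<Longrightarrow> norm (ee n z) \<le> wt \<rho> n"
proof -
  assume a: "\<bar>Im z\<bar> \<le> \<rho>"
  have "- (of_int n * Im z) \<le> \<bar>of_int n\<bar> * \<bar>Im z\<bar>"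
    by (metis abs_ge_self abs_minus_cancel abs_mult)
  also have "\<dots> \<le> \<bar>of_int n\<bar> * \<rho>" using a by (intro mult_left_mono) auto
  finally have "2 * pi * (- (of_int n * Im z)) \<le> 2 * pi * (\<bar>of_int n\<bar> * \<rho>)"
    by (intro mult_left_mono) auto
  then show ?thesis by (simp add: norm_ee wt_def mult_ac)
qed

lemma ee_has_field_derivative [derivative_intros]:
  "(ee n has_field_derivative 2 * of_real pi * \<i> * of_int n * ee n z) (at z within A)"
  unfolding ee_def by (auto intro!: derivative_eq_intros)

lemma holomorphic_ee [holomorphic_intros]: "g holomorphic_on A \<Longrightarrow> (\<lambda>z. ee n (g z)) holomorphic_on A"
  unfolding ee_def by (intro holomorphic_intros)

lemma continuous_on_ee [continuous_intros]: "continuous_on A g \<Longrightarrow> continuous_on A (\<lambda>z. ee n (g z))"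
  unfolding ee_def by (intro continuous_intros)

section \<open>One-periodic holomorphic functions on a strip\<close>

definition per_hol :: "real \<Rightarrow> (complex \<Rightarrow> complex) \<Rightarrow> bool"
  where "per_hol b f \<longleftrightarrow> f holomorphic_on strip b \<and> (\<forall>z\<in>strip b. f (z + 1) = f z)"

lemma per_holI: "f holomorphic_on strip b \<Longrightarrow> (\<And>z. z \<in> strip b \<Longrightarrow> f (z + 1) = f z) \<Longrightarrow> per_hol b f"
  by (simp add: per_hol_def)

lemma per_hol_holo: "per_hol b f \<Longrightarrow> f holomorphic_on strip b"
  by (simp add: per_hol_def)

lemma per_hol_per: "per_hol b f \<Longrightarrow> z \<in> strip b \<Longrightarrow> f (z + 1) = f z"
  by (simp add: per_hol_def)

lemma per_hol_mono: "per_hol b f \<Longrightarrow> c \<le> b \<Longrightarrow> per_hol c f"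
  unfolding per_hol_def using strip_subset[of c b] holomorphic_on_subset by blast

lemma per_hol_cong: "per_hol b f \<Longrightarrow> (\<And>z. z \<in> strip b \<Longrightarrow> f z = g z) \<Longrightarrow> per_hol b g"
  unfolding per_hol_def by (metis holomorphic_transform strip_add_real one_complex.sel(2))

lemma per_hol_ee: "per_hol b (ee n)"
  by (intro per_holI holomorphic_intros) (simp_all add: ee_add_arg)

lemma per_hol_const: "per_hol b (\<lambda>_. c)"
  by (intro per_holI holomorphic_intros) simp_all

lemma per_hol_add: "per_hol b f \<Longrightarrow> per_hol b g \<Longrightarrow> per_hol b (\<lambda>z. f z + g z)"
  and per_hol_diff: "per_hol b f \<Longrightarrow> per_hol b g \<Longrightarrow> per_hol b (\<lambda>z. f z - g z)"
  and per_hol_mult: "per_hol b f \<Longrightarrow> per_hol b g \<Longrightarrow> per_hol b (\<lambda>z. f z * g z)"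
  by (auto simp: per_hol_def intro!: holomorphic_intros)

lemma per_hol_sum: "(\<And>i. i \<in> I \<Longrightarrow> per_hol b (f i)) \<Longrightarrow> per_hol b (\<lambda>z. \<Sum>i\<in>I. f i z)"
  by (auto simp: per_hol_def intro!: holomorphic_intros sum.cong)

lemma per_hol_exp: "per_hol b f \<Longrightarrow> per_hol b (\<lambda>z. exp (f z))"
  by (auto simp: per_hol_def intro!: holomorphic_intros)

lemma per_hol_cont_line:
  assumes "per_hol b f" "\<bar>y\<bar> < b"
  shows "continuous_on A (\<lambda>x::real. f (of_real x + \<i> * of_real y))"
proof -
  have "continuous_on (strip b) f" using assms per_hol_holo holomorphic_on_imp_continuous_on by blast
  then show ?thesis
    by (rule continuous_on_compose2) (use assms in \<open>auto intro!: continuous_intros simp: strip_iff\<close>)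
qed

lemma per_hol_cont_real:
  assumes "per_hol b f" "0 < b"
  shows "continuous_on A (\<lambda>x::real. f (of_real x))"
  using per_hol_cont_line[OF assms(1), of 0] assms(2) by simp

text \<open>On the convex strip \<open>F\<close> has a primitive \<open>G\<close>, and the integral
  over a period starting at \<open>t\<close> is \<open>G (1 + t) - G t\<close>. As a function of
  \<open>t\<close> this has derivative \<open>F (t + 1) - F t = 0\<close>, so the base point does
  not matter.\<close>

lemma line_integral:
  assumes F: "per_hol b F" and w: "w \<in> strip b"
  shows "integral {0..1} (\<lambda>x::real. F (of_real x + w)) = integral {0..1} (\<lambda>x::real. F (of_real x))"
proof -
  obtain G where G: "\<And>z. z \<in> strip b \<Longrightarrow> (G has_field_derivative F z) (at z within strip b)"
    using holomorphic_convex_primitive'[OF convex_strip open_strip per_hol_holo[OF F]] by blast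
  then have G': "\<And>z. z \<in> strip b \<Longrightarrow> (G has_field_derivative F z) (at z)"
    by (metis at_within_open open_strip)
  have I: "integral {0..1} (\<lambda>x::real. F (of_real x + t)) = G (1 + t) - G t" if t: "t \<in> strip b" for t
  proof -
    have "((\<lambda>x::real. F (of_real x + t)) has_integral (G (of_real 1 + t) - G (of_real 0 + t))) {0..1}"
    proof (rule fundamental_theorem_of_calculus)
      fix x :: real
      have "of_real x + t \<in> strip b" using t by (simp add: strip_iff)
      from G'[OF this] have "((\<lambda>z. G (z + t)) has_field_derivative F (of_real x + t)) (at (of_real x))"
        by (simp add: DERIV_shift)
      then show "((\<lambda>x. G (of_real x + t)) has_vector_derivative F (of_real x + t)) (at x within {0..1})"
        by (rule has_vector_derivative_real_field)
    qed simp
    then show ?thesis by (simp add: integral_unique)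
  qed
  have "\<exists>c. \<forall>z\<in>strip b. G (z + 1) - G z = c"
  proof (rule has_field_derivative_zero_constant[OF convex_strip])
    fix z assume z: "z \<in> strip b"
    then have z1: "z + 1 \<in> strip b" by (simp add: strip_iff)
    have "((\<lambda>z. G (z + 1)) has_field_derivative F (z + 1)) (at z)"
      using G'[OF z1] by (simp add: DERIV_shift)
    then have "((\<lambda>z. G (z + 1) - G z) has_field_derivative F (z + 1) - F z) (at z)"
      using G'[OF z] by (intro derivative_intros)
    then show "((\<lambda>z. G (z + 1) - G z) has_field_derivative 0) (at z within strip b)"
      using per_hol_per[OF F z] by (simp add: has_field_derivative_at_within)
  qed
  then obtain c where c: "\<And>z. z \<in> strip b \<Longrightarrow> G (z + 1) - G z = c" by blast
  have "0 \<in> strip b" using strip_pos[OF w] by (simp add: strip_iff)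
  then show ?thesis using I[OF w] I[of 0] c[OF w] c[of 0] by (simp add: add.commute)
qed

definition fc :: "(complex \<Rightarrow> complex) \<Rightarrow> int \<Rightarrow> complex"
  where "fc f n = integral {0..1} (\<lambda>x::real. f (of_real x) * ee (- n) (of_real x))"

lemma fc_line:
  assumes "per_hol b f" "w \<in> strip b"
  shows "integral {0..1} (\<lambda>x::real. f (of_real x + w) * ee (- n) (of_real x + w)) = fc f n"
  unfolding fc_def using line_integral[OF per_hol_mult[OF assms(1) per_hol_ee] assms(2)] .

text \<open>Translation by any \<open>w\<close> in the strip is diagonal in the characters. Real
  \<open>w\<close> diagonalises the rotation; non-real \<open>w\<close> moves functions between
  horizontal lines.\<close>

lemma fc_shift:
  assumes "per_hol b f" "w \<in> strip b"
  shows "fc (\<lambda>z. f (z + w)) n = ee n w * fc f n"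
proof -
  have "fc (\<lambda>z. f (z + w)) n = integral {0..1} (\<lambda>x::real. ee n w * (f (of_real x + w) * ee (- n) (of_real x + w)))"
    unfolding fc_def by (intro integral_cong) (simp add: ee_add_arg ee_minus)
  then show ?thesis using fc_line[OF assms, of n] by simp
qed

lemma norm_integral_le_const:
  fixes f :: "real \<Rightarrow> complex"
  assumes "continuous_on {0..1} f" "\<And>x. x \<in> {0..1} \<Longrightarrow> norm (f x) \<le> B"
  shows "norm (integral {0..1} f) \<le> B"
  using integral_bound[OF _ assms(1), of B] assms(2) by simp

lemma fc_bound_line:
  assumes f: "per_hol b f" and y: "\<bar>y\<bar> < b" and M: "\<And>z. Im z = y \<Longrightarrow> norm (f z) \<le> M"
  shows "norm (fc f n) \<le> M * exp (2 * pi * of_int n * y)"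
  unfolding fc_line[OF f, of "\<i> * of_real y", symmetric, unfolded strip_iff, simplified, OF y]
proof (rule norm_integral_le_const)
  show "continuous_on {0..1} (\<lambda>x. f (of_real x + \<i> * of_real y) * ee (- n) (of_real x + \<i> * of_real y))"
    by (rule per_hol_cont_line[OF per_hol_mult[OF f per_hol_ee] y])
  fix x :: real
  have "norm (ee (-n) (of_real x + \<i> * of_real y)) = exp (2 * pi * of_int n * y)" by (simp add: norm_ee)
  then show "norm (f (of_real x + \<i> * of_real y) * ee (- n) (of_real x + \<i> * of_real y)) \<le> M * exp (2 * pi * of_int n * y)"
    using M[of "of_real x + \<i> * of_real y"] by (simp add: norm_mult)
qed

text \<open>The contour is pushed towards the boundary line on which \<open>ee (- n)\<close> is
  small, so the side depends on the sign of \<open>n\<close>. Letting \<open>c\<close> tend to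
  \<open>b\<close> gives the decay for the full width although \<open>f\<close> need not extend to
  the boundary.\<close>

lemma fc_bound:
  assumes f: "per_hol b f" and b: "0 < b" and M: "\<And>z. z \<in> strip b \<Longrightarrow> norm (f z) \<le> M"
  shows "norm (fc f n) \<le> M * wt (- b) n"
proof -
  have "norm (fc f n) \<le> M * wt (- c) n" if c: "0 < c" "c < b" for c
  proof -
    let ?y = "if n \<ge> 0 then - c else c"
    have "norm (fc f n) \<le> M * exp (2 * pi * of_int n * ?y)"
      using f by (rule fc_bound_line) (use c in \<open>auto intro!: M simp: strip_iff\<close>)
    also have "exp (2 * pi * of_int n * ?y) = wt (- c) n" by (auto simp: wt_def mult_ac)
    finally show ?thesis .
  qed
  then have "\<forall>\<^sub>F c in at_left b. norm (fc f n) \<le> M * wt (- c) n"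
    using b by (auto simp: eventually_at_left intro: exI[of _ 0])
  moreover have "((\<lambda>c. M * wt (- c) n) \<longlongrightarrow> M * wt (- b) n) (at_left b)"
    unfolding wt_def by (intro tendsto_intros)
  ultimately show ?thesis
    by (intro tendsto_lowerbound[OF _ _ trivial_limit_at_left_real])
qed

lemma fc_norm_le:
  assumes "per_hol b f" "0 < b" "\<And>x::real. norm (f (of_real x)) \<le> M"
  shows "norm (fc f n) \<le> M"
proof -
  have "norm (fc f n) \<le> M * exp (2 * pi * of_int n * 0)"
    using assms(1) by (rule fc_bound_line) (use assms in \<open>auto intro: complex_eq_iff simp: complex_is_Real_iff\<close>,
      metis Reals_cases complex_is_Real_iff)
  then show ?thesis by simp
qed

lemma fc_integrable:
  assumes "per_hol b f" "0 < b"
  shows "(\<lambda>x::real. f (of_real x) * ee (- n) (of_real x)) integrable_on {0..1}"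
  by (intro integrable_continuous_real per_hol_cont_real[OF per_hol_mult[OF assms(1) per_hol_ee] assms(2)])

lemma fc_add: "per_hol b f \<Longrightarrow> per_hol b g \<Longrightarrow> 0 < b \<Longrightarrow> fc (\<lambda>z. f z + g z) n = fc f n + fc g n"
  unfolding fc_def by (simp add: fc_integrable distrib_right Henstock_Kurzweil_Integration.integral_add)

lemma fc_diff: "per_hol b f \<Longrightarrow> per_hol b g \<Longrightarrow> 0 < b \<Longrightarrow> fc (\<lambda>z. f z - g z) n = fc f n - fc g n"
  unfolding fc_def by (simp add: fc_integrable left_diff_distrib Henstock_Kurzweil_Integration.integral_diff)

lemma fc_cmult: "fc (\<lambda>z. c * f z) n = c * fc f n"
  unfolding fc_def by (simp add: mult.assoc)

lemma fc_cong: "(\<And>x::real. f (of_real x) = g (of_real x)) \<Longrightarrow> fc f n = fc g n"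
  by (simp add: fc_def)

lemma fc_sum: "finite I \<Longrightarrow> (\<And>i. i \<in> I \<Longrightarrow> per_hol b (f i)) \<Longrightarrow> 0 < b \<Longrightarrow> fc (\<lambda>z. \<Sum>i\<in>I. f i z) n = (\<Sum>i\<in>I. fc (f i) n)"
proof (induction I rule: finite_induct)
  case empty then show ?case by (simp add: fc_def)
next
  case (insert i I)
  have "fc (\<lambda>z. f i z + (\<Sum>i\<in>I. f i z)) n = fc (f i) n + fc (\<lambda>z. \<Sum>i\<in>I. f i z) n"
    using insert by (intro fc_add[of b]) (auto intro!: per_hol_sum)
  then show ?case using insert by simp
qed

text \<open>Integration by parts over one period; the boundary terms cancel by periodicity.\<close>

lemma fc_deriv_eq:
  assumes f: "per_hol b f" "0 < b"
  shows "fc (deriv f) n = 2 * of_real pi * \<i> * of_int n * fc f n"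
proof -
  have d: "(f has_field_derivative deriv f z) (at z)" if "z \<in> strip b" for z
    using per_hol_holo[OF f(1)] that open_strip holomorphic_derivI by blast
  let ?F = "\<lambda>z. f z * ee (- n) z"
  have "((\<lambda>x::real. deriv f (of_real x) * ee (-n) (of_real x) + f (of_real x) * (2 * of_real pi * \<i> * of_int (-n) * ee (-n) (of_real x)))
     has_integral (?F (of_real 1) - ?F (of_real 0))) {0..1}"
  proof (rule fundamental_theorem_of_calculus)
    fix x :: real
    have "(?F has_field_derivative (deriv f (of_real x) * ee (-n) (of_real x) + (2 * of_real pi * \<i> * of_int (-n) * ee (-n) (of_real x)) * f (of_real x))) (at (of_real x))"
      by (rule DERIV_mult[OF d ee_has_field_derivative]) (use f in simp)
    then have "(?F has_field_derivative (deriv f (of_real x) * ee (-n) (of_real x) + f (of_real x) * (2 * of_real pi * \<i> * of_int (-n) * ee (-n) (of_real x)))) (at (of_real x))"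
      by (simp add: mult_ac)
    then show "((\<lambda>x. ?F (of_real x)) has_vector_derivative (deriv f (of_real x) * ee (-n) (of_real x) + f (of_real x) * (2 * of_real pi * \<i> * of_int (-n) * ee (-n) (of_real x)))) (at x within {0..1})"
      by (rule has_vector_derivative_real_field)
  qed simp
  moreover have "?F (of_real 1) - ?F (of_real 0) = 0"
    using per_hol_per[OF f(1), of 0] f(2) ee_one[of "-n"] by (simp add: strip_iff)
  ultimately have "((\<lambda>x::real. deriv f (of_real x) * ee (-n) (of_real x) + f (of_real x) * (2 * of_real pi * \<i> * of_int (-n) * ee (-n) (of_real x))) has_integral 0) {0..1}"
    by simp
  moreover have "((\<lambda>x::real. (2 * of_real pi * \<i> * of_int n) * (f (of_real x) * ee (- n) (of_real x))) has_integral
      (2 * of_real pi * \<i> * of_int n) * fc f n) {0..1}"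
    unfolding fc_def by (intro has_integral_mult_right integrable_integral fc_integrable[OF f])
  ultimately have "((\<lambda>x::real. deriv f (of_real x) * ee (-n) (of_real x)) has_integral
      0 + (2 * of_real pi * \<i> * of_int n) * fc f n) {0..1}"
    by (rule has_integral_eq[OF _ has_integral_add, rotated]) (simp add: algebra_simps)
  then show ?thesis unfolding fc_def by (simp add: integral_unique)
qed

lemma per_hol_deriv: 
  assumes "per_hol b f" shows "per_hol b (deriv f)"
proof (rule per_holI)
  show "deriv f holomorphic_on strip b" using assms per_hol_holo holomorphic_deriv open_strip by blast
  fix z assume z: "z \<in> strip b"
  then have z1: "z + 1 \<in> strip b" by (simp add: strip_iff)
  have "(f has_field_derivative deriv f (z + 1)) (at (z + 1))"
    using per_hol_holo[OF assms] z1 open_strip holomorphic_derivI by blast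
  then have "((\<lambda>w. f (w + 1)) has_field_derivative deriv f (z + 1)) (at z)" by (simp add: DERIV_shift)
  then have "(f has_field_derivative deriv f (z + 1)) (at z)"
    by (rule has_field_derivative_transform_within_open[OF _ open_strip z]) (use per_hol_per[OF assms] in auto)
  then show "deriv f (z + 1) = deriv f z" using DERIV_imp_deriv by metis
qed

text \<open>Differentiation multiplies \<open>ee m\<close> by a factor proportional to
  \<open>m\<close>, while by \<open>fc_deriv_eq\<close> it multiplies the coefficient at
  \<open>n\<close> by the same factor with \<open>n\<close>. For distinct indices the coefficient
  must vanish.\<close>

lemma fc_ee: "fc (ee m) n = (if m = n then 1 else 0)"
proof (cases "m = n")
  case True
  have "fc (ee m) n = integral {0..1} (\<lambda>x::real. 1)" unfolding fc_def
    by (intro integral_cong) (simp add: True ee_minus)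
  then show ?thesis using True by simp
next
  case False
  have "fc (deriv (ee m)) n = 2 * of_real pi * \<i> * of_int n * fc (ee m) n"
    by (rule fc_deriv_eq[OF per_hol_ee, of 1]) simp
  moreover have "deriv (ee m) = (\<lambda>z. 2 * of_real pi * \<i> * of_int m * ee m z)"
    by (rule ext, rule DERIV_imp_deriv, rule ee_has_field_derivative)
  ultimately have "2 * of_real pi * \<i> * of_int m * fc (ee m) n = 2 * of_real pi * \<i> * of_int n * fc (ee m) n"
    by (simp add: fc_cmult)
  then show ?thesis using False by simp
qed

lemma fc_const: "fc (\<lambda>_. c) n = (if n = 0 then c else 0)"
proof -
  have "fc (\<lambda>z. c * ee 0 z) n = c * (if 0 = n then 1 else 0)" by (simp only: fc_cmult fc_ee)
  then show ?thesis by auto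
qed

lemma per_hol_shift_strip:
  assumes f: "per_hol b f" and c: "\<bar>Im c\<bar> + d \<le> b"
  shows "per_hol d (\<lambda>z. f (z + c))"
proof (rule per_holI)
  have s: "z + c \<in> strip b" if "z \<in> strip d" for z using that c by (auto simp: strip_iff)
  have "(f \<circ> (\<lambda>z. z + c)) holomorphic_on strip d"
    by (rule holomorphic_on_compose_gen[OF _ per_hol_holo[OF f]]) (auto intro!: holomorphic_intros s)
  then show "(\<lambda>z. f (z + c)) holomorphic_on strip d" by (simp add: o_def)
  show "f (z + 1 + c) = f (z + c)" if "z \<in> strip d" for z
    using per_hol_per[OF f s[OF that]] by (simp add: add_ac)
qed

lemma per_hol_of_int:
  assumes f: "per_hol b f" and z: "z \<in> strip b"
  shows "f (z + of_int n) = f z"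
proof -
  have nat: "f (w + of_nat k) = f w" if "w \<in> strip b" for w k
  proof (induction k)
    case (Suc k)
    have "f (w + of_nat k + 1) = f (w + of_nat k)"
      by (rule per_hol_per[OF f]) (use that in \<open>simp add: strip_add_real\<close>)
    then show ?case using Suc by (simp add: add_ac)
  qed simp
  show ?thesis
  proof (cases n)
    case (nonneg k) then show ?thesis using nat[OF z] by simp
  next
    case (neg k)
    have "f (z + of_int n + of_nat (Suc k)) = f (z + of_int n)"
      by (rule nat) (use z in \<open>simp add: strip_add_real\<close>)
    moreover have "z + of_int n + of_nat (Suc k) = z" by (simp add: neg)
    ultimately show ?thesis by metis
  qed
qed

lemma per_hol_bounded:
  assumes f: "per_hol b f" and c: "c < b"
  obtains M where "\<And>z. \<bar>Im z\<bar> \<le> c \<Longrightarrow> norm (f z) \<le> M"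
proof -
  let ?K = "cbox (Complex 0 (-c)) (Complex 1 c)"
  have sub: "?K \<subseteq> strip b" using c by (auto simp: in_cbox_complex_iff strip_iff)
  have "continuous_on ?K f"
    using holomorphic_on_imp_continuous_on[OF per_hol_holo[OF f]] sub continuous_on_subset by blast
  then have "compact (f ` ?K)" by (rule compact_continuous_image) simp
  then obtain M where M: "\<And>w. w \<in> ?K \<Longrightarrow> norm (f w) \<le> M"
    using compact_imp_bounded bounded_iff by (metis image_eqI)
  have "norm (f z) \<le> M" if z: "\<bar>Im z\<bar> \<le> c" for z
  proof -
    have "f (z + of_int (- \<lfloor>Re z\<rfloor>)) = f z"
      by (rule per_hol_of_int[OF f]) (use z c in \<open>simp add: strip_iff\<close>)
    moreover have "z + of_int (- \<lfloor>Re z\<rfloor>) \<in> ?K"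
      using z by (simp add: in_cbox_complex_iff) (simp add: abs_le_iff; linarith)
    ultimately show ?thesis using M by metis
  qed
  then show ?thesis by (rule that)
qed

lemma fc_ee_mult: "fc (\<lambda>z. ee k z * f z) n = fc f (n - k)"
  unfolding fc_def
proof (rule integral_cong)
  fix x :: real
  have "ee (- (n - k)) (of_real x) = ee k (of_real x) * ee (- n) (of_real x)"
    by (simp flip: ee_add)
  then show "ee k (of_real x) * f (of_real x) * ee (- n) (of_real x) = f (of_real x) * ee (- (n - k)) (of_real x)"
    by simp
qed

text \<open>The quadratic factor is a common majorant for what is later charged to a mode: 1 for a
  composition, \<open>2 * pi * \<bar>n\<bar>\<close> for a difference of compositions, and
  \<open>2 * pi * \<bar>n\<bar> * \<bar>n\<bar>\<close> for a derivative together with a small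
  divisor.\<close>

lemma weight_summable:
  assumes t: "0 < t"
  shows "(\<lambda>n::int. (1 + 2 * pi * \<bar>of_int n\<bar>) ^ 2 * wt (- t) n) summable_on UNIV"
proof -
  \<comment> \<open>A quarter of \<open>t\<close> for each of the two factors \<open>1 + x\<close>,
    through \<open>1 + x \<le> (1 + 1 / s) * exp (s * x)\<close>; the remaining half of
    \<open>t\<close> leaves a geometric series.\<close>
  define s where "s = t / 4"
  have s: "0 < s" using t by (simp add: s_def)
  define q where "q = exp (- (2 * pi * (t / 2)))"
  have q: "0 < q" "q < 1" using t by (auto simp: q_def)
  have le: "(1 + 2 * pi * \<bar>of_int n\<bar>) ^ 2 * wt (- t) n \<le> (1 + 1 / s) ^ 2 * q ^ nat \<bar>n\<bar>" for n :: int
  proof -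
    define x where "x = 2 * pi * \<bar>real_of_int n\<bar>"
    have x: "0 \<le> x" by (simp add: x_def)
    have "1 + x \<le> (1 + 1 / s) * (1 + s * x)" using s x by (simp add: field_simps)
    also have "\<dots> \<le> (1 + 1 / s) * exp (s * x)" using s by (intro mult_left_mono exp_ge_add_one_self) auto
    finally have "(1 + x) ^ 2 \<le> ((1 + 1 / s) * exp (s * x)) ^ 2" using x by (intro power_mono) auto
    then have "(1 + x) ^ 2 * exp (- t * x) \<le> (1 + 1 / s) ^ 2 * (exp (s * x) ^ 2 * exp (- t * x))"
      by (simp add: power_mult_distrib)
    also have "exp (s * x) ^ 2 * exp (- t * x) = exp (- (t / 2) * x)"
      by (simp add: s_def algebra_simps flip: exp_of_nat_mult exp_add exp_double)
    also have "\<dots> = q ^ nat \<bar>n\<bar>"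
      by (simp add: q_def x_def algebra_simps flip: exp_of_nat_mult)
    finally show ?thesis by (simp add: x_def wt_def mult_ac)
  qed
  have N: "(\<lambda>n. (1 + 1 / s) ^ 2 * q ^ n) summable_on UNIV"
    using q by (intro norm_summable_imp_summable_on) (auto simp: norm_mult norm_power intro!: summable_mult summable_geometric)
  have A: "(\<lambda>n. (1 + 1 / s) ^ 2 * q ^ nat \<bar>n\<bar>) summable_on range int"
    using N by (subst summable_on_reindex) (auto simp: o_def)
  have B: "(\<lambda>n. (1 + 1 / s) ^ 2 * q ^ nat \<bar>n\<bar>) summable_on range (\<lambda>n. - int n)"
    using N by (subst summable_on_reindex) (auto simp: o_def inj_def)
  have "(\<lambda>n. (1 + 1 / s) ^ 2 * q ^ nat \<bar>n\<bar>) summable_on (range int \<union> range (\<lambda>n. - int n))"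
    by (rule summable_on_union[OF A B])
  also have "range int \<union> range (\<lambda>n. - int n) = UNIV"
    by (auto, metis int_cases2 rangeI)
  finally show ?thesis
    by (rule summable_on_comparison_test) (use le in auto)
qed

text \<open>The constant paid for narrowing a strip by \<open>t\<close>: the sum of the decay that
  the narrowing leaves over, with the quadratic factor included.\<close>

definition cs :: "real \<Rightarrow> real"
  where "cs t = (\<Sum>\<^sub>\<infinity>n::int. (1 + 2 * pi * \<bar>of_int n\<bar>) ^ 2 * wt (- t) n)"

lemma weight_sum_le:
  assumes "0 < t" "finite F"
  shows "(\<Sum>n\<in>F. (1 + 2 * pi * \<bar>of_int n\<bar>) ^ 2 * wt (- t) n) \<le> cs t"
  unfolding cs_def by (rule finite_sum_le_infsum[OF weight_summable]) (use assms in auto)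

lemma cs_ge1: "0 < t \<Longrightarrow> 1 \<le> cs t"
  using weight_sum_le[of t "{0}"] by (simp add: wt_def)

lemma weight_factor_le1: "1 \<le> (1 + 2 * pi * \<bar>of_int n\<bar>) ^ 2"
  by (simp add: power_increasing[of 0])

lemma weight_factor_le2: "2 * pi * \<bar>of_int n\<bar> \<le> (1 + 2 * pi * \<bar>of_int n\<bar>) ^ 2"
  by (simp add: power2_eq_square algebra_simps)

text \<open>With \<open>F z = (f z - f z0) / (ee 1 (z - z0) - 1)\<close>, which extends holomorphically over \<open>z0 + \<int>\<close>, the identity
  \<open>(ee 1 (z - z0) - 1) * F z = f z - f z0\<close> telescopes on the level of Fourier coefficients.\<close>

lemma fourier_telescope:
  assumes f: "per_hol b f" and z0: "z0 \<in> strip b"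
  obtains F where "per_hol b F"
    "\<And>N::nat. (\<Sum>n\<in>{- int N..int N}. fc f n * ee n z0) = f z0 + fc F (- int N - 1) * ee (- int N - 1) z0 - fc F (int N) * ee (int N) z0"
proof -
  have b: "0 < b" using strip_pos[OF z0] .
  define Q where "Q = (\<lambda>z. ee 1 (z - z0) - 1)"
  \<comment> \<open>The value at the zeros of \<open>Q\<close> is the limit of the quotient by
    l'Hopital: \<open>Q\<close> has derivative \<open>2 * pi * \<i>\<close> there and
    \<open>deriv f\<close> is periodic.\<close>
  define F where "F = (\<lambda>z. if Q z = 0 then deriv f z0 / (2 * of_real pi * \<i>) else (f z - f z0) / Q z)"
  have Q_hol: "Q holomorphic_on A" for A unfolding Q_def by (intro holomorphic_intros)
  have Q_per: "Q (z + 1) = Q z" for z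
    using ee_add_arg[of 1 "z - z0" 1] by (simp add: Q_def add_diff_eq add.commute)
  have f0: "f z = f z0" if "Q z = 0" for z
  proof -
    have "z - z0 \<in> \<int>" using that ee_eq_1_iff[of 1 "z - z0"] by (simp add: Q_def)
    then obtain m where "z = z0 + of_int m" by (auto elim!: Ints_cases simp: diff_eq_eq add.commute)
    then show ?thesis using per_hol_of_int[OF f z0] by simp
  qed
  have FQ: "F z * Q z = f z - f z0" for z
    using f0 by (simp add: F_def)
  have df: "(f has_field_derivative deriv f z) (at z)" if "z \<in> strip b" for z
    using per_hol_holo[OF f] that open_strip holomorphic_derivI by blast
  have "F field_differentiable at a" if a: "a \<in> strip b" for a
  proof (cases "Q a = 0")
    case False
    have op: "open {z \<in> strip b. Q z \<noteq> 0}"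
    proof -
      have "continuous_on (strip b) Q" using Q_hol holomorphic_on_imp_continuous_on by blast
      then have "open (strip b \<inter> Q -` (- {0}))" by (intro continuous_open_preimage open_strip) auto
      also have "strip b \<inter> Q -` (- {0}) = {z \<in> strip b. Q z \<noteq> 0}" by auto
      finally show ?thesis .
    qed
    have "(\<lambda>z. (f z - f z0) / Q z) holomorphic_on {z \<in> strip b. Q z \<noteq> 0}"
      by (intro holomorphic_intros Q_hol) (auto intro: holomorphic_on_subset[OF per_hol_holo[OF f]])
    then have "F holomorphic_on {z \<in> strip b. Q z \<noteq> 0}"
      by (rule holomorphic_transform) (simp add: F_def)
    then show ?thesis using op a False by (auto intro: holomorphic_on_imp_differentiable_at)
  next
    case True
    then have ai: "a - z0 \<in> \<int>" using ee_eq_1_iff[of 1 "a - z0"] by (simp add: Q_def)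
    then obtain m where m: "a = z0 + of_int m" by (auto elim!: Ints_cases simp: diff_eq_eq add.commute)
    have dfa: "deriv f a = deriv f z0" using m per_hol_of_int[OF per_hol_deriv[OF f] z0] by simp
    have dQ: "(Q has_field_derivative 2 * of_real pi * \<i>) (at a)"
    proof -
      have "((\<lambda>z. ee 1 (z + - z0)) has_field_derivative 2 * of_real pi * \<i> * of_int 1 * ee 1 (a + - z0)) (at a)"
        by (subst DERIV_shift[symmetric]) (rule ee_has_field_derivative)
      then show ?thesis using True unfolding Q_def by (auto intro!: derivative_eq_intros)
    qed
    define S where "S = strip b \<inter> ball a (1 / 2)"
    have S: "open S" "a \<in> S" using a open_strip by (auto simp: S_def)
    have nz: "Q z \<noteq> 0" if "z \<in> S - {a}" for z
    proof
      assume "Q z = 0"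
      then have "z - z0 \<in> \<int>" using ee_eq_1_iff[of 1 "z - z0"] by (simp add: Q_def)
      then have "z - a \<in> \<int>" using ai Ints_diff[of "z - z0" "a - z0"] by simp
      moreover have "norm (z - a) < 1 / 2" using that by (simp add: S_def dist_norm norm_minus_commute)
      ultimately obtain k where k: "z - a = of_int k" "norm (z - a) < 1 / 2" by (metis Ints_cases)
      then have "\<bar>real_of_int k\<bar> < 1 / 2" by simp
      then have "k = 0" by linarith
      then show False using that k(1) by simp
    qed
    have lim: "(F \<longlongrightarrow> F a) (at a)"
    proof -
      have "((\<lambda>z. (f z - f z0) / Q z) \<longlongrightarrow> deriv f z0 / (2 * of_real pi * \<i>)) (at a)"
      proof (rule lhopital_complex_simple)
        show "((\<lambda>z. f z - f z0) has_field_derivative deriv f z0) (at a)"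
          using df[OF a] dfa by (auto intro!: derivative_eq_intros)
        show "(Q has_field_derivative 2 * of_real pi * \<i>) (at a)" by (rule dQ)
      qed (use True f0 in auto)
      moreover have "F a = deriv f z0 / (2 * of_real pi * \<i>)" using True by (simp add: F_def)
      moreover have "\<forall>\<^sub>F z in at a. (f z - f z0) / Q z = F z"
        using S nz unfolding eventually_at_topological by (intro exI[of _ S]) (auto simp: F_def)
      ultimately show ?thesis by (auto intro: Lim_transform_eventually)
    qed
    have "F holomorphic_on S"
    proof (rule no_isolated_singularity')
      show "(F \<longlongrightarrow> F z) (at z within S)" if "z \<in> {a}" for z
        using lim that tendsto_within_subset by blast
      have "(\<lambda>z. (f z - f z0) / Q z) holomorphic_on S - {a}"
        by (intro holomorphic_intros Q_hol nz) (auto simp: S_def intro: holomorphic_on_subset[OF per_hol_holo[OF f]])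
      then show "F holomorphic_on S - {a}"
        by (rule holomorphic_transform) (use nz in \<open>auto simp: F_def\<close>)
    qed (use S in auto)
    then show ?thesis using S holomorphic_on_imp_differentiable_at by blast
  qed
  then have "F holomorphic_on strip b"
    by (simp add: holomorphic_on_def field_differentiable_at_within)
  then have F: "per_hol b F"
    using per_hol_per[OF f] by (intro per_holI) (auto simp: F_def Q_per)
  have step: "fc f n * ee n z0 = (if n = 0 then f z0 else 0) + fc F (n - 1) * ee (n - 1) z0 - fc F n * ee n z0" for n
  proof -
    have "fc f n - (if n = 0 then f z0 else 0) = fc (\<lambda>z. f z - f z0) n"
      by (simp add: fc_diff[OF f per_hol_const b] fc_const)
    also have "\<dots> = fc (\<lambda>z. ee (- 1) z0 * (ee 1 z * F z) - F z) n"
      unfolding FQ[symmetric] Q_def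
      by (intro fc_cong) (simp add: ee_add_arg[of 1 _ "- z0", unfolded add_uminus_conv_diff] ee_minus, simp add: ee_def exp_minus algebra_simps)
    also have "\<dots> = ee (- 1) z0 * fc F (n - 1) - fc F n"
      by (simp add: fc_diff[OF per_hol_mult[OF per_hol_const per_hol_mult[OF per_hol_ee F]] F b] fc_cmult fc_ee_mult)
    finally have "(fc f n - (if n = 0 then f z0 else 0)) * ee n z0 = (ee (- 1) z0 * fc F (n - 1) - fc F n) * ee n z0" by simp
    moreover have "ee (- 1) z0 * ee n z0 = ee (n - 1) z0" by (simp flip: ee_add)
    ultimately show ?thesis by (cases "n = 0") (simp_all add: algebra_simps)
  qed
  have "(\<Sum>n\<in>{- int N..int N}. fc f n * ee n z0) = f z0 + fc F (- int N - 1) * ee (- int N - 1) z0 - fc F (int N) * ee (int N) z0" for N :: nat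
  proof (induction N)
    case 0 then show ?case using step[of 0] by simp
  next
    case (Suc N)
    have "{- int (Suc N)..int (Suc N)} = insert (- int N - 1) (insert (int N + 1) {- int N..int N})" by auto
    then have "(\<Sum>n\<in>{- int (Suc N)..int (Suc N)}. fc f n * ee n z0) =
       fc f (- int N - 1) * ee (- int N - 1) z0 + (fc f (int N + 1) * ee (int N + 1) z0 + (\<Sum>n\<in>{- int N..int N}. fc f n * ee n z0))"
      by simp
    also have "\<dots> = f z0 + fc F (- int (Suc N) - 1) * ee (- int (Suc N) - 1) z0 - fc F (int (Suc N)) * ee (int (Suc N)) z0"
      unfolding Suc step[of "- int N - 1"] step[of "int N + 1"] by (simp add: algebra_simps)
    finally show ?case .
  qed
  then show ?thesis using F that by blast
qed

text \<open>Links unordered summation over the integers, in which the norm estimates are made, with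
  the symmetric partial sums, in which Fourier sums telescope.\<close>

lemma summable_on_intervals:
  fixes a :: "int \<Rightarrow> 'a :: {t2_space, comm_monoid_add}"
  assumes "(a has_sum s) UNIV"
  shows "(\<lambda>N. \<Sum>n\<in>{- int N..int N}. a n) \<longlonglongrightarrow> s"
proof -
  have "filterlim (\<lambda>N. {- int N..int N}) (finite_subsets_at_top UNIV) sequentially"
    unfolding filterlim_finite_subsets_at_top
  proof (intro allI impI)
    fix X :: "int set" assume X: "finite X \<and> X \<subseteq> UNIV"
    define M where "M = (\<Sum>x\<in>X. nat \<bar>x\<bar>)"
    have "nat \<bar>x\<bar> \<le> M" if "x \<in> X" for x using X that unfolding M_def by (intro member_le_sum) auto
    then have "\<forall>x\<in>X. \<bar>x\<bar> \<le> int M" by (meson nat_le_iff)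
    then show "\<forall>\<^sub>F N in sequentially. finite {- int N..int N} \<and> X \<subseteq> {- int N..int N} \<and> {- int N..int N} \<subseteq> UNIV"
      by (intro eventually_mono[OF eventually_ge_at_top[of M]]) force
  qed
  then show ?thesis using assms unfolding has_sum_def by (rule filterlim_compose[rotated])
qed

text \<open>The decay of the coefficients on a strip of half-width between
  \<open>\<bar>Im z\<bar>\<close> and \<open>b\<close> makes the series absolutely summable. Its
  value is identified by the symmetric partial sums: the two boundary terms of the telescoped form
  tend to 0, because \<open>F\<close> is holomorphic on the same strip and its coefficients decay
  alike.\<close>

lemma fourier_expansion:
  assumes f: "per_hol b f" and z: "z \<in> strip b"
  shows "((\<lambda>n. fc f n * ee n z) has_sum f z) UNIV"
proof -
  obtain F where F: "per_hol b F" and tel: "\<And>N::nat. (\<Sum>n\<in>{- int N..int N}. fc f n * ee n z) = f z + fc F (- int N - 1) * ee (- int N - 1) z - fc F (int N) * ee (int N) z"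
    using fourier_telescope[OF f z] by blast
  obtain c where c: "\<bar>Im z\<bar> < c" "c < b" using z dense by (auto simp: strip_iff)
  define t where "t = c - \<bar>Im z\<bar>"
  have t: "0 < t" using c by (simp add: t_def)
  have dec: "\<exists>M\<ge>0. \<forall>n. norm (fc G n * ee n z) \<le> M * wt (- t) n" if G: "per_hol b G" for G
  proof -
    obtain M where M: "\<And>z. \<bar>Im z\<bar> \<le> c \<Longrightarrow> norm (G z) \<le> M" using per_hol_bounded[OF G c(2)] by blast
    have M0: "0 \<le> M" using M[of 0] c by (smt (verit) norm_ge_zero zero_complex.sel(2))
    have "norm (fc G n * ee n z) \<le> M * wt (- t) n" for n
    proof -
      have "norm (fc G n) \<le> M * wt (- c) n"
        by (rule fc_bound[OF per_hol_mono[OF G]]) (use c M in \<open>auto simp: strip_iff\<close>)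
      moreover have "norm (ee n z) \<le> wt \<bar>Im z\<bar> n" by (rule norm_ee_le) simp
      ultimately have "norm (fc G n * ee n z) \<le> (M * wt (- c) n) * wt \<bar>Im z\<bar> n"
        unfolding norm_mult by (intro mult_mono) (auto simp: M0)
      also have "\<dots> = M * wt (- t) n" by (simp add: t_def flip: wt_add)
      finally show ?thesis .
    qed
    then show ?thesis using M0 by blast
  qed
  obtain M where M: "0 \<le> M" "\<And>n. norm (fc f n * ee n z) \<le> M * wt (- t) n" using dec[OF f] by blast
  have "(\<lambda>n. M * ((1 + 2 * pi * \<bar>of_int n\<bar>) ^ 2 * wt (- t) n)) summable_on UNIV"
    by (intro summable_on_cmult_right weight_summable t)
  then have "(\<lambda>n. norm (fc f n * ee n z)) summable_on UNIV"
  proof (rule summable_on_comparison_test)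
    fix n :: int
    have "M * (1 * wt (- t) n) \<le> M * ((1 + 2 * pi * \<bar>of_int n\<bar>) ^ 2 * wt (- t) n)"
      by (intro mult_left_mono mult_right_mono weight_factor_le1 M) auto
    then show "norm (fc f n * ee n z) \<le> M * ((1 + 2 * pi * \<bar>of_int n\<bar>) ^ 2 * wt (- t) n)" using M(2)[of n] by simp
  qed auto
  then have "(\<lambda>n. fc f n * ee n z) summable_on UNIV"
    by (rule abs_summable_summable)
  then obtain s where s: "((\<lambda>n. fc f n * ee n z) has_sum s) UNIV"
    unfolding summable_on_def by blast
  obtain M' where M': "0 \<le> M'" "\<And>n. norm (fc F n * ee n z) \<le> M' * wt (- t) n" using dec[OF F] by blast
  have q: "exp (- (2 * pi * t)) < 1" using t by simp
  have lim0: "(\<lambda>N. fc F (g N) * ee (g N) z) \<longlonglongrightarrow> 0" if g: "\<And>N. int N \<le> \<bar>g N\<bar>" for g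
  proof (rule Lim_null_comparison)
    have "wt (- t) (g N) \<le> exp (- (2 * pi * t)) ^ N" for N
    proof -
      have "real N \<le> \<bar>of_int (g N)\<bar>" using g[of N] by linarith
      then have "2 * pi * t * real N \<le> 2 * pi * t * \<bar>of_int (g N)\<bar>" using t by (intro mult_left_mono) auto
      then show ?thesis by (simp add: wt_def mult_ac flip: exp_of_nat_mult)
    qed
    then show "\<forall>\<^sub>F N in sequentially. norm (fc F (g N) * ee (g N) z) \<le> M' * exp (- (2 * pi * t)) ^ N"
      using M' by (intro always_eventually allI) (meson mult_left_mono order_trans)
    show "(\<lambda>N. M' * exp (- (2 * pi * t)) ^ N) \<longlonglongrightarrow> 0"
      using q by (intro tendsto_mult_right_zero LIMSEQ_power_zero) simp
  qed
  have "(\<lambda>N. f z + fc F (- int N - 1) * ee (- int N - 1) z - fc F (int N) * ee (int N) z) \<longlonglongrightarrow> f z + 0 - 0"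
    by (intro tendsto_intros lim0) auto
  then have "(\<lambda>N. \<Sum>n\<in>{- int N..int N}. fc f n * ee n z) \<longlonglongrightarrow> f z" by (simp add: tel)
  with summable_on_intervals[OF s] have "s = f z" using LIMSEQ_unique by blast
  then show ?thesis using s by simp
qed

lemma per_hol_eqI:
  assumes "per_hol b f" "per_hol b g" "\<And>n. fc f n = fc g n" "z \<in> strip b"
  shows "f z = g z"
  using fourier_expansion[OF assms(1,4)] fourier_expansion[OF assms(2,4)] assms(3)
  by (simp add: has_sum_unique)

section \<open>The weighted Wiener algebra\<close>

text \<open>\<open>WB \<rho> f B\<close>: the norm of \<open>f\<close> in the weighted Wiener algebra is at most \<open>B\<close>. Stating this through
  finite partial sums avoids summability side conditions.\<close>

definition WB :: "real \<Rightarrow> (complex \<Rightarrow> complex) \<Rightarrow> real \<Rightarrow> bool"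
  where "WB \<rho> f B \<longleftrightarrow> per_hol \<rho> f \<and> (\<forall>F. finite F \<longrightarrow> (\<Sum>n\<in>F. norm (fc f n) * wt \<rho> n) \<le> B)"

lemma WB_I: "per_hol \<rho> f \<Longrightarrow> (\<And>F. finite F \<Longrightarrow> (\<Sum>n\<in>F. norm (fc f n) * wt \<rho> n) \<le> B) \<Longrightarrow> WB \<rho> f B"
  by (simp add: WB_def)

lemma WB_D: "WB \<rho> f B \<Longrightarrow> finite F \<Longrightarrow> (\<Sum>n\<in>F. norm (fc f n) * wt \<rho> n) \<le> B"
  by (simp add: WB_def)

lemma WB_per_hol: "WB \<rho> f B \<Longrightarrow> per_hol \<rho> f"
  by (simp add: WB_def)

lemma WB_nonneg: "WB \<rho> f B \<Longrightarrow> 0 \<le> B"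
  using WB_D[of \<rho> f B "{}"] by simp

lemma WB_mono: "WB \<rho> f A \<Longrightarrow> A \<le> B \<Longrightarrow> WB \<rho> f B"
  unfolding WB_def by fastforce

lemma WB_fc: "WB \<rho> f B \<Longrightarrow> norm (fc f n) * wt \<rho> n \<le> B"
  using WB_D[of \<rho> f B "{n}"] by simp

lemma WB_fc0: "WB \<rho> f B \<Longrightarrow> norm (fc f 0) \<le> B"
  using WB_fc[of \<rho> f B 0] by (simp add: wt_def)

context
  fixes \<rho> :: real
  assumes \<rho>: "0 < \<rho>"
begin

lemma WB_cong:
  assumes "WB \<rho> f B" "\<And>z. z \<in> strip \<rho> \<Longrightarrow> f z = g z"
  shows "WB \<rho> g B"
proof -
  have "fc g n = fc f n" for n by (rule fc_cong) (simp add: assms(2) \<rho>)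
  then show ?thesis using assms per_hol_cong[of \<rho> f g] by (simp add: WB_def)
qed

lemma WB_norm:
  assumes f: "WB \<rho> f B" and z: "z \<in> strip \<rho>"
  shows "norm (f z) \<le> B"
proof -
  have "((\<lambda>n. fc f n * ee n z) has_sum f z) UNIV"
    using fourier_expansion[OF WB_per_hol[OF f] z] .
  then have "((\<lambda>F. norm (\<Sum>n\<in>F. fc f n * ee n z)) \<longlongrightarrow> norm (f z)) (finite_subsets_at_top UNIV)"
    unfolding has_sum_def by (rule tendsto_norm)
  moreover have "\<forall>\<^sub>F F in finite_subsets_at_top UNIV. norm (\<Sum>n\<in>F. fc f n * ee n z) \<le> B"
  proof (rule eventually_finite_subsets_at_top_weakI)
    fix F :: "int set" assume F: "finite F"
    have "norm (\<Sum>n\<in>F. fc f n * ee n z) \<le> (\<Sum>n\<in>F. norm (fc f n) * wt \<rho> n)"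
      using z by (intro sum_norm_le) (auto simp: norm_mult strip_iff intro!: mult_left_mono norm_ee_le)
    also have "\<dots> \<le> B" by (rule WB_D[OF f F])
    finally show "norm (\<Sum>n\<in>F. fc f n * ee n z) \<le> B" .
  qed
  ultimately show ?thesis by (rule tendsto_upperbound) simp
qed

lemma WB_add:
  assumes f: "WB \<rho> f A" and g: "WB \<rho> g B"
  shows "WB \<rho> (\<lambda>z. f z + g z) (A + B)"
proof (rule WB_I)
  show "per_hol \<rho> (\<lambda>z. f z + g z)" using f g by (intro per_hol_add WB_per_hol)
  fix F :: "int set" assume F: "finite F"
  have "(\<Sum>n\<in>F. norm (fc (\<lambda>z. f z + g z) n) * wt \<rho> n) \<le> (\<Sum>n\<in>F. norm (fc f n) * wt \<rho> n + norm (fc g n) * wt \<rho> n)"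
    by (intro sum_mono) (simp add: fc_add[OF WB_per_hol[OF f] WB_per_hol[OF g] \<rho>] norm_triangle_ineq mult_right_mono flip: distrib_right)
  also have "\<dots> \<le> A + B" using WB_D[OF f F] WB_D[OF g F] by (simp add: sum.distrib)
  finally show "(\<Sum>n\<in>F. norm (fc (\<lambda>z. f z + g z) n) * wt \<rho> n) \<le> A + B" .
qed

lemma WB_cmult:
  assumes f: "WB \<rho> f A"
  shows "WB \<rho> (\<lambda>z. c * f z) (norm c * A)"
proof (rule WB_I)
  show "per_hol \<rho> (\<lambda>z. c * f z)" using f by (intro per_hol_mult per_hol_const WB_per_hol)
  fix F :: "int set" assume F: "finite F"
  have "(\<Sum>n\<in>F. norm (fc (\<lambda>z. c * f z) n) * wt \<rho> n) = norm c * (\<Sum>n\<in>F. norm (fc f n) * wt \<rho> n)"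
    by (simp add: fc_cmult norm_mult sum_distrib_left mult_ac)
  also have "\<dots> \<le> norm c * A" by (intro mult_left_mono WB_D[OF f F]) auto
  finally show "(\<Sum>n\<in>F. norm (fc (\<lambda>z. c * f z) n) * wt \<rho> n) \<le> norm c * A" .
qed

lemma WB_diff:
  assumes f: "WB \<rho> f A" and g: "WB \<rho> g B"
  shows "WB \<rho> (\<lambda>z. f z - g z) (A + B)"
  using WB_add[OF f WB_cmult[OF g, of "-1"]] by simp

lemma WB_minus_commute: "WB \<rho> (\<lambda>z. f z - g z) B \<Longrightarrow> WB \<rho> (\<lambda>z. g z - f z) B"
  using WB_cmult[of "\<lambda>z. f z - g z" B "-1"] by simp

lemma WB_const: "WB \<rho> (\<lambda>_. c) (norm c)"
proof (rule WB_I[OF per_hol_const])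
  fix F :: "int set" assume F: "finite F"
  have "(\<Sum>n\<in>F. norm (fc (\<lambda>_. c) n) * wt \<rho> n) = (\<Sum>n\<in>F. if n = 0 then norm c else 0)"
    by (intro sum.cong) (auto simp: fc_const wt_def)
  then show "(\<Sum>n\<in>F. norm (fc (\<lambda>_. c) n) * wt \<rho> n) \<le> norm c" using F by simp
qed

lemma WB_0: "WB \<rho> (\<lambda>_. 0) 0"
  using WB_const[of 0] by simp

lemma WB_sum:
  assumes "finite I" "\<And>i. i \<in> I \<Longrightarrow> WB \<rho> (f i) (B i)"
  shows "WB \<rho> (\<lambda>z. \<Sum>i\<in>I. f i z) (\<Sum>i\<in>I. B i)"
  using assms by (induction I rule: finite_induct) (auto simp: WB_0 intro: WB_add)

text \<open>A character shifts the coefficients by \<open>k\<close>, and submultiplicativity of the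
  weight pays for the shift.\<close>

lemma WB_ee_mult:
  assumes f: "WB \<rho> f A"
  shows "WB \<rho> (\<lambda>z. ee k z * f z) (wt \<rho> k * A)"
proof (rule WB_I)
  show "per_hol \<rho> (\<lambda>z. ee k z * f z)" using f by (intro per_hol_mult per_hol_ee WB_per_hol)
  fix F :: "int set" assume F: "finite F"
  have "(\<Sum>n\<in>F. norm (fc (\<lambda>z. ee k z * f z) n) * wt \<rho> n) \<le> (\<Sum>n\<in>F. wt \<rho> k * (norm (fc f (n - k)) * wt \<rho> (n - k)))"
  proof (rule sum_mono)
    fix n
    have "wt \<rho> n \<le> wt \<rho> k * wt \<rho> (n - k)" using wt_add_le[of \<rho> k "n - k"] \<rho> by simp
    then have "norm (fc f (n - k)) * wt \<rho> n \<le> norm (fc f (n - k)) * (wt \<rho> k * wt \<rho> (n - k))"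
      by (rule mult_left_mono) simp
    then show "norm (fc (\<lambda>z. ee k z * f z) n) * wt \<rho> n \<le> wt \<rho> k * (norm (fc f (n - k)) * wt \<rho> (n - k))"
      unfolding fc_ee_mult by (simp only: mult_ac)
  qed
  also have "\<dots> = wt \<rho> k * (\<Sum>n\<in>(\<lambda>n. n - k) ` F. norm (fc f n) * wt \<rho> n)"
    by (subst sum.reindex) (simp_all add: inj_on_def sum_distrib_left)
  also have "\<dots> \<le> wt \<rho> k * A" by (intro mult_left_mono WB_D[OF f] finite_imageI F) auto
  finally show "(\<Sum>n\<in>F. norm (fc (\<lambda>z. ee k z * f z) n) * wt \<rho> n) \<le> wt \<rho> k * A" .
qed

text \<open>A Fatou argument: each coefficient is continuous for uniform convergence on the real
  line, and the bound tests only finitely many coefficients at a time. Approximation on the real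
  line therefore suffices for a norm bound on the strip.\<close>

lemma WB_limit:
  assumes f: "per_hol \<rho> f"
    and lim: "\<And>e. e > 0 \<Longrightarrow> \<exists>g. WB \<rho> g B \<and> (\<forall>x::real. norm (f (of_real x) - g (of_real x)) \<le> e)"
  shows "WB \<rho> f B"
proof (rule WB_I[OF f])
  fix F :: "int set" assume F: "finite F"
  \<comment> \<open>The summand 1 keeps \<open>W\<close> positive when \<open>F\<close> is
    empty.\<close>
  define W where "W = (\<Sum>n\<in>F. wt \<rho> n) + 1"
  have W: "0 < W" unfolding W_def by (intro add_nonneg_pos sum_nonneg) auto
  show "(\<Sum>n\<in>F. norm (fc f n) * wt \<rho> n) \<le> B"
  proof (rule field_le_epsilon)
    fix e :: real assume e: "e > 0"
    obtain g where g: "WB \<rho> g B" "\<And>x::real. norm (f (of_real x) - g (of_real x)) \<le> e / W"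
      using lim[of "e / W"] e W by auto
    have "(\<Sum>n\<in>F. norm (fc f n) * wt \<rho> n) \<le> (\<Sum>n\<in>F. norm (fc g n) * wt \<rho> n + e / W * wt \<rho> n)"
    proof (rule sum_mono)
      fix n
      have "norm (fc (\<lambda>z. f z - g z) n) \<le> e / W"
        by (rule fc_norm_le[OF per_hol_diff[OF f WB_per_hol[OF g(1)]] \<rho> g(2)])
      then have "norm (fc f n) \<le> norm (fc g n) + e / W"
        using norm_triangle_sub[of "fc f n" "fc g n"] by (simp add: fc_diff[OF f WB_per_hol[OF g(1)] \<rho>])
      then have "norm (fc f n) * wt \<rho> n \<le> (norm (fc g n) + e / W) * wt \<rho> n"
        by (rule mult_right_mono) simp
      then show "norm (fc f n) * wt \<rho> n \<le> norm (fc g n) * wt \<rho> n + e / W * wt \<rho> n"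
        by (simp only: distrib_right)
    qed
    also have "\<dots> = (\<Sum>n\<in>F. norm (fc g n) * wt \<rho> n) + e / W * (W - 1)"
      by (simp add: sum.distrib W_def sum_distrib_left sum_divide_distrib)
    also have "e / W * (W - 1) \<le> e" using e W by (simp add: field_simps)
    also have "(\<Sum>n\<in>F. norm (fc g n) * wt \<rho> n) \<le> B" by (rule WB_D[OF g(1) F])
    finally show "(\<Sum>n\<in>F. norm (fc f n) * wt \<rho> n) \<le> B + e" by simp
  qed
qed

lemma WB_Inf:
  assumes "\<And>e. e > 0 \<Longrightarrow> WB \<rho> f (B + e)" shows "WB \<rho> f B"
  unfolding WB_def using assms[of 1] WB_per_hol WB_D[OF assms] by (auto intro: field_le_epsilon)

text \<open>If a finite set nearly attains the supremum of the finite sums, the coefficients outside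
  it have finite sums below \<open>e\<close>. This reduces the product estimate to trigonometric
  polynomials.\<close>

lemma WB_tail:
  assumes f: "WB \<rho> f B" and e: "0 < e"
  shows "\<exists>F. finite F \<and> WB \<rho> (\<lambda>z. f z - (\<Sum>n\<in>F. fc f n * ee n z)) e"
proof -
  let ?S = "\<lambda>F. \<Sum>n\<in>F. norm (fc f n) * wt \<rho> n"
  define s where "s = (SUP F\<in>{F. finite F}. ?S F)"
  have bdd: "bdd_above (?S ` {F. finite F})" by (rule bdd_aboveI[of _ B]) (use WB_D[OF f] in auto)
  have "\<exists>F. finite F \<and> s - e < ?S F"
    using less_cSUP_iff[of "{F. finite F}" ?S "s - e"] bdd e unfolding s_def by auto
  then obtain F where F: "finite F" "s - e < ?S F" by blast
  define r where "r = (\<lambda>z. f z - (\<Sum>n\<in>F. fc f n * ee n z))"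
  have ph: "per_hol \<rho> (\<lambda>z. \<Sum>n\<in>F. fc f n * ee n z)"
    by (intro per_hol_sum per_hol_mult per_hol_const per_hol_ee)
  have fr: "fc r k = (if k \<in> F then 0 else fc f k)" for k
  proof -
    have "fc r k = fc f k - (\<Sum>n\<in>F. fc f n * (if n = k then 1 else 0))"
      unfolding r_def
      by (simp only: fc_diff[OF WB_per_hol[OF f] ph \<rho>] fc_sum[OF F(1) per_hol_mult[OF per_hol_const per_hol_ee] \<rho>] fc_cmult fc_ee)
    then show ?thesis using F(1) by (simp add: if_distrib cong: if_cong)
  qed
  have "WB \<rho> r e"
  proof (rule WB_I)
    show "per_hol \<rho> r" unfolding r_def by (intro per_hol_diff ph WB_per_hol[OF f])
    fix G :: "int set" assume G: "finite G"
    have "(\<Sum>n\<in>G. norm (fc r n) * wt \<rho> n) = ?S (G - F)"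
      by (rule sum.mono_neutral_cong_right) (use G in \<open>auto simp: fr\<close>)
    also have "\<dots> = ?S ((G - F) \<union> F) - ?S F"
      using G F by (subst sum.union_disjoint) auto
    also have "?S ((G - F) \<union> F) \<le> s"
      unfolding s_def by (rule cSUP_upper[OF _ bdd]) (use G F in auto)
    finally show "(\<Sum>n\<in>G. norm (fc r n) * wt \<rho> n) \<le> e" using F(2) by simp
  qed
  then show ?thesis using F(1) unfolding r_def by blast
qed

text \<open>With a trigonometric polynomial in place of \<open>f\<close> this is the triangle
  inequality over \<open>WB_ee_mult\<close>. The tail of \<open>f\<close> is measured in the sup
  norm only, which \<open>WB_limit\<close> tolerates; this takes the place of a convolution of
  coefficient sequences.\<close>

lemma WB_mult:
  assumes f: "WB \<rho> f A" and g: "WB \<rho> g B"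
  shows "WB \<rho> (\<lambda>z. f z * g z) (A * B)"
proof (rule WB_limit)
  show "per_hol \<rho> (\<lambda>z. f z * g z)" using f g by (intro per_hol_mult WB_per_hol)
  have B: "0 \<le> B" using WB_nonneg[OF g] .
  fix e :: real assume e: "e > 0"
  obtain F where F: "finite F" "WB \<rho> (\<lambda>z. f z - (\<Sum>n\<in>F. fc f n * ee n z)) (e / (B + 1))"
    using WB_tail[OF f, of "e / (B + 1)"] e B by auto
  have "WB \<rho> (\<lambda>z. \<Sum>n\<in>F. fc f n * (ee n z * g z)) (\<Sum>n\<in>F. norm (fc f n) * (wt \<rho> n * B))"
    by (intro WB_sum WB_cmult WB_ee_mult g F)
  then have 1: "WB \<rho> (\<lambda>z. \<Sum>n\<in>F. fc f n * (ee n z * g z)) (A * B)"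
  proof (rule WB_mono)
    have "(\<Sum>n\<in>F. norm (fc f n) * (wt \<rho> n * B)) = (\<Sum>n\<in>F. norm (fc f n) * wt \<rho> n) * B"
      by (simp add: sum_distrib_right mult.assoc)
    also have "\<dots> \<le> A * B" by (intro mult_right_mono WB_D[OF f F(1)] B)
    finally show "(\<Sum>n\<in>F. norm (fc f n) * (wt \<rho> n * B)) \<le> A * B" .
  qed
  have 2: "norm (f (of_real x) * g (of_real x) - (\<Sum>n\<in>F. fc f n * (ee n (of_real x) * g (of_real x)))) \<le> e" for x :: real
  proof -
    have "norm ((f (of_real x) - (\<Sum>n\<in>F. fc f n * ee n (of_real x))) * g (of_real x)) \<le> e / (B + 1) * B"
      unfolding norm_mult by (intro mult_mono WB_norm[OF F(2)] WB_norm[OF g]) (use \<rho> e B in auto)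
    also have "\<dots> \<le> e" using e B by (simp add: field_simps)
    finally show ?thesis by (simp add: algebra_simps sum_distrib_left)
  qed
  show "\<exists>h. WB \<rho> h (A * B) \<and> (\<forall>x::real. norm (f (of_real x) * g (of_real x) - h (of_real x)) \<le> e)"
    using 1 2 by blast
qed

lemma WB_power:
  assumes f: "WB \<rho> f A" shows "WB \<rho> (\<lambda>z. f z ^ k) (A ^ k)"
  by (induction k) (use WB_const[of 1] WB_mult[OF f] in auto)

text \<open>Turns termwise norm bounds of a pointwise convergent expansion into a norm bound of its
  sum. The exponential and both composition estimates are instances.\<close>

lemma WB_series:
  fixes f :: "'i \<Rightarrow> complex \<Rightarrow> complex"
  assumes f: "\<And>i. WB \<rho> (f i) (B i)" and B: "(B has_sum S) UNIV"
    and s: "\<And>z. z \<in> strip \<rho> \<Longrightarrow> ((\<lambda>i. f i z) has_sum h z) UNIV" and h: "per_hol \<rho> h"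
  shows "WB \<rho> h S"
proof (rule WB_limit[OF h])
  have B0: "0 \<le> B i" for i using WB_nonneg[OF f] .
  fix e :: real assume e: "e > 0"
  have "\<forall>\<^sub>F I in finite_subsets_at_top UNIV. dist (sum B I) S < e"
    using B e unfolding has_sum_def by (rule tendstoD)
  then obtain I where I: "finite I" "dist (sum B I) S < e"
    by (auto simp: eventually_finite_subsets_at_top)
  have le: "sum B I \<le> S" using finite_sum_le_has_sum[OF B I(1)] B0 by auto
  have 1: "WB \<rho> (\<lambda>z. \<Sum>i\<in>I. f i z) S" by (rule WB_mono[OF WB_sum[OF I(1) f] le])
  have 2: "norm (h (of_real x) - (\<Sum>i\<in>I. f i (of_real x))) \<le> e" for x :: real
  proof -
    have "((\<lambda>i. f i (of_real x)) has_sum (h (of_real x) - (\<Sum>i\<in>I. f i (of_real x)))) (UNIV - I)"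
      by (rule has_sum_Diff[OF s]) (use \<rho> I(1) in \<open>auto intro: has_sum_finite\<close>)
    moreover have "(B has_sum (S - sum B I)) (UNIV - I)"
      by (rule has_sum_Diff[OF B]) (use I(1) in \<open>auto intro: has_sum_finite\<close>)
    ultimately have "norm (h (of_real x) - (\<Sum>i\<in>I. f i (of_real x))) \<le> S - sum B I"
      by (rule norm_infsum_le) (use WB_norm[OF f] \<rho> in auto)
    then show ?thesis using I(2) le by (simp add: dist_real_def)
  qed
  show "\<exists>g. WB \<rho> g S \<and> (\<forall>x::real. norm (h (of_real x) - g (of_real x)) \<le> e)" using 1 2 by blast
qed

lemma WB_power_diff:
  assumes a: "WB \<rho> a A" and b: "WB \<rho> b A" and d: "WB \<rho> (\<lambda>z. a z - b z) D"
  shows "WB \<rho> (\<lambda>z. a z ^ Suc k - b z ^ Suc k) (real (Suc k) * D * A ^ k)"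
proof (induction k)
  case 0 then show ?case using d by simp
next
  case (Suc k)
  have "WB \<rho> (\<lambda>z. a z * (a z ^ Suc k - b z ^ Suc k) + (a z - b z) * b z ^ Suc k)
      (A * (real (Suc k) * D * A ^ k) + D * A ^ Suc k)"
    by (intro WB_add WB_mult a d Suc WB_power b)
  then show ?case by (simp add: algebra_simps)
qed

text \<open>The constant terms of the two exponential series cancel, so the sum runs over the powers
  \<open>Suc k\<close>. The factor \<open>Suc k\<close> of a power difference cancels against the
  factorial and leaves \<open>D\<close> times the series of \<open>exp A\<close>.\<close>

lemma WB_exp_diff:
  assumes a: "WB \<rho> a A" and b: "WB \<rho> b A" and d: "WB \<rho> (\<lambda>z. a z - b z) D"
  shows "WB \<rho> (\<lambda>z. exp (a z) - exp (b z)) (D * exp A)"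
proof (rule WB_series)
  show "WB \<rho> (\<lambda>z. inverse (fact (Suc k)) * (a z ^ Suc k - b z ^ Suc k)) (D * (A ^ k / fact k))" for k
  proof (rule WB_mono[OF WB_cmult[OF WB_power_diff[OF a b d]]])
    have "norm (inverse (fact (Suc k)) :: complex) = inverse (real (Suc k) * fact k)"
      by (simp only: norm_inverse norm_fact, simp only: fact_Suc)
    moreover have "inverse (m * c) * (m * D * A ^ k) = D * (A ^ k / c)" if "0 < m" "0 < c" for m c :: real
      using that by (simp add: field_simps)
    from this[of "real (Suc k)" "fact k"]
    have "inverse (real (Suc k) * fact k) * (real (Suc k) * D * A ^ k) = D * (A ^ k / fact k)" by simp
    ultimately show "norm (inverse (fact (Suc k)) :: complex) * (real (Suc k) * D * A ^ k) \<le> D * (A ^ k / fact k)"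
      by (simp only: order_refl)
  qed
  have "(\<lambda>k. A ^ k / fact k) sums exp A" using exp_converges[of A] by (simp add: divide_inverse scaleR_conv_of_real mult.commute)
  then have "(\<lambda>k. D * (A ^ k / fact k)) sums (D * exp A)" by (rule sums_mult)
  then show "((\<lambda>k. D * (A ^ k / fact k)) has_sum D * exp A) UNIV"
    by (rule sums_nonneg_imp_has_sum_strong) (use WB_nonneg[OF a] WB_nonneg[OF d] in auto)
  show "per_hol \<rho> (\<lambda>z. exp (a z) - exp (b z))"
    by (intro per_hol_diff per_hol_exp WB_per_hol[OF a] WB_per_hol[OF b])
  have s: "((\<lambda>k. inverse (fact (Suc k)) * w ^ Suc k) has_sum (exp w - 1)) UNIV" for w :: complex
  proof (rule norm_summable_imp_has_sum)
    show "summable (\<lambda>k. norm (inverse (fact (Suc k)) * w ^ Suc k))"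
      using summable_norm_exp[of w] by (subst summable_Suc_iff) (simp add: norm_mult norm_inverse scaleR_conv_of_real)
    show "(\<lambda>k. inverse (fact (Suc k)) * w ^ Suc k) sums (exp w - 1)"
      using exp_converges[of w] by (subst sums_Suc_iff) (simp add: scaleR_conv_of_real)
  qed
  show "((\<lambda>k. inverse (fact (Suc k)) * (a z ^ Suc k - b z ^ Suc k)) has_sum exp (a z) - exp (b z)) UNIV" for z
    using has_sum_add[OF s[of "a z"] has_sum_cmult_right[OF s[of "b z"], of "- 1"]] by (simp add: right_diff_distrib)
qed

lemma WB_exp_minus_1:
  assumes a: "WB \<rho> a A"
  shows "WB \<rho> (\<lambda>z. exp (a z) - 1) (A * exp A)"
  using WB_exp_diff[OF a WB_mono[OF WB_0 WB_nonneg[OF a]], of A] a by simp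

lemma WB_exp:
  assumes a: "WB \<rho> a A"
  shows "WB \<rho> (\<lambda>z. exp (a z)) (exp A)"
proof (rule WB_series)
  show "WB \<rho> (\<lambda>z. inverse (fact k) * a z ^ k) (A ^ k / fact k)" for k
    by (rule WB_mono[OF WB_cmult[OF WB_power[OF a]]]) (simp only: norm_inverse norm_fact, simp add: field_simps)
  have "(\<lambda>k. A ^ k / fact k) sums exp A" using exp_converges[of A] by (simp add: divide_inverse scaleR_conv_of_real mult.commute)
  then show "((\<lambda>k. A ^ k / fact k) has_sum exp A) UNIV"
    by (rule sums_nonneg_imp_has_sum_strong) (use WB_nonneg[OF a] in auto)
  show "per_hol \<rho> (\<lambda>z. exp (a z))" by (intro per_hol_exp WB_per_hol[OF a])
  show "((\<lambda>k. inverse (fact k) * a z ^ k) has_sum exp (a z)) UNIV" for z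
  proof (rule norm_summable_imp_has_sum)
    show "summable (\<lambda>k. norm (inverse (fact k) * a z ^ k))"
      using summable_norm_exp[of "a z"] by (simp add: norm_mult norm_inverse scaleR_conv_of_real)
    show "(\<lambda>k. inverse (fact k) * a z ^ k) sums exp (a z)"
      using exp_converges[of "a z"] by (simp add: scaleR_conv_of_real)
  qed
qed

end

section \<open>Fourier multipliers and the operators of the fixed-point equation\<close>

definition syn :: "(int \<Rightarrow> complex) \<Rightarrow> complex \<Rightarrow> complex"
  where "syn a z = (\<Sum>\<^sub>\<infinity>n. a n * ee n z)"

definition mul :: "(int \<Rightarrow> complex) \<Rightarrow> (complex \<Rightarrow> complex) \<Rightarrow> complex \<Rightarrow> complex"
  where "mul m f = syn (\<lambda>n. m n * fc f n)"

text \<open>The primitive of mean zero. The mode 0 of the argument is dropped, so differentiation is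
  inverted only on functions of mean zero.\<close>

definition Dinv :: "(complex \<Rightarrow> complex) \<Rightarrow> complex \<Rightarrow> complex"
  where "Dinv = mul (\<lambda>n. if n = 0 then 0 else 1 / (2 * of_real pi * \<i> * of_int n))"

text \<open>The multiplier \<open>sdm \<alpha>\<close> takes the derivative of \<open>f\<close> to the solution \<open>u\<close> of \<open>u (z + \<alpha>) - u z = f z - fc f 0\<close>.
  Since it acts on the derivative, it is bounded for \<open>\<alpha>\<close> of bounded type.\<close>

definition sdm :: "real \<Rightarrow> int \<Rightarrow> complex"
  where "sdm \<alpha> n = (if n = 0 then 0 else 1 / (2 * of_real pi * \<i> * of_int n * (ee n (of_real \<alpha>) - 1)))"

definition small_div :: "real \<Rightarrow> real \<Rightarrow> bool"
  where "small_div C \<alpha> \<longleftrightarrow> 1 \<le> C \<and> (\<forall>n. n \<noteq> 0 \<longrightarrow> 1 \<le> C * \<bar>of_int n\<bar> * norm (ee n (of_real \<alpha>) - 1))"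

text \<open>With \<open>\<eta>\<close> the derivative of \<psi> and h = id + \<open>Dinv v\<close>,
  the argument of the multiplier is the derivative of \<psi> composed with h (for \<open>v\<close>
  of mean zero). The result u therefore solves u (z + \<alpha>) - u z = \<psi> (h z) up to a
  constant: it is the candidate for ln h' up to normalisation.\<close>

definition Uop :: "real \<Rightarrow> (complex \<Rightarrow> complex) \<Rightarrow> (complex \<Rightarrow> complex) \<Rightarrow> complex \<Rightarrow> complex"
  where "Uop \<alpha> \<eta> v = mul (sdm \<alpha>) (\<lambda>z. \<eta> (z + Dinv v z) * (1 + v z))"

text \<open>Fixed points \<open>v\<close> of \<open>Top\<close> are the derivatives of \<open>g\<close> for the conjugacies \<open>id + g\<close>; the normalisation
  makes \<open>1 + v\<close> have mean one.\<close>

definition Top :: "real \<Rightarrow> (complex \<Rightarrow> complex) \<Rightarrow> (complex \<Rightarrow> complex) \<Rightarrow> complex \<Rightarrow> complex"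
  where "Top \<alpha> \<eta> v = (\<lambda>z. exp (Uop \<alpha> \<eta> v z) / fc (\<lambda>z. exp (Uop \<alpha> \<eta> v z)) 0 - 1)"

lemma sdm_le:
  assumes "small_div C \<alpha>" shows "norm (sdm \<alpha> n) \<le> C"
proof (cases "n = 0")
  case True then show ?thesis using assms by (simp add: sdm_def small_div_def)
next
  case False
  let ?d = "\<bar>real_of_int n\<bar> * norm (ee n (of_real \<alpha>) - 1)"
  have 1: "1 \<le> C * ?d" and C: "0 < C" using assms False by (auto simp: small_div_def mult.assoc)
  then have d: "0 < ?d" by (smt (verit) mult_nonneg_nonpos)
  have "norm (sdm \<alpha> n) = 1 / (2 * pi) * (1 / ?d)" using False by (simp add: sdm_def norm_mult norm_divide)
  also have "\<dots> \<le> 1 * C"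
  proof (rule mult_mono)
    show "1 / ?d \<le> C" using 1 d by (simp add: field_simps)
    show "1 / (2 * pi) \<le> 1" using pi_gt3 by simp
  qed auto
  finally show ?thesis by simp
qed

lemma ee_nonres: "small_div C \<alpha> \<Longrightarrow> n \<noteq> 0 \<Longrightarrow> ee n (of_real \<alpha>) \<noteq> 1"
  by (auto simp: small_div_def)

context
  fixes \<rho> :: real
  assumes \<rho>: "0 < \<rho>"
begin

text \<open>Weighted absolute summability bounds the tails uniformly on the whole strip, so the sum
  is holomorphic and its coefficients are limits of those of the partial sums.\<close>

lemma syn:
  assumes a: "\<And>F. finite F \<Longrightarrow> (\<Sum>n\<in>F. norm (a n) * wt \<rho> n) \<le> B"
  shows "WB \<rho> (syn a) B" "fc (syn a) n = a n"
proof -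
  have "(\<lambda>n. norm (a n) * wt \<rho> n) summable_on UNIV"
    by (rule nonneg_bdd_above_summable_on) (auto intro!: bdd_aboveI[of _ B] a)
  then obtain W where W: "((\<lambda>n. norm (a n) * wt \<rho> n) has_sum W) UNIV"
    unfolding summable_on_def by blast
  have le: "norm (a n * ee n z) \<le> norm (a n) * wt \<rho> n" if "z \<in> strip \<rho>" for z n
    using that by (simp add: norm_mult strip_iff mult_left_mono norm_ee_le)
  have hs: "((\<lambda>n. a n * ee n z) has_sum syn a z) UNIV" if z: "z \<in> strip \<rho>" for z
  proof -
    have "(\<lambda>n. norm (a n * ee n z)) summable_on UNIV"
      by (rule summable_on_comparison_test[OF has_sum_imp_summable[OF W]]) (use le[OF z] in auto)
    then have "(\<lambda>n. a n * ee n z) summable_on UNIV" by (rule abs_summable_summable)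
    then show ?thesis unfolding syn_def by (rule has_sum_infsum)
  qed
  define S where "S = (\<lambda>N::nat. \<lambda>z. \<Sum>n\<in>{- int N..int N}. a n * ee n z)"
  define t where "t = (\<lambda>N::nat. W - (\<Sum>n\<in>{- int N..int N}. norm (a n) * wt \<rho> n))"
  have t: "t \<longlonglongrightarrow> 0"
    using tendsto_diff[OF tendsto_const[of W] summable_on_intervals[OF W]] by (simp add: t_def)
  have St: "norm (syn a z - S N z) \<le> t N" if z: "z \<in> strip \<rho>" for N z
  proof (rule norm_infsum_le)
    show "((\<lambda>n. a n * ee n z) has_sum (syn a z - S N z)) (UNIV - {- int N..int N})"
      unfolding S_def by (rule has_sum_Diff[OF hs[OF z]]) (auto intro: has_sum_finite)
    show "((\<lambda>n. norm (a n) * wt \<rho> n) has_sum t N) (UNIV - {- int N..int N})"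
      unfolding t_def by (rule has_sum_Diff[OF W]) (auto intro: has_sum_finite)
  qed (use le[OF z] in auto)
  have Sh: "per_hol \<rho> (S N)" for N
    unfolding S_def by (intro per_hol_sum per_hol_mult per_hol_const per_hol_ee)
  have ul: "uniform_limit (strip \<rho>) S (syn a) sequentially"
  proof (rule uniform_limitI)
    fix e :: real assume "e > 0"
    then have "\<forall>\<^sub>F N in sequentially. t N < e" using t order_tendstoD(2) by blast
    then show "\<forall>\<^sub>F N in sequentially. \<forall>z\<in>strip \<rho>. dist (S N z) (syn a z) < e"
    proof (rule eventually_mono)
      fix N assume "t N < e"
      then show "\<forall>z\<in>strip \<rho>. dist (S N z) (syn a z) < e"
        using le_less_trans[OF St] by (simp add: dist_norm norm_minus_commute)
    qed
  qed
  have "syn a holomorphic_on strip \<rho>"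
  proof (rule holomorphic_uniform_sequence[OF open_strip])
    show "S N holomorphic_on strip \<rho>" for N using per_hol_holo[OF Sh] .
    fix x assume "x \<in> strip \<rho>"
    then obtain d where d: "0 < d" "cball x d \<subseteq> strip \<rho>" by (meson open_strip open_contains_cball)
    then show "\<exists>d>0. cball x d \<subseteq> strip \<rho> \<and> uniform_limit (cball x d) S (syn a) sequentially"
      using uniform_limit_on_subset[OF ul] by blast
  qed
  then have ph: "per_hol \<rho> (syn a)"
    by (rule per_holI) (simp add: syn_def ee_add_arg)
  have fcn: "fc (syn a) n = a n" for n
  proof -
    have "\<forall>\<^sub>F N in sequentially. norm (fc (syn a) n - a n) \<le> t N"
      using eventually_ge_at_top[of "nat \<bar>n\<bar>"]
    proof eventually_elim
      case (elim N)
      have "fc (S N) n = (\<Sum>k\<in>{- int N..int N}. a k * (if k = n then 1 else 0))"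
        unfolding S_def
        by (simp only: fc_sum[OF _ per_hol_mult[OF per_hol_const per_hol_ee] \<rho>] finite_atLeastAtMost_int fc_cmult fc_ee)
      also have "\<dots> = a n" using elim by (auto simp: if_distrib cong: if_cong)
      finally have "fc (syn a) n - a n = fc (\<lambda>z. syn a z - S N z) n" by (simp add: fc_diff[OF ph Sh \<rho>])
      then show ?case using fc_norm_le[OF per_hol_diff[OF ph Sh] \<rho> St] \<rho> by simp
    qed
    then have "norm (fc (syn a) n - a n) \<le> 0" by (rule tendsto_lowerbound[OF t]) simp
    then show ?thesis by simp
  qed
  show "WB \<rho> (syn a) B" by (rule WB_I[OF ph]) (simp add: fcn a)
  show "fc (syn a) n = a n" by (rule fcn)
qed

lemma mul:
  assumes f: "WB \<rho> f B" and m: "\<And>n. norm (m n) \<le> C"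
  shows "WB \<rho> (mul m f) (C * B)" "fc (mul m f) n = m n * fc f n"
proof -
  have C: "0 \<le> C" using order_trans[OF norm_ge_zero m] .
  have "(\<Sum>n\<in>F. norm (m n * fc f n) * wt \<rho> n) \<le> C * B" if F: "finite F" for F
  proof -
    have "(\<Sum>n\<in>F. norm (m n * fc f n) * wt \<rho> n) \<le> (\<Sum>n\<in>F. C * (norm (fc f n) * wt \<rho> n))"
      by (intro sum_mono) (simp add: norm_mult m mult_right_mono flip: mult.assoc)
    also have "\<dots> \<le> C * B" unfolding sum_distrib_left[symmetric] by (intro mult_left_mono WB_D[OF f F] C)
    finally show ?thesis .
  qed
  from syn[OF this] show "WB \<rho> (mul m f) (C * B)" "fc (mul m f) n = m n * fc f n"
    unfolding mul_def by auto
qed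

lemma mul_diff:
  assumes f: "WB \<rho> f A" and g: "WB \<rho> g B" and d: "WB \<rho> (\<lambda>z. f z - g z) D" and m: "\<And>n. norm (m n) \<le> C"
  shows "WB \<rho> (\<lambda>z. mul m f z - mul m g z) (C * D)"
proof (rule WB_cong[OF \<rho> mul(1)[OF d m]])
  fix z assume z: "z \<in> strip \<rho>"
  have p: "per_hol \<rho> (mul m f)" "per_hol \<rho> (mul m g)"
    by (rule WB_per_hol[OF mul(1)[OF f m]], rule WB_per_hol[OF mul(1)[OF g m]])
  show "mul m (\<lambda>z. f z - g z) z = mul m f z - mul m g z"
  proof (rule per_hol_eqI[OF WB_per_hol[OF mul(1)[OF d m]] per_hol_diff[OF p] _ z])
    show "fc (mul m (\<lambda>z. f z - g z)) n = fc (\<lambda>z. mul m f z - mul m g z) n" for n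
      by (simp add: fc_diff[OF p \<rho>] mul(2)[OF d m] mul(2)[OF f m] mul(2)[OF g m]
          fc_diff[OF WB_per_hol[OF f] WB_per_hol[OF g] \<rho>] right_diff_distrib)
  qed
qed

lemma Dinv_mult_le: "norm (if n = (0::int) then 0 else 1 / (2 * complex_of_real pi * \<i> * of_int n)) \<le> 1"
proof (cases "n = 0")
  case False
  then have "1 \<le> \<bar>real_of_int n\<bar>" by linarith
  then have "1 * 1 \<le> (2 * pi) * \<bar>real_of_int n\<bar>" using pi_gt3 by (intro mult_mono) auto
  then show ?thesis using False by (simp add: norm_mult norm_divide field_simps)
qed simp

lemma Dinv_WB: "WB \<rho> v B \<Longrightarrow> WB \<rho> (Dinv v) B"
  using mul(1)[OF _ Dinv_mult_le] unfolding Dinv_def by fastforce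

lemma Dinv_fc: "WB \<rho> v B \<Longrightarrow> fc (Dinv v) n = (if n = 0 then 0 else fc v n / (2 * of_real pi * \<i> * of_int n))"
  using mul(2)[OF _ Dinv_mult_le] unfolding Dinv_def by simp

lemma Dinv_diff:
  assumes "WB \<rho> f A" "WB \<rho> g B" "WB \<rho> (\<lambda>z. f z - g z) D"
  shows "WB \<rho> (\<lambda>z. Dinv f z - Dinv g z) D"
  using mul_diff[OF assms Dinv_mult_le] unfolding Dinv_def by simp

lemma deriv_Dinv:
  assumes v: "WB \<rho> v B" "fc v 0 = 0" and z: "z \<in> strip \<rho>"
  shows "deriv (Dinv v) z = v z"
proof (rule per_hol_eqI[OF per_hol_deriv[OF WB_per_hol[OF Dinv_WB[OF v(1)]]] WB_per_hol[OF v(1)] _ z])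
  show "fc (deriv (Dinv v)) n = fc v n" for n
    using v(2) by (simp add: fc_deriv_eq[OF WB_per_hol[OF Dinv_WB[OF v(1)]] \<rho>] Dinv_fc[OF v(1)])
qed

lemma Dinv_deriv:
  assumes g: "per_hol \<rho> g" "fc g 0 = 0" and v: "WB \<rho> (deriv g) B" and z: "z \<in> strip \<rho>"
  shows "Dinv (deriv g) z = g z"
proof (rule per_hol_eqI[OF WB_per_hol[OF Dinv_WB[OF v]] g(1) _ z])
  show "fc (Dinv (deriv g)) n = fc g n" for n
    using g(2) by (simp add: Dinv_fc[OF v] fc_deriv_eq[OF g(1) \<rho>])
qed

section \<open>Composition with maps close to the identity\<close>

lemma per_hol_comp:
  assumes x: "per_hol b \<eta>" and g: "WB \<rho> g r" and b: "\<rho> + r \<le> b"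
  shows "per_hol \<rho> (\<lambda>z. \<eta> (z + g z))"
proof (rule per_holI)
  have s: "z + g z \<in> strip b" if "z \<in> strip \<rho>" for z
    using strip_add[OF that WB_norm[OF \<rho> g that]] b strip_mono by blast
  have "(\<lambda>z. z + g z) holomorphic_on strip \<rho>"
    by (intro holomorphic_intros per_hol_holo[OF WB_per_hol[OF g]])
  then have "(\<eta> \<circ> (\<lambda>z. z + g z)) holomorphic_on strip \<rho>"
    by (rule holomorphic_on_compose_gen[OF _ per_hol_holo[OF x]]) (use s in auto)
  then show "(\<lambda>z. \<eta> (z + g z)) holomorphic_on strip \<rho>" by (simp add: o_def)
  show "\<eta> (z + 1 + g (z + 1)) = \<eta> (z + g z)" if "z \<in> strip \<rho>" for z
    using per_hol_per[OF x s[OF that]] per_hol_per[OF WB_per_hol[OF g] that] by (simp add: add_ac)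
qed

lemma WB_ee_comp:
  assumes g: "WB \<rho> g r"
  shows "WB \<rho> (\<lambda>z. 2 * of_real pi * \<i> * of_int k * g z) (2 * pi * \<bar>of_int k\<bar> * r)"
  using WB_cmult[OF \<rho> g, of "2 * of_real pi * \<i> * of_int k"] by (simp add: norm_mult)

text \<open>The budget of mode \<open>k\<close>: the coefficient of \<open>\<eta>\<close> brings
  \<open>wt (- b) k\<close>, the character costs \<open>wt \<rho> k\<close>, the exponential
  containing the perturbation costs \<open>wt r k\<close>, and the surplus is
  \<open>wt (- (b - \<rho> - r)) k\<close>. The free factor \<open>y\<close> is 1 for a composition
  and \<open>2 * pi * \<bar>of_int k\<bar> * D\<close> for a difference.\<close>

lemma WB_comp_aux:
  assumes x: "per_hol b \<eta>" and b: "0 < b - \<rho> - r" "0 \<le> r" and M: "\<And>z. z \<in> strip b \<Longrightarrow> norm (\<eta> z) \<le> M"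
    and y: "y \<le> (1 + 2 * pi * \<bar>of_int k\<bar>) ^ 2 * D" "0 \<le> y" "0 \<le> D"
  shows "norm (fc \<eta> k) * (wt \<rho> k * (y * wt r k)) \<le> M * D * ((1 + 2 * pi * \<bar>of_int k\<bar>) ^ 2 * wt (- (b - \<rho> - r)) k)"
proof -
  have b0: "0 < b" using \<rho> b by simp
  have M0: "0 \<le> M" using order_trans[OF norm_ge_zero M[of 0]] b0 by (simp add: strip_iff)
  have "norm (fc \<eta> k) * (wt \<rho> k * (y * wt r k)) \<le> (M * wt (- b) k) * (wt \<rho> k * ((1 + 2 * pi * \<bar>of_int k\<bar>) ^ 2 * D * wt r k))"
    by (intro mult_mono fc_bound[OF x b0 M] y order_refl mult_nonneg_nonneg) (use y M0 in auto)
  also have "\<dots> = M * D * ((1 + 2 * pi * \<bar>of_int k\<bar>) ^ 2 * (wt (- b) k * wt \<rho> k * wt r k))" by (simp add: mult_ac)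
  also have "wt (- b) k * wt \<rho> k * wt r k = wt (- b + \<rho> + r) k" by (simp only: wt_add)
  also have "- b + \<rho> + r = - (b - \<rho> - r)" by simp
  finally show ?thesis .
qed

lemma cs_has_sum: "0 < t \<Longrightarrow> ((\<lambda>k::int. c * ((1 + 2 * pi * \<bar>of_int k\<bar>) ^ 2 * wt (- t) k)) has_sum c * cs t) UNIV"
  unfolding cs_def by (intro has_sum_cmult_right has_sum_infsum weight_summable)

text \<open>Expanding \<open>\<eta>\<close> in characters, \<open>ee k (z + g z)\<close> is
  \<open>ee k z\<close> times the exponential of a multiple of \<open>g z\<close>, so the
  composition becomes a series of products and exponentials inside the algebra.\<close>

lemma WB_comp:
  assumes x: "per_hol b \<eta>" and g: "WB \<rho> g r" and b: "0 < b - \<rho> - r" and M: "\<And>z. z \<in> strip b \<Longrightarrow> norm (\<eta> z) \<le> M"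
  shows "WB \<rho> (\<lambda>z. \<eta> (z + g z)) (M * cs (b - \<rho> - r))"
proof (rule WB_series[OF \<rho>])
  have r: "0 \<le> r" using WB_nonneg[OF g] .
  show "WB \<rho> (\<lambda>z. fc \<eta> k * (ee k z * exp (2 * of_real pi * \<i> * of_int k * g z)))
     (M * 1 * ((1 + 2 * pi * \<bar>of_int k\<bar>) ^ 2 * wt (- (b - \<rho> - r)) k))" for k
  proof (rule WB_mono[OF WB_cmult[OF \<rho> WB_ee_mult[OF \<rho> WB_exp[OF \<rho> WB_ee_comp[OF g]]]]])
    show "norm (fc \<eta> k) * (wt \<rho> k * exp (2 * pi * \<bar>of_int k\<bar> * r)) \<le> M * 1 * ((1 + 2 * pi * \<bar>of_int k\<bar>) ^ 2 * wt (- (b - \<rho> - r)) k)"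
      using WB_comp_aux[OF x b r M, of 1 k 1] weight_factor_le1[of k] by (simp add: wt_def mult_ac)
  qed
  show "((\<lambda>k. M * 1 * ((1 + 2 * pi * \<bar>real_of_int k\<bar>)\<^sup>2 * wt (- (b - \<rho> - r)) k)) has_sum M * cs (b - \<rho> - r)) UNIV"
    using cs_has_sum[OF b, of M] by simp
  show "per_hol \<rho> (\<lambda>z. \<eta> (z + g z))" by (rule per_hol_comp[OF x g]) (use b in simp)
  show "((\<lambda>k. fc \<eta> k * (ee k z * exp (2 * of_real pi * \<i> * of_int k * g z))) has_sum \<eta> (z + g z)) UNIV" if z: "z \<in> strip \<rho>" for z
  proof -
    have "z + g z \<in> strip b" using strip_add[OF z WB_norm[OF \<rho> g z]] b strip_mono[of _ "\<rho> + r" b] by simp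
    from fourier_expansion[OF x this] show ?thesis by (simp add: ee_add_arg) (simp add: ee_def)
  qed
qed

text \<open>The expansion of \<open>WB_comp\<close> again, now with a difference of exponentials in
  each mode. The factor \<open>2 * pi * \<bar>of_int k\<bar>\<close> that it brings out is absorbed
  by the quadratic factor in \<open>cs\<close>, so the Lipschitz constant involves the sup bound of
  \<open>\<eta>\<close> alone.\<close>

lemma WB_comp_diff:
  assumes x: "per_hol b \<eta>" and g: "WB \<rho> g r" and h: "WB \<rho> h r" and d: "WB \<rho> (\<lambda>z. g z - h z) D"
    and b: "0 < b - \<rho> - r" and M: "\<And>z. z \<in> strip b \<Longrightarrow> norm (\<eta> z) \<le> M"
  shows "WB \<rho> (\<lambda>z. \<eta> (z + g z) - \<eta> (z + h z)) (M * D * cs (b - \<rho> - r))"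
proof (rule WB_series[OF \<rho>])
  have r: "0 \<le> r" using WB_nonneg[OF g] .
  have D: "0 \<le> D" using WB_nonneg[OF d] .
  let ?e = "\<lambda>k g z. exp (2 * of_real pi * \<i> * of_int k * g z)"
  show "WB \<rho> (\<lambda>z. fc \<eta> k * (ee k z * (?e k g z - ?e k h z)))
     (M * D * ((1 + 2 * pi * \<bar>of_int k\<bar>) ^ 2 * wt (- (b - \<rho> - r)) k))" for k
  proof (rule WB_mono[OF WB_cmult[OF \<rho> WB_ee_mult[OF \<rho> WB_exp_diff[OF \<rho> WB_ee_comp[OF g] WB_ee_comp[OF h]]]]])
    show "WB \<rho> (\<lambda>z. 2 * of_real pi * \<i> * of_int k * g z - 2 * of_real pi * \<i> * of_int k * h z) (2 * pi * \<bar>of_int k\<bar> * D)"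
      using WB_ee_comp[OF d, of k] by (simp add: right_diff_distrib)
    show "norm (fc \<eta> k) * (wt \<rho> k * (2 * pi * \<bar>of_int k\<bar> * D * exp (2 * pi * \<bar>of_int k\<bar> * r))) \<le> M * D * ((1 + 2 * pi * \<bar>of_int k\<bar>) ^ 2 * wt (- (b - \<rho> - r)) k)"
      using WB_comp_aux[OF x b r M, of "2 * pi * \<bar>of_int k\<bar> * D" k D] mult_right_mono[OF weight_factor_le2[of k] D] D
      by (simp add: wt_def mult_ac)
  qed
  show "((\<lambda>k. M * D * ((1 + 2 * pi * \<bar>real_of_int k\<bar>)\<^sup>2 * wt (- (b - \<rho> - r)) k)) has_sum M * D * cs (b - \<rho> - r)) UNIV"
    by (rule cs_has_sum[OF b])
  show "per_hol \<rho> (\<lambda>z. \<eta> (z + g z) - \<eta> (z + h z))"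
    by (intro per_hol_diff per_hol_comp[OF x g] per_hol_comp[OF x h]) (use b in auto)
  show "((\<lambda>k. fc \<eta> k * (ee k z * (?e k g z - ?e k h z))) has_sum (\<eta> (z + g z) - \<eta> (z + h z))) UNIV" if z: "z \<in> strip \<rho>" for z
  proof -
    have s: "z + g z \<in> strip b" "z + h z \<in> strip b"
      using strip_add[OF z WB_norm[OF \<rho> g z]] strip_add[OF z WB_norm[OF \<rho> h z]] b strip_mono[of _ "\<rho> + r" b] by simp_all
    have "((\<lambda>k. fc \<eta> k * ee k (z + g z) + - 1 * (fc \<eta> k * ee k (z + h z))) has_sum (\<eta> (z + g z) + - 1 * \<eta> (z + h z))) UNIV"
      by (intro has_sum_add has_sum_cmult_right fourier_expansion[OF x] s)
    moreover have "exp (2 * of_real pi * \<i> * of_int k * w) = ee k w" for k w by (simp add: ee_def)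
    ultimately show ?thesis by (simp add: ee_add_arg right_diff_distrib)
  qed
qed

end

section \<open>The fixed-point operator\<close>

context
  fixes \<rho> :: real
  assumes \<rho>: "0 < \<rho>"
begin

text \<open>The bound 1/15 gives \<open>exp U \<le> 5 / 4\<close>, hence the mean of the exponential
  lies within 1/12 of 1 and its inverse is at most 12/11. The constants 3 and 4 round up what
  division by the mean then costs.\<close>

lemma normalize_exp:
  fixes N :: "(complex \<Rightarrow> complex) \<Rightarrow> complex \<Rightarrow> complex"
  assumes u: "WB \<rho> u U" and w: "WB \<rho> w U" and d: "WB \<rho> (\<lambda>z. u z - w z) X" and U: "U \<le> 1 / 15"
  defines "N \<equiv> \<lambda>u z. exp (u z) / fc (\<lambda>z. exp (u z)) 0 - 1"
  shows "WB \<rho> (N u) (3 * U)" "fc (N u) 0 = 0" "WB \<rho> (\<lambda>z. N u z - N w z) (4 * X)"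
    "1 / 2 \<le> norm (fc (\<lambda>z. exp (u z)) 0)"
proof -
  have U0: "0 \<le> U" using WB_nonneg[OF u] .
  have X0: "0 \<le> X" using WB_nonneg[OF d] .
  have "exp U \<le> 1 + U + U\<^sup>2" using U U0 by (intro exp_bound) auto
  also have "U\<^sup>2 \<le> (1 / 15)\<^sup>2" using U U0 by (intro power_mono) auto
  finally have eU: "exp U \<le> 5 / 4" using U by (simp add: power2_eq_square)
  have E: "WB \<rho> (\<lambda>z. exp (v z) - 1) (5 / 4 * U)" "WB \<rho> (\<lambda>z. exp (v z)) (5 / 4)"
    "norm (fc (\<lambda>z. exp (v z)) 0 - 1) \<le> 5 / 4 * U" "11 / 12 \<le> norm (fc (\<lambda>z. exp (v z)) 0)" if v: "WB \<rho> v U" for v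
  proof -
    have "U * exp U \<le> U * (5 / 4)" by (intro mult_left_mono eU U0)
    then show 1: "WB \<rho> (\<lambda>z. exp (v z) - 1) (5 / 4 * U)" using WB_mono[OF WB_exp_minus_1[OF \<rho> v]] by simp
    show "WB \<rho> (\<lambda>z. exp (v z)) (5 / 4)" by (rule WB_mono[OF WB_exp[OF \<rho> v] eU])
    show 2: "norm (fc (\<lambda>z. exp (v z)) 0 - 1) \<le> 5 / 4 * U"
      using WB_fc0[OF 1] by (simp add: fc_diff[OF per_hol_exp[OF WB_per_hol[OF v]] per_hol_const \<rho>] fc_const)
    have "1 - norm (fc (\<lambda>z. exp (v z)) 0) \<le> norm (fc (\<lambda>z. exp (v z)) 0 - 1)"
      using norm_triangle_ineq2[of 1 "fc (\<lambda>z. exp (v z)) 0"] by (simp add: norm_minus_commute)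
    then show "11 / 12 \<le> norm (fc (\<lambda>z. exp (v z)) 0)" using 2 U by linarith
  qed
  define m n where "m = fc (\<lambda>z. exp (u z)) 0" and "n = fc (\<lambda>z. exp (w z)) 0"
  have m: "11 / 12 \<le> norm m" "norm (m - 1) \<le> 5 / 4 * U" and n: "11 / 12 \<le> norm n" "norm (n - 1) \<le> 5 / 4 * U"
    using E[OF u] E[OF w] by (auto simp: m_def n_def)
  have nz: "m \<noteq> 0" "n \<noteq> 0" using m n by auto
  have im: "norm (1 / m) \<le> 12 / 11" "norm (1 / n) \<le> 12 / 11"
    using m n nz by (auto simp: norm_divide field_simps)
  show "1 / 2 \<le> norm (fc (\<lambda>z. exp (u z)) 0)" using m(1) by (simp add: m_def)
  have "WB \<rho> (\<lambda>z. 1 / m * ((exp (u z) - 1) + (1 - m))) (norm (1 / m) * (5 / 4 * U + norm (1 - m)))"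
    by (intro WB_cmult WB_add WB_const E u \<rho>)
  moreover have "norm (1 / m) * (5 / 4 * U + norm (1 - m)) \<le> 12 / 11 * (5 / 4 * U + 5 / 4 * U)"
    using im m U0 by (intro mult_mono add_mono) (auto simp: norm_minus_commute)
  moreover have "12 / 11 * (5 / 4 * U + 5 / 4 * U) \<le> 3 * U" using U0 by simp
  ultimately have "WB \<rho> (\<lambda>z. 1 / m * ((exp (u z) - 1) + (1 - m))) (3 * U)" using WB_mono by (meson order_trans)
  then show "WB \<rho> (N u) (3 * U)" unfolding N_def m_def[symmetric]
    by (rule WB_cong[OF \<rho>]) (use nz in \<open>simp add: field_simps\<close>)
  have "per_hol \<rho> (\<lambda>z. 1 / m * exp (u z))" by (intro per_hol_mult per_hol_const per_hol_exp WB_per_hol[OF u])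
  from fc_diff[OF this per_hol_const \<rho>, of 1 0]
  have "fc (\<lambda>z. 1 / m * exp (u z) - 1) 0 = 1 / m * m - 1"
    by (simp only: fc_cmult fc_const m_def[symmetric]) simp
  then show "fc (N u) 0 = 0" using nz unfolding N_def m_def[symmetric] by simp
  have ed: "WB \<rho> (\<lambda>z. exp (u z) - exp (w z)) (X * (5 / 4))"
    by (rule WB_mono[OF WB_exp_diff[OF \<rho> u w d]]) (intro mult_left_mono eU X0)
  have mn: "norm (n - m) \<le> X * (5 / 4)"
    using WB_fc0[OF ed] unfolding m_def n_def
    by (simp add: fc_diff[OF per_hol_exp[OF WB_per_hol[OF u]] per_hol_exp[OF WB_per_hol[OF w]] \<rho>] norm_minus_commute)
  \<comment> \<open>The difference of the two quotients is split into the difference of the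
    exponentials over \<open>m\<close> and the difference of the means over \<open>m * n\<close>,
    times the second exponential.\<close>
  have "WB \<rho> (\<lambda>z. 1 / m * (exp (u z) - exp (w z)) + (1 / m * (1 / n) * (n - m)) * exp (w z))
      (norm (1 / m) * (X * (5 / 4)) + norm (1 / m * (1 / n) * (n - m)) * (5 / 4))"
    by (intro WB_cmult WB_add WB_const E w \<rho> ed)
  moreover have "norm (1 / m) * (X * (5 / 4)) + norm (1 / m * (1 / n) * (n - m)) * (5 / 4)
      \<le> 12 / 11 * (X * (5 / 4)) + (12 / 11 * (12 / 11) * (X * (5 / 4))) * (5 / 4)"
    unfolding norm_mult using im mn X0 by (intro mult_mono add_mono mult_nonneg_nonneg) auto
  moreover have "12 / 11 * (X * (5 / 4)) + (12 / 11 * (12 / 11) * (X * (5 / 4))) * (5 / 4) \<le> 4 * X"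
    using X0 by simp
  ultimately have "WB \<rho> (\<lambda>z. 1 / m * (exp (u z) - exp (w z)) + (1 / m * (1 / n) * (n - m)) * exp (w z)) (4 * X)"
    using WB_mono by (meson order_trans)
  then show "WB \<rho> (\<lambda>z. N u z - N w z) (4 * X)" unfolding N_def m_def[symmetric] n_def[symmetric]
    by (rule WB_cong[OF \<rho>]) (use nz in \<open>simp add: field_simps\<close>)
qed

text \<open>Completeness in the form that Picard iteration asks for. Each coefficient sequence is
  Cauchy, \<open>syn\<close> assembles the limits, and the norm bounds survive because each concerns
  finite sums.\<close>

lemma WB_complete:
  assumes v: "\<And>n. WB \<rho> (v n) R" and d: "\<And>n. WB \<rho> (\<lambda>z. v (Suc n) z - v n z) (D / 2 ^ n)"
  obtains w where "WB \<rho> w R" "\<And>n. WB \<rho> (\<lambda>z. w z - v n z) (2 * D / 2 ^ n)" "\<And>k. (\<lambda>n. fc (v n) k) \<longlonglongrightarrow> fc w k"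
proof -
  have D: "0 \<le> D" using WB_nonneg[OF d[of 0]] by simp
  have vd: "WB \<rho> (\<lambda>z. v (n + j) z - v n z) (2 * D / 2 ^ n)" for n j
  proof -
    have "WB \<rho> (\<lambda>z. v (n + j) z - v n z) (2 * D / 2 ^ n - 2 * D / 2 ^ (n + j))"
    proof (induction j)
      case 0 show ?case using WB_0[OF \<rho>] by simp
    next
      case (Suc j)
      have "WB \<rho> (\<lambda>z. (v (Suc (n + j)) z - v (n + j) z) + (v (n + j) z - v n z)) (D / 2 ^ (n + j) + (2 * D / 2 ^ n - 2 * D / 2 ^ (n + j)))"
        by (intro WB_add \<rho> d Suc)
      then show ?case by (simp add: field_simps)
    qed
    then show ?thesis by (rule WB_mono) (use D in simp)
  qed
  have fd: "fc (\<lambda>z. v m z - v n z) k = fc (v m) k - fc (v n) k" for m n k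
    by (rule fc_diff[OF WB_per_hol[OF v] WB_per_hol[OF v] \<rho>])
  have near: "norm (fc (v (n + j)) k - fc (v n) k) \<le> 2 * D / 2 ^ n" for n j k
  proof -
    have "norm (fc (v (n + j)) k - fc (v n) k) * 1 \<le> norm (fc (v (n + j)) k - fc (v n) k) * wt \<rho> k"
      by (intro mult_left_mono wt_ge1) (use \<rho> in auto)
    then show ?thesis using WB_fc[OF vd[of n j], of k] by (simp add: fd)
  qed
  have "convergent (\<lambda>n. fc (v n) k)" for k
  proof (rule Cauchy_convergent, rule metric_CauchyI)
    fix e :: real assume e: "0 < e"
    have "(\<lambda>n. (4 * D) * (1 / 2) ^ n) \<longlonglongrightarrow> 0" by (intro tendsto_mult_right_zero LIMSEQ_power_zero) simp
    then have "\<forall>\<^sub>F n in sequentially. (4 * D) * (1 / 2) ^ n < e" using e order_tendstoD(2) by blast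
    then obtain n where n: "(4 * D) * (1 / 2) ^ n < e" by (auto simp: eventually_sequentially)
    have "dist (fc (v i) k) (fc (v j) k) < e" if "i \<ge> n" "j \<ge> n" for i j
    proof -
      have "dist (fc (v i) k) (fc (v j) k) \<le> dist (fc (v i) k) (fc (v n) k) + dist (fc (v j) k) (fc (v n) k)"
        by (rule dist_triangle2)
      also have "\<dots> \<le> 2 * D / 2 ^ n + 2 * D / 2 ^ n"
        using near[of n "i - n" k] near[of n "j - n" k] that by (simp add: dist_norm)
      also have "\<dots> = (4 * D) * (1 / 2) ^ n" by (simp add: power_divide)
      finally show ?thesis using n by simp
    qed
    then show "\<exists>M. \<forall>m\<ge>M. \<forall>n\<ge>M. dist (fc (v m) k) (fc (v n) k) < e" by blast
  qed
  then obtain a where a: "\<And>k. (\<lambda>n. fc (v n) k) \<longlonglongrightarrow> a k"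
    unfolding convergent_def by metis
  have aR: "(\<Sum>k\<in>F. norm (a k) * wt \<rho> k) \<le> R" if F: "finite F" for F
  proof (rule LIMSEQ_le_const2)
    show "(\<lambda>n. \<Sum>k\<in>F. norm (fc (v n) k) * wt \<rho> k) \<longlonglongrightarrow> (\<Sum>k\<in>F. norm (a k) * wt \<rho> k)"
      by (intro tendsto_intros a)
    show "\<exists>N. \<forall>n\<ge>N. (\<Sum>k\<in>F. norm (fc (v n) k) * wt \<rho> k) \<le> R" using WB_D[OF v F] by blast
  qed
  note w = syn[OF \<rho> aR]
  have "WB \<rho> (\<lambda>z. syn a z - v n z) (2 * D / 2 ^ n)" for n
  proof (rule WB_I)
    show "per_hol \<rho> (\<lambda>z. syn a z - v n z)" by (intro per_hol_diff WB_per_hol[OF w(1)] WB_per_hol[OF v])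
    fix F :: "int set" assume F: "finite F"
    have "(\<Sum>k\<in>F. norm (a k - fc (v n) k) * wt \<rho> k) \<le> 2 * D / 2 ^ n"
    proof (rule LIMSEQ_le_const2)
      show "(\<lambda>j. \<Sum>k\<in>F. norm (fc (v (j + n)) k - fc (v n) k) * wt \<rho> k) \<longlonglongrightarrow> (\<Sum>k\<in>F. norm (a k - fc (v n) k) * wt \<rho> k)"
        by (intro tendsto_intros LIMSEQ_ignore_initial_segment[OF a])
      show "\<exists>N. \<forall>j\<ge>N. (\<Sum>k\<in>F. norm (fc (v (j + n)) k - fc (v n) k) * wt \<rho> k) \<le> 2 * D / 2 ^ n"
        using WB_D[OF vd[of n] F] by (simp add: fd add.commute)
    qed
    then show "(\<Sum>k\<in>F. norm (fc (\<lambda>z. syn a z - v n z) k) * wt \<rho> k) \<le> 2 * D / 2 ^ n"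
      by (simp add: fc_diff[OF WB_per_hol[OF w(1)] WB_per_hol[OF v] \<rho>] w(2))
  qed
  with w a that show ?thesis by metis
qed

text \<open>The improvement step has \<open>2 * A\<close> as its fixed value, and iteration
  approaches it geometrically. Any a priori bound \<open>D\<close>, however crude, is thus replaced
  by one that depends on \<open>A\<close> alone.\<close>

lemma WB_halving:
  assumes "WB \<rho> f D" and step: "\<And>D. WB \<rho> f D \<Longrightarrow> WB \<rho> f (D / 2 + A)"
  shows "WB \<rho> f (2 * A)"
proof -
  have n: "WB \<rho> f (2 * A + (D - 2 * A) / 2 ^ n)" for n
  proof (induction n)
    case 0 then show ?case using assms(1) by simp
  next
    case (Suc n)
    have "(2 * A + (D - 2 * A) / 2 ^ n) / 2 + A = 2 * A + (D - 2 * A) / 2 ^ Suc n" by (simp add: field_simps)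
    with step[OF Suc] show ?case by (simp only:)
  qed
  show ?thesis
  proof (rule WB_Inf[OF \<rho>])
    fix e :: real assume e: "0 < e"
    have "(\<lambda>n. (D - 2 * A) * (1 / 2) ^ n) \<longlonglongrightarrow> 0" by (intro tendsto_mult_right_zero LIMSEQ_power_zero) simp
    then have "\<forall>\<^sub>F n in sequentially. (D - 2 * A) * (1 / 2) ^ n < e" using e order_tendstoD(2) by blast
    then obtain k where "(D - 2 * A) * (1 / 2) ^ k < e" by (auto simp: eventually_sequentially)
    then show "WB \<rho> f (2 * A + e)" using WB_mono[OF n[of k], of "2 * A + e"] by (simp add: power_divide)
  qed
qed

section \<open>The contraction \<open>Top\<close> on the ball of radius \<open>r\<close>\<close>

context
  fixes r b C \<alpha> M Q :: real
  assumes r: "0 < r" "r \<le> 1 / 2" and b: "\<rho> + r < b" and sd: "small_div C \<alpha>"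
    and Q_def: "Q = C * cs (b - \<rho> - r)" and QM: "30 * Q * M \<le> r"
begin

lemma gap_pos: "0 < b - \<rho> - r" using b by simp

lemma C_ge1: "1 \<le> C" using sd by (simp add: small_div_def)

lemma cs_gap_ge1: "1 \<le> cs (b - \<rho> - r)" by (rule cs_ge1[OF gap_pos])

lemma Q_ge1: "1 \<le> Q" unfolding Q_def using mult_mono[OF C_ge1 cs_gap_ge1] C_ge1 by simp

lemma Uop_WB:
  assumes v: "WB \<rho> v r" and x: "per_hol b \<eta>" "\<And>z. z \<in> strip b \<Longrightarrow> norm (\<eta> z) \<le> M"
  shows "WB \<rho> (\<lambda>z. \<eta> (z + Dinv v z) * (1 + v z)) (2 * M * cs (b - \<rho> - r))"
    "WB \<rho> (Uop \<alpha> \<eta> v) (2 * Q * M)"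
    "fc (Uop \<alpha> \<eta> v) n = sdm \<alpha> n * fc (\<lambda>z. \<eta> (z + Dinv v z) * (1 + v z)) n"
proof -
  have M0: "0 \<le> M" using order_trans[OF norm_ge_zero x(2)[of 0]] b \<rho> r by (simp add: strip_iff)
  have "WB \<rho> (\<lambda>z. \<eta> (z + Dinv v z) * (1 + v z)) ((M * cs (b - \<rho> - r)) * (norm (1 :: complex) + r))"
    by (intro WB_mult WB_comp[OF \<rho> x(1) Dinv_WB gap_pos x(2)] WB_add WB_const v \<rho>)
  then show f: "WB \<rho> (\<lambda>z. \<eta> (z + Dinv v z) * (1 + v z)) (2 * M * cs (b - \<rho> - r))"
    by (rule WB_mono) (use mult_left_mono[of "1 + r" 2 "M * cs (b - \<rho> - r)"] r M0 cs_gap_ge1 in \<open>simp add: mult_ac\<close>)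
  show "WB \<rho> (Uop \<alpha> \<eta> v) (2 * Q * M)"
    using mul(1)[OF \<rho> f sdm_le[OF sd]] by (simp add: Uop_def Q_def mult_ac)
  show "fc (Uop \<alpha> \<eta> v) n = sdm \<alpha> n * fc (\<lambda>z. \<eta> (z + Dinv v z) * (1 + v z)) n"
    using mul(2)[OF \<rho> f sdm_le[OF sd]] by (simp add: Uop_def)
qed

text \<open>Three changes are separated: in the argument of \<open>\<eta>\<close>, in the factor
  \<open>1 + v\<close>, and from \<open>\<eta>\<close> to \<open>\<theta>\<close>. With
  \<open>1 + r \<le> 2\<close> they contribute \<open>2 * M * D\<close>, \<open>M * D\<close> and
  \<open>2 * \<Delta>\<close>.\<close>

lemma Uop_diff:
  assumes v: "WB \<rho> v r" and w: "WB \<rho> w r" and d: "WB \<rho> (\<lambda>z. v z - w z) D"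
    and x: "per_hol b \<eta>" "\<And>z. z \<in> strip b \<Longrightarrow> norm (\<eta> z) \<le> M"
    and y: "per_hol b \<theta>" "\<And>z. z \<in> strip b \<Longrightarrow> norm (\<theta> z) \<le> M"
    and xy: "\<And>z. z \<in> strip b \<Longrightarrow> norm (\<eta> z - \<theta> z) \<le> \<Delta>"
  shows "WB \<rho> (\<lambda>z. Uop \<alpha> \<eta> v z - Uop \<alpha> \<theta> w z) (Q * (3 * M * D + 2 * \<Delta>))"
proof -
  let ?c = "cs (b - \<rho> - r)"
  have M0: "0 \<le> M" using order_trans[OF norm_ge_zero x(2)[of 0]] b \<rho> r by (simp add: strip_iff)
  have D0: "0 \<le> \<Delta>" using order_trans[OF norm_ge_zero xy[of 0]] b \<rho> r by (simp add: strip_iff)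
  have DD: "0 \<le> D" using WB_nonneg[OF d] .
  let ?g = "Dinv v" and ?h = "Dinv w"
  have "WB \<rho> (\<lambda>z. (\<eta> (z + ?g z) - \<eta> (z + ?h z)) * (1 + v z) + \<eta> (z + ?h z) * (v z - w z) + (\<eta> (z + ?h z) - \<theta> (z + ?h z)) * (1 + w z))
     ((M * D * ?c) * (norm (1 :: complex) + r) + (M * ?c) * D + (\<Delta> * ?c) * (norm (1 :: complex) + r))"
    by (intro WB_mult WB_add WB_const v w d \<rho> WB_comp[OF \<rho> x(1) Dinv_WB gap_pos x(2)]
        WB_comp[OF \<rho> per_hol_diff[OF x(1) y(1)] Dinv_WB gap_pos xy]
        WB_comp_diff[OF \<rho> x(1) Dinv_WB Dinv_WB Dinv_diff[OF \<rho> v w] gap_pos x(2)])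
  then have f: "WB \<rho> (\<lambda>z. \<eta> (z + ?g z) * (1 + v z) - \<theta> (z + ?h z) * (1 + w z)) (?c * (3 * M * D + 2 * \<Delta>))"
  proof (rule WB_mono[OF WB_cong[OF \<rho>]])
    have "M * D * ?c * (norm (1 :: complex) + r) \<le> M * D * ?c * 2" "\<Delta> * ?c * (norm (1 :: complex) + r) \<le> \<Delta> * ?c * 2"
      using r M0 D0 DD cs_gap_ge1 by (intro mult_left_mono mult_nonneg_nonneg; simp)+
    then show "(M * D * ?c) * (norm (1 :: complex) + r) + (M * ?c) * D + (\<Delta> * ?c) * (norm (1 :: complex) + r) \<le> ?c * (3 * M * D + 2 * \<Delta>)"
      by (simp add: algebra_simps)
  qed (simp add: algebra_simps)
  show ?thesis
    using mul_diff[OF \<rho> Uop_WB(1)[OF v x] Uop_WB(1)[OF w y] f sdm_le[OF sd]] by (simp add: Uop_def Q_def mult_ac)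
qed

text \<open>The smallness condition \<open>30 * Q * M \<le> r\<close> covers three demands:
  \<open>2 * Q * M \<le> 1 / 15\<close> for \<open>normalize_exp\<close>,
  \<open>6 * Q * M \<le> r\<close> for staying in the ball, and
  \<open>12 * Q * M \<le> 1 / 2\<close> for the contraction in \<open>Top_diff\<close>.\<close>

lemma Top_WB:
  assumes v: "WB \<rho> v r" and x: "per_hol b \<eta>" "\<And>z. z \<in> strip b \<Longrightarrow> norm (\<eta> z) \<le> M"
  shows "WB \<rho> (Top \<alpha> \<eta> v) r" "fc (Top \<alpha> \<eta> v) 0 = 0" "1 / 2 \<le> norm (fc (\<lambda>z. exp (Uop \<alpha> \<eta> v z)) 0)"
proof -
  have M0: "0 \<le> M" using order_trans[OF norm_ge_zero x(2)[of 0]] b \<rho> r by (simp add: strip_iff)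
  have "0 \<le> Q * M" using M0 Q_ge1 by simp
  then have s: "2 * Q * M \<le> 1 / 15" "3 * (2 * Q * M) \<le> r" using QM r by auto
  note u = Uop_WB(2)[OF v x]
  have d: "WB \<rho> (\<lambda>z. Uop \<alpha> \<eta> v z - Uop \<alpha> \<eta> v z) 0" using WB_0[OF \<rho>] by simp
  note n = normalize_exp[OF u u d s(1)]
  show "WB \<rho> (Top \<alpha> \<eta> v) r" unfolding Top_def by (rule WB_mono[OF n(1) s(2)])
  show "fc (Top \<alpha> \<eta> v) 0 = 0" unfolding Top_def by (rule n(2))
  show "1 / 2 \<le> norm (fc (\<lambda>z. exp (Uop \<alpha> \<eta> v z)) 0)" by (rule n(4))
qed

lemma Top_diff:
  assumes v: "WB \<rho> v r" and w: "WB \<rho> w r" and d: "WB \<rho> (\<lambda>z. v z - w z) D"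
    and x: "per_hol b \<eta>" "\<And>z. z \<in> strip b \<Longrightarrow> norm (\<eta> z) \<le> M"
    and y: "per_hol b \<theta>" "\<And>z. z \<in> strip b \<Longrightarrow> norm (\<theta> z) \<le> M"
    and xy: "\<And>z. z \<in> strip b \<Longrightarrow> norm (\<eta> z - \<theta> z) \<le> \<Delta>"
  shows "WB \<rho> (\<lambda>z. Top \<alpha> \<eta> v z - Top \<alpha> \<theta> w z) (D / 2 + 10 * Q * \<Delta>)"
proof -
  have M0: "0 \<le> M" using order_trans[OF norm_ge_zero x(2)[of 0]] b \<rho> r by (simp add: strip_iff)
  have D0: "0 \<le> \<Delta>" using order_trans[OF norm_ge_zero xy[of 0]] b \<rho> r by (simp add: strip_iff)
  have DD: "0 \<le> D" using WB_nonneg[OF d] .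
  have "0 \<le> Q * M" using M0 Q_ge1 by simp
  then have s: "2 * Q * M \<le> 1 / 15" using QM r by auto
  have n: "WB \<rho> (\<lambda>z. Top \<alpha> \<eta> v z - Top \<alpha> \<theta> w z) (4 * (Q * (3 * M * D + 2 * \<Delta>)))"
    unfolding Top_def by (rule normalize_exp(3)[OF Uop_WB(2)[OF v x] Uop_WB(2)[OF w y] Uop_diff[OF v w d x y xy] s])
  have "12 * (Q * M) * D \<le> (1 / 2) * D" using QM r by (intro mult_right_mono DD) simp
  moreover have "0 \<le> Q * \<Delta>" using D0 Q_ge1 by simp
  ultimately have "4 * (Q * (3 * M * D + 2 * \<Delta>)) \<le> D / 2 + 10 * Q * \<Delta>" by (simp add: algebra_simps)
  then show ?thesis using n WB_mono by blast
qed

text \<open>Picard iteration from 0. The first increment is at most \<open>r\<close> because the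
  iterates stay in the ball, and each later one is half its predecessor. The limit has mean zero
  because \<open>Top\<close> normalises every iterate.\<close>

lemma Top_fixed_point:
  assumes x: "per_hol b \<eta>" "\<And>z. z \<in> strip b \<Longrightarrow> norm (\<eta> z) \<le> M"
  obtains v where "WB \<rho> v r" "fc v 0 = 0" "\<And>z. z \<in> strip \<rho> \<Longrightarrow> Top \<alpha> \<eta> v z = v z"
proof -
  define s where "s = (\<lambda>n. (Top \<alpha> \<eta> ^^ n) (\<lambda>_. 0))"
  have sS: "s (Suc n) = Top \<alpha> \<eta> (s n)" for n by (simp add: s_def)
  have s: "WB \<rho> (s n) r" for n
  proof (induction n)
    case 0 show ?case using WB_mono[OF WB_0[OF \<rho>], of r] r by (simp add: s_def)
  qed (simp add: sS Top_WB(1)[OF _ x])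
  have s0: "fc (s n) 0 = 0" for n
    by (cases n) (use Top_WB(2)[OF s x] in \<open>auto simp: sS\<close>, simp add: s_def fc_def)
  have d: "WB \<rho> (\<lambda>z. s (Suc n) z - s n z) (r / 2 ^ n)" for n
  proof (induction n)
    case 0 show ?case using s[of 1] by (simp add: s_def)
  next
    case (Suc n)
    have "WB \<rho> (\<lambda>z. Top \<alpha> \<eta> (s (Suc n)) z - Top \<alpha> \<eta> (s n) z) ((r / 2 ^ n) / 2 + 10 * Q * 0)"
      by (rule Top_diff[OF s s Suc x x]) simp_all
    then show ?case by (simp add: sS mult.commute)
  qed
  obtain v where v: "WB \<rho> v r" "\<And>n. WB \<rho> (\<lambda>z. v z - s n z) (2 * r / 2 ^ n)" "\<And>k. (\<lambda>n. fc (s n) k) \<longlonglongrightarrow> fc v k"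
    using WB_complete[OF s d] by metis
  have "fc v 0 = 0" using v(3)[of 0] LIMSEQ_unique[OF _ tendsto_const] by (simp add: s0) 
  moreover have "Top \<alpha> \<eta> v z = v z" if z: "z \<in> strip \<rho>" for z
  proof -
    have le: "norm (Top \<alpha> \<eta> v z - v z) \<le> (4 * r) * (1 / 2) ^ n" for n
    proof -
      have "WB \<rho> (\<lambda>z. (Top \<alpha> \<eta> v z - Top \<alpha> \<eta> (s n) z) + (s (Suc n) z - v z)) (((2 * r / 2 ^ n) / 2 + 10 * Q * 0) + 2 * r / 2 ^ Suc n)"
        by (rule WB_add[OF \<rho> Top_diff[OF v(1) s v(2) x x] WB_minus_commute[OF \<rho> v(2)]]) auto
      from WB_norm[OF \<rho> this z] have "norm (Top \<alpha> \<eta> v z - v z) \<le> 2 * r / 2 ^ n" by (simp add: sS)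
      also have "\<dots> \<le> (4 * r) * (1 / 2) ^ n" using r by (simp add: power_divide divide_right_mono)
      finally show ?thesis .
    qed
    have "(\<lambda>n. (4 * r) * (1 / 2) ^ n) \<longlonglongrightarrow> 0" by (intro tendsto_mult_right_zero LIMSEQ_power_zero) simp
    then have "norm (Top \<alpha> \<eta> v z - v z) \<le> 0" by (rule LIMSEQ_le_const) (use le in auto)
    then show ?thesis by simp
  qed
  ultimately show ?thesis using v(1) that by blast
qed

text \<open>For two fixed points \<open>Top_diff\<close> bounds their difference by half of itself
  plus a multiple of \<open>\<Delta>\<close>, and \<open>WB_halving\<close> absorbs the half. The
  case \<open>\<Delta> = 0\<close> is uniqueness, the general one Lipschitz dependence on the
  data.\<close>

lemma Top_fixed_points_near:
  assumes v: "WB \<rho> v r" "\<And>z. z \<in> strip \<rho> \<Longrightarrow> Top \<alpha> \<eta> v z = v z"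
    and w: "WB \<rho> w r" "\<And>z. z \<in> strip \<rho> \<Longrightarrow> Top \<alpha> \<theta> w z = w z"
    and x: "per_hol b \<eta>" "\<And>z. z \<in> strip b \<Longrightarrow> norm (\<eta> z) \<le> M"
    and y: "per_hol b \<theta>" "\<And>z. z \<in> strip b \<Longrightarrow> norm (\<theta> z) \<le> M"
    and xy: "\<And>z. z \<in> strip b \<Longrightarrow> norm (\<eta> z - \<theta> z) \<le> \<Delta>"
  shows "WB \<rho> (\<lambda>z. v z - w z) (20 * Q * \<Delta>)"
proof -
  have "WB \<rho> (\<lambda>z. v z - w z) (2 * (10 * Q * \<Delta>))"
  proof (rule WB_halving[OF WB_diff[OF \<rho> v(1) w(1)]])
    fix D assume "WB \<rho> (\<lambda>z. v z - w z) D"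
    from Top_diff[OF v(1) w(1) this x y xy] show "WB \<rho> (\<lambda>z. v z - w z) (D / 2 + 10 * Q * \<Delta>)"
    proof (rule WB_cong[OF \<rho>])
      fix z assume "z \<in> strip \<rho>"
      from v(2)[OF this] w(2)[OF this] show "Top \<alpha> \<eta> v z - Top \<alpha> \<theta> w z = v z - w z" by simp
    qed
  qed
  then show ?thesis by (simp add: mult.assoc)
qed

end

end

section \<open>Conjugacies with counterterm\<close>

lemma deriv_bound:
  assumes f: "f holomorphic_on strip (b + \<delta>)" and \<delta>: "0 < \<delta>" and M: "\<And>z. z \<in> strip (b + \<delta>) \<Longrightarrow> norm (f z) \<le> M"
    and z: "z \<in> strip b"
  shows "norm (deriv f z) \<le> M / \<delta>"
proof -
  have sub: "cball z \<delta> \<subseteq> strip (b + \<delta>)"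
  proof
    fix w assume "w \<in> cball z \<delta>"
    then have "z + (w - z) \<in> strip (b + \<delta>)" by (intro strip_add z) (simp add: dist_norm norm_minus_commute)
    then show "w \<in> strip (b + \<delta>)" by simp
  qed
  have "norm ((deriv ^^ 1) f z) \<le> fact 1 * M / \<delta> ^ 1"
  proof (rule Cauchy_inequality[OF _ _ \<delta>])
    show "f holomorphic_on ball z \<delta>" using f sub holomorphic_on_subset ball_subset_cball by blast
    show "continuous_on (cball z \<delta>) f"
      using holomorphic_on_imp_continuous_on[OF f] sub continuous_on_subset by blast
    fix x assume "norm (z - x) = \<delta>"
    then have "x \<in> cball z \<delta>" by (simp add: dist_norm)
    then show "norm (f x) \<le> M" using M sub by blast
  qed
  then show ?thesis by simp
qed

section \<open>The logarithm of the derivative of the map\<close>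

definition bnd :: "real \<Rightarrow> (complex \<Rightarrow> complex) \<Rightarrow> real \<Rightarrow> bool"
  where "bnd b f M \<longleftrightarrow> (\<forall>z\<in>strip b. norm (f z) \<le> M)"

lemma bndD: "bnd b f M \<Longrightarrow> z \<in> strip b \<Longrightarrow> norm (f z) \<le> M"
  by (simp add: bnd_def)

definition psi :: "(complex \<Rightarrow> complex) \<Rightarrow> complex \<Rightarrow> complex"
  where "psi \<phi> = (\<lambda>z. Ln (1 + deriv \<phi> z))"

lemma half_not_nonpos:
  fixes w :: complex assumes "norm w < 1 / 2" shows "1 + w \<notin> \<real>\<^sub>\<le>\<^sub>0" "1 + w \<noteq> 0"
proof -
  have "\<bar>Re w\<bar> < 1 / 2" using assms abs_Re_le_cmod[of w] by linarith
  then have "0 < Re (1 + w)" by simp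
  then show "1 + w \<notin> \<real>\<^sub>\<le>\<^sub>0" by (auto simp: complex_nonpos_Reals_iff)
  then show "1 + w \<noteq> 0" by auto
qed

lemma Ln_diff_le:
  fixes v w :: complex
  assumes "norm v < 1 / 2" "norm w < 1 / 2"
  shows "norm (Ln (1 + v) - Ln (1 + w)) \<le> 2 * norm (v - w)"
proof (rule field_differentiable_bound[of "ball 0 (1 / 2)"])
  fix z :: complex assume z: "z \<in> ball 0 (1 / 2)"
  then have n: "norm z < 1 / 2" by simp
  have "(Ln has_field_derivative inverse (z + 1)) (at (z + 1))"
    by (rule has_field_derivative_Ln) (use half_not_nonpos(1)[OF n] in \<open>simp add: add.commute\<close>)
  then have "((\<lambda>z. Ln (z + 1)) has_field_derivative inverse (z + 1)) (at z)" by (simp only: DERIV_shift)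
  then have "((\<lambda>z. Ln (1 + z)) has_field_derivative 1 / (1 + z)) (at z)" by (simp only: add.commute divide_inverse mult_1)
  then show "((\<lambda>z. Ln (1 + z)) has_field_derivative 1 / (1 + z)) (at z within ball 0 (1 / 2))"
    by (rule has_field_derivative_at_within)
  have "1 - norm z \<le> norm (1 + z)" using norm_triangle_ineq2[of 1 "- z"] by simp
  then have "1 / 2 \<le> norm (1 + z)" using n by linarith
  then have "1 / norm (1 + z) \<le> 1 / (1 / 2)" by (intro frac_le) auto
  then show "norm (1 / (1 + z)) \<le> 2" by (simp add: norm_divide)
qed (use assms in auto)

text \<open>Two Cauchy estimates at a cost of \<open>\<delta>\<close> each, for
  \<open>deriv \<phi>\<close> and for the derivative of the logarithm. The condition
  \<open>M < \<delta> / 2\<close> keeps \<open>1 + deriv \<phi> z\<close> within 1/2 of 1, away from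
  the cut of \<open>Ln\<close>.\<close>

lemma psi:
  assumes \<phi>: "per_hol (b + 2 * \<delta>) \<phi>" and \<delta>: "0 < \<delta>" and M: "bnd (b + 2 * \<delta>) \<phi> M"
    and M2: "M < \<delta> / 2"
  shows "per_hol (b + \<delta>) (psi \<phi>)"
    "\<And>z. z \<in> strip (b + \<delta>) \<Longrightarrow> norm (deriv \<phi> z) \<le> M / \<delta>"
    "\<And>z. z \<in> strip (b + \<delta>) \<Longrightarrow> norm (deriv \<phi> z) < 1 / 2"
    "\<And>z. z \<in> strip (b + \<delta>) \<Longrightarrow> exp (psi \<phi> z) = 1 + deriv \<phi> z"
    "\<And>z. z \<in> strip (b + \<delta>) \<Longrightarrow> norm (psi \<phi> z) \<le> 2 * M / \<delta>"
    "\<And>z. z \<in> strip b \<Longrightarrow> norm (deriv (psi \<phi>) z) \<le> 2 * M / \<delta>\<^sup>2"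
proof -
  have e: "b + 2 * \<delta> = (b + \<delta>) + \<delta>" by simp
  show d: "norm (deriv \<phi> z) \<le> M / \<delta>" if "z \<in> strip (b + \<delta>)" for z
    by (rule deriv_bound[OF _ \<delta> _ that]) (use per_hol_holo[OF \<phi>] M in \<open>simp_all add: e bnd_def\<close>)
  have "M / \<delta> < 1 / 2" using M2 \<delta> by (simp add: field_simps)
  then show h: "norm (deriv \<phi> z) < 1 / 2" if "z \<in> strip (b + \<delta>)" for z using d[OF that] by linarith
  have pd: "per_hol (b + \<delta>) (deriv \<phi>)" by (rule per_hol_mono[OF per_hol_deriv[OF \<phi>]]) (use \<delta> in simp)
  show p: "per_hol (b + \<delta>) (psi \<phi>)"
  proof (rule per_holI)
    show "psi \<phi> holomorphic_on strip (b + \<delta>)" unfolding psi_def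
      by (intro holomorphic_intros per_hol_holo[OF pd] half_not_nonpos h)
    show "psi \<phi> (z + 1) = psi \<phi> z" if "z \<in> strip (b + \<delta>)" for z
      using per_hol_per[OF pd that] by (simp add: psi_def)
  qed
  show "exp (psi \<phi> z) = 1 + deriv \<phi> z" if "z \<in> strip (b + \<delta>)" for z
    using half_not_nonpos(2)[OF h[OF that]] by (simp add: psi_def)
  show n: "norm (psi \<phi> z) \<le> 2 * M / \<delta>" if "z \<in> strip (b + \<delta>)" for z
    using norm_Ln_le[OF h[OF that]] d[OF that] by (simp add: psi_def)
  show "norm (deriv (psi \<phi>) z) \<le> 2 * M / \<delta>\<^sup>2" if "z \<in> strip b" for z
    using deriv_bound[OF per_hol_holo[OF p] \<delta> n that] by (simp add: power2_eq_square)
qed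

lemma psi_diff:
  assumes \<phi>: "per_hol (b + 2 * \<delta>) \<phi>" "bnd (b + 2 * \<delta>) \<phi> M"
    and \<theta>: "per_hol (b + 2 * \<delta>) \<theta>" "bnd (b + 2 * \<delta>) \<theta> M"
    and \<delta>: "0 < \<delta>" and M2: "M < \<delta> / 2"
    and d: "bnd (b + 2 * \<delta>) (\<lambda>z. \<phi> z - \<theta> z) \<Delta>" and z: "z \<in> strip b"
  shows "norm (deriv (psi \<phi>) z - deriv (psi \<theta>) z) \<le> 2 * \<Delta> / \<delta>\<^sup>2"
proof -
  note p = psi[OF \<phi>(1) \<delta> \<phi>(2) M2] and q = psi[OF \<theta>(1) \<delta> \<theta>(2) M2]
  have e: "b + 2 * \<delta> = (b + \<delta>) + \<delta>" by simp
  have D: "(f has_field_derivative deriv f w) (at w)" if "per_hol c f" "w \<in> strip c" for f c w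
    using per_hol_holo[OF that(1)] that(2) open_strip holomorphic_derivI by blast
  have dd: "deriv (\<lambda>w. f w - g w) w = deriv f w - deriv g w" if "per_hol c f" "per_hol c g" "w \<in> strip c" for f g c w
    using D[OF that(1,3)] D[OF that(2,3)] by (auto intro!: DERIV_imp_deriv derivative_intros)
  have 1: "norm (psi \<phi> w - psi \<theta> w) \<le> 2 * \<Delta> / \<delta>" if w: "w \<in> strip (b + \<delta>)" for w
  proof -
    have w2: "w \<in> strip (b + 2 * \<delta>)" using w \<delta> strip_mono[of w "b + \<delta>" "b + 2 * \<delta>"] by simp
    have "norm (deriv (\<lambda>z. \<phi> z - \<theta> z) w) \<le> \<Delta> / \<delta>"
      by (rule deriv_bound[OF _ \<delta> _ w]) (use per_hol_holo[OF per_hol_diff[OF \<phi>(1) \<theta>(1)]] d in \<open>simp_all add: e bnd_def\<close>)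
    then have "norm (deriv \<phi> w - deriv \<theta> w) \<le> \<Delta> / \<delta>" by (simp add: dd[OF \<phi>(1) \<theta>(1) w2])
    then show ?thesis using Ln_diff_le[OF p(3)[OF w] q(3)[OF w]] by (simp add: psi_def)
  qed
  have "norm (deriv (\<lambda>z. psi \<phi> z - psi \<theta> z) z) \<le> 2 * \<Delta> / \<delta> / \<delta>"
    by (rule deriv_bound[OF per_hol_holo[OF per_hol_diff[OF p(1) q(1)]] \<delta> 1 z])
  moreover have "z \<in> strip (b + \<delta>)" using z \<delta> strip_mono[of z b "b + \<delta>"] by simp
  ultimately show ?thesis by (simp add: dd[OF p(1) q(1)] power2_eq_square)
qed

text \<open>\<open>id + g\<close> conjugates \<open>z + \<alpha> + \<phi> z + l\<close> to the rotation; the constant \<open>l\<close> is the counterterm.\<close>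

definition sol :: "real \<Rightarrow> real \<Rightarrow> real \<Rightarrow> (complex \<Rightarrow> complex) \<Rightarrow> (complex \<Rightarrow> complex) \<Rightarrow> complex \<Rightarrow> bool"
  where "sol \<alpha> \<rho> r \<phi> g l \<longleftrightarrow> per_hol \<rho> g \<and> fc g 0 = 0 \<and> WB \<rho> (deriv g) r \<and>
    (\<forall>z\<in>strip \<rho>. g (z + of_real \<alpha>) - g z = \<phi> (z + g z) + l)"

text \<open>Having mean zero, \<open>g\<close> is the primitive \<open>Dinv (deriv g)\<close>, and
  \<open>Dinv\<close> does not increase the norm.\<close>

lemma sol_WB:
  assumes \<rho>: "0 < \<rho>" and s: "sol \<alpha> \<rho> r \<phi> g l"
  shows "WB \<rho> g r"
proof (rule WB_cong[OF \<rho> Dinv_WB[OF \<rho>]])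
  show "WB \<rho> (deriv g) r" using s by (simp add: sol_def)
  show "Dinv (deriv g) z = g z" if "z \<in> strip \<rho>" for z
    using s that by (intro Dinv_deriv[OF \<rho>]) (auto simp: sol_def)
qed

lemma deriv_comp_id_add:
  assumes x: "per_hol b f" and g: "WB \<rho> g r" and \<rho>: "0 < \<rho>" and b: "\<rho> + r \<le> b" and z: "z \<in> strip \<rho>"
  shows "((\<lambda>z. f (z + g z)) has_field_derivative deriv f (z + g z) * (1 + deriv g z)) (at z)"
proof -
  have s: "z + g z \<in> strip b"
    using strip_add[OF z WB_norm[OF \<rho> g z]] b strip_mono by blast
  have 1: "(f has_field_derivative deriv f (z + g z)) (at (z + g z))"
    using per_hol_holo[OF x] s open_strip holomorphic_derivI by blast
  have 2: "(g has_field_derivative deriv g z) (at z)"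
    using per_hol_holo[OF WB_per_hol[OF g]] z open_strip holomorphic_derivI by blast
  show ?thesis by (rule DERIV_chain2[where g = "\<lambda>z. z + g z", OF 1]) (auto intro!: derivative_eq_intros 2)
qed

section \<open>Conjugacies as fixed points of the contraction\<close>

context
  fixes \<rho> r b C \<alpha> M Q \<delta> :: real
  assumes \<rho>: "0 < \<rho>" and r: "0 < r" "r \<le> 1 / 4" and b: "\<rho> + r < b" and sd: "small_div C \<alpha>"
    and Q_def: "Q = C * cs (b - \<rho> - r)" and \<delta>: "0 < \<delta>" and QM: "30 * Q * (2 * M / \<delta>\<^sup>2) \<le> r" and M2: "M < \<delta> / 2"
begin

lemma r_le_half: "r \<le> 1 / 2" using r by simp

lemma strip_shift: "z \<in> strip \<rho> \<Longrightarrow> z + of_real \<alpha> \<in> strip \<rho>"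
  by (simp add: strip_iff)

lemma per_hol_shift: "per_hol \<rho> f \<Longrightarrow> per_hol \<rho> (\<lambda>z. f (z + of_real \<alpha>))"
  by (erule per_hol_shift_strip) simp

lemma fc_shift_real: "per_hol \<rho> f \<Longrightarrow> fc (\<lambda>z. f (z + of_real \<alpha>)) n = ee n (of_real \<alpha>) * fc f n"
  by (rule fc_shift) (use \<rho> in auto)

lemma sdm_eq: "(ee n (of_real \<alpha>) - 1) * (sdm \<alpha> n * (2 * of_real pi * \<i> * of_int n * c)) = (if n = 0 then 0 else c)"
  using ee_nonres[OF sd, of n] by (simp add: sdm_def)

context
  fixes \<phi> :: "complex \<Rightarrow> complex"
  assumes \<phi>: "per_hol (b + 2 * \<delta>) \<phi>" "bnd (b + 2 * \<delta>) \<phi> M"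
begin

lemmas psi_phi = psi[OF \<phi>(1) \<delta> \<phi>(2) M2]

lemma deriv_psi_per_hol: "per_hol b (deriv (psi \<phi>))"
  by (rule per_hol_mono[OF per_hol_deriv[OF psi_phi(1)]]) (use \<delta> in simp)

lemma psi_per_hol: "per_hol b (psi \<phi>)"
  by (rule per_hol_mono[OF psi_phi(1)]) (use \<delta> in simp)

lemma phi_per_hol: "per_hol b \<phi>"
  by (rule per_hol_mono[OF \<phi>(1)]) (use \<delta> in simp)

lemma comp_mem_strip: "WB \<rho> g r \<Longrightarrow> z \<in> strip \<rho> \<Longrightarrow> z + g z \<in> strip b"
  using strip_add[OF _ WB_norm[OF \<rho>]] b strip_mono[of _ "\<rho> + r" b] by fastforce

lemma strip_widen: "z \<in> strip b \<Longrightarrow> z \<in> strip (b + \<delta>)"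
  using \<delta> strip_mono[of z b "b + \<delta>"] by simp

text \<open>Exponentiating the cohomological equation for \<open>u\<close> gives the differentiated
  conjugacy equation up to the constant factor \<open>k\<close>. Once averaging has shown that this
  factor is 1, integration yields the conjugacy equation itself, and the counterterm is the constant
  of integration.\<close>

lemma fixed_point_sol:
  assumes v: "WB \<rho> v r" "fc v 0 = 0" "\<And>z. z \<in> strip \<rho> \<Longrightarrow> Top \<alpha> (deriv (psi \<phi>)) v z = v z"
  shows "\<exists>l. sol \<alpha> \<rho> r \<phi> (Dinv v) l"
proof -
  define g where "g = Dinv v"
  define u where "u = Uop \<alpha> (deriv (psi \<phi>)) v"
  define m where "m = fc (\<lambda>z. exp (u z)) 0"
  define f where "f = (\<lambda>z. psi \<phi> (z + g z))"
  have g: "WB \<rho> g r" unfolding g_def by (rule Dinv_WB[OF \<rho> v(1)])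
  have gp: "per_hol \<rho> g" by (rule WB_per_hol[OF g])
  have g0: "fc g 0 = 0" unfolding g_def by (simp add: Dinv_fc[OF \<rho> v(1)])
  have dg: "deriv g z = v z" if "z \<in> strip \<rho>" for z
    unfolding g_def by (rule deriv_Dinv[OF \<rho> v(1,2) that])
  have vd: "WB \<rho> (deriv g) r" by (rule WB_cong[OF \<rho> v(1)]) (simp add: dg)
  have fp: "per_hol \<rho> f" unfolding f_def by (rule per_hol_comp[OF \<rho> psi_per_hol g]) (use b in simp)
  have df: "deriv f z = deriv (psi \<phi>) (z + g z) * (1 + v z)" if z: "z \<in> strip \<rho>" for z
    unfolding f_def using deriv_comp_id_add[OF psi_per_hol g \<rho> _ z] b dg[OF z] by (auto intro: DERIV_imp_deriv)
  note U = Uop_WB[OF \<rho> r(1) r_le_half b sd Q_def QM v(1) deriv_psi_per_hol psi_phi(6)]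
  have up: "per_hol \<rho> u" unfolding u_def by (rule WB_per_hol[OF U(2)])
  have fu: "fc u n = sdm \<alpha> n * (2 * of_real pi * \<i> * of_int n * fc f n)" for n
  proof -
    have "fc u n = sdm \<alpha> n * fc (\<lambda>z. deriv (psi \<phi>) (z + Dinv v z) * (1 + v z)) n" unfolding u_def by (rule U(3))
    also have "fc (\<lambda>z. deriv (psi \<phi>) (z + Dinv v z) * (1 + v z)) n = fc (deriv f) n"
      by (rule fc_cong) (simp add: df \<rho> g_def)
    finally show ?thesis by (simp add: fc_deriv_eq[OF fp \<rho>])
  qed
  have coh: "u (z + of_real \<alpha>) - u z = f z - fc f 0" if z: "z \<in> strip \<rho>" for z
  proof (rule per_hol_eqI[OF per_hol_diff[OF per_hol_shift[OF up] up] per_hol_diff[OF fp per_hol_const] _ z])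
    fix n
    have "fc (\<lambda>z. u (z + of_real \<alpha>) - u z) n = (ee n (of_real \<alpha>) - 1) * fc u n"
      by (simp add: fc_diff[OF per_hol_shift[OF up] up \<rho>] fc_shift_real[OF up] algebra_simps)
    also have "\<dots> = (if n = 0 then 0 else fc f n)" unfolding fu by (rule sdm_eq)
    also have "\<dots> = fc (\<lambda>z. f z - fc f 0) n" by (simp add: fc_diff[OF fp per_hol_const \<rho>] fc_const)
    finally show "fc (\<lambda>z. u (z + of_real \<alpha>) - u z) n = fc (\<lambda>z. f z - fc f 0) n" .
  qed
  have "1 / 2 \<le> norm m" unfolding m_def u_def by (rule Top_WB(3)[OF \<rho> r(1) r_le_half b sd Q_def QM v(1) deriv_psi_per_hol psi_phi(6)])
  then have m: "m \<noteq> 0" by auto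
  have eu: "exp (u z) = m * (1 + v z)" if z: "z \<in> strip \<rho>" for z
    using v(3)[OF z] m by (simp add: Top_def u_def[symmetric] m_def[symmetric] field_simps)
  define k where "k = exp (fc f 0)"
  have key: "k * (1 + v (z + of_real \<alpha>)) = (1 + v z) * (1 + deriv \<phi> (z + g z))" if z: "z \<in> strip \<rho>" for z
  proof -
    have "m * (1 + v (z + of_real \<alpha>)) = exp (u z + (f z - fc f 0))"
      unfolding coh[OF z, symmetric] eu[OF strip_shift[OF z], symmetric] by simp
    also have "\<dots> = m * (1 + v z) * (1 + deriv \<phi> (z + g z)) / k"
      by (simp add: exp_add exp_diff k_def eu[OF z] f_def psi_phi(4)[OF strip_widen[OF comp_mem_strip[OF g z]]])
    finally have "m * (k * (1 + v (z + of_real \<alpha>))) = m * ((1 + v z) * (1 + deriv \<phi> (z + g z)))"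
      by (simp add: k_def field_simps)
    then show ?thesis using mult_left_cancel[OF m] by blast
  qed
  have vp: "per_hol \<rho> v" by (rule WB_per_hol[OF v(1)])
  define F where "F = (\<lambda>z. \<phi> (z + g z))"
  have Fp: "per_hol \<rho> F" unfolding F_def by (rule per_hol_comp[OF \<rho> phi_per_hol g]) (use b in simp)
  have DF: "(F has_field_derivative deriv \<phi> (z + g z) * (1 + v z)) (at z)" if z: "z \<in> strip \<rho>" for z
    unfolding F_def using deriv_comp_id_add[OF phi_per_hol g \<rho> _ z] b dg[OF z] by simp
  have dF: "deriv F z = deriv \<phi> (z + g z) * (1 + v z)" if z: "z \<in> strip \<rho>" for z
    using DF[OF z] by (rule DERIV_imp_deriv)
  \<comment> \<open>Means of both sides of \<open>key\<close>: on the left \<open>k\<close>, since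
    \<open>v\<close> has mean zero; on the right 1, since the extra term is the derivative of a
    periodic function. Hence \<open>k = 1\<close>.\<close>
  have "k * (1 + fc (\<lambda>z. v (z + of_real \<alpha>)) 0) = fc (\<lambda>z. k * (1 + v (z + of_real \<alpha>))) 0"
    by (simp add: fc_cmult fc_add[OF per_hol_const per_hol_shift[OF vp] \<rho>] fc_const)
  also have "\<dots> = fc (\<lambda>z. (1 + v z) + deriv F z) 0"
  proof (rule fc_cong)
    fix x :: real
    have x: "of_real x \<in> strip \<rho>" using \<rho> by simp
    show "k * (1 + v (of_real x + of_real \<alpha>)) = 1 + v (of_real x) + deriv F (of_real x)"
      unfolding key[OF x] dF[OF x] by (simp add: algebra_simps)
  qed
  also have "\<dots> = 1"
    by (simp add: fc_add[OF per_hol_add[OF per_hol_const vp] per_hol_deriv[OF Fp] \<rho>] fc_add[OF per_hol_const vp \<rho>]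
        fc_const v(2) fc_deriv_eq[OF Fp \<rho>])
  finally have k: "k = 1" by (simp add: fc_shift_real[OF vp] v(2))
  have "\<exists>l. \<forall>z\<in>strip \<rho>. g (z + of_real \<alpha>) - g z - F z = l"
  proof (rule has_field_derivative_zero_constant[OF convex_strip])
    fix z assume z: "z \<in> strip \<rho>"
    have D: "(g has_field_derivative v w) (at w)" if "w \<in> strip \<rho>" for w
      using holomorphic_derivI[OF per_hol_holo[OF gp] open_strip that, of UNIV] dg[OF that] by simp
    have "((\<lambda>z. g (z + of_real \<alpha>)) has_field_derivative v (z + of_real \<alpha>)) (at z)"
      using D[OF strip_shift[OF z]] by (simp add: DERIV_shift)
    then have "((\<lambda>z. g (z + of_real \<alpha>) - g z - F z) has_field_derivative v (z + of_real \<alpha>) - v z - deriv \<phi> (z + g z) * (1 + v z)) (at z)"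
      by (intro derivative_intros D[OF z] DF[OF z])
    also have "v (z + of_real \<alpha>) - v z - deriv \<phi> (z + g z) * (1 + v z) = 0"
      using key[OF z] k by (simp add: algebra_simps)
    finally show "((\<lambda>z. g (z + of_real \<alpha>) - g z - F z) has_field_derivative 0) (at z within strip \<rho>)"
      by (rule has_field_derivative_at_within)
  qed
  then obtain l where "\<forall>z\<in>strip \<rho>. g (z + of_real \<alpha>) - g z = F z + l" by (metis diff_add_cancel add.commute)
  then have "sol \<alpha> \<rho> r \<phi> g l" using gp g0 vd by (simp add: sol_def F_def)
  then show ?thesis unfolding g_def by blast
qed

lemma sol_exists: "\<exists>g l. sol \<alpha> \<rho> r \<phi> g l"
  using Top_fixed_point[OF \<rho> r(1) r_le_half b sd Q_def QM deriv_psi_per_hol psi_phi(6)] fixed_point_sol by metis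

lemma sol_key:
  assumes s: "sol \<alpha> \<rho> r \<phi> g l" and z: "z \<in> strip \<rho>"
  shows "1 + deriv g (z + of_real \<alpha>) = (1 + deriv g z) * (1 + deriv \<phi> (z + g z))"
proof -
  have g: "WB \<rho> g r" by (rule sol_WB[OF \<rho> s])
  have D: "(g has_field_derivative deriv g w) (at w)" if "w \<in> strip \<rho>" for w
    using holomorphic_derivI[OF per_hol_holo[OF WB_per_hol[OF g]] open_strip that, of UNIV] .
  have eq: "\<And>z. z \<in> strip \<rho> \<Longrightarrow> g (z + of_real \<alpha>) - g z = \<phi> (z + g z) + l"
    using s by (auto simp: sol_def)
  have 1: "((\<lambda>z. g (z + of_real \<alpha>) - g z) has_field_derivative deriv g (z + of_real \<alpha>) - deriv g z) (at z)"
    using D[OF strip_shift[OF z]] by (intro derivative_intros D[OF z]) (simp add: DERIV_shift)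
  have "((\<lambda>z. \<phi> (z + g z) + l) has_field_derivative deriv \<phi> (z + g z) * (1 + deriv g z)) (at z)"
    using deriv_comp_id_add[OF phi_per_hol g \<rho> _ z] b by (auto intro!: derivative_eq_intros)
  then have 2: "((\<lambda>z. g (z + of_real \<alpha>) - g z) has_field_derivative deriv \<phi> (z + g z) * (1 + deriv g z)) (at z)"
    by (rule has_field_derivative_transform_within_open[OF _ open_strip z]) (simp add: eq)
  from DERIV_unique[OF 1 2] show ?thesis by (simp add: algebra_simps)
qed

text \<open>Taking logarithms in \<open>sol_key\<close> runs \<open>fixed_point_sol\<close>
  backwards. Every solution in the ball is thus a fixed point of the contraction, through which
  uniqueness and Lipschitz dependence reach conjugacies.\<close>

lemma sol_fixed_point:
  assumes s: "sol \<alpha> \<rho> r \<phi> g l" and z: "z \<in> strip \<rho>"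
  shows "Top \<alpha> (deriv (psi \<phi>)) (deriv g) z = deriv g z"
proof -
  define v where "v = deriv g"
  have g: "WB \<rho> g r" by (rule sol_WB[OF \<rho> s])
  have gp: "per_hol \<rho> g" by (rule WB_per_hol[OF g])
  have v: "WB \<rho> v r" and g0: "fc g 0 = 0"
    using s by (auto simp: sol_def v_def)
  have vp: "per_hol \<rho> v" by (rule WB_per_hol[OF v])
  have v0: "fc v 0 = 0" by (simp add: v_def fc_deriv_eq[OF gp \<rho>])
  have Dv: "Dinv v z = g z" if "z \<in> strip \<rho>" for z
    unfolding v_def by (rule Dinv_deriv[OF \<rho> gp g0 v[unfolded v_def] that])
  have key: "1 + v (z + of_real \<alpha>) = (1 + v z) * (1 + deriv \<phi> (z + g z))" if z: "z \<in> strip \<rho>" for z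
    unfolding v_def by (rule sol_key[OF s z])
  define f where "f = (\<lambda>z. psi \<phi> (z + g z))"
  have fp: "per_hol \<rho> f" unfolding f_def by (rule per_hol_comp[OF \<rho> psi_per_hol g]) (use b in simp)
  have df: "deriv f z = deriv (psi \<phi>) (z + g z) * (1 + v z)" if z: "z \<in> strip \<rho>" for z
    unfolding f_def v_def using deriv_comp_id_add[OF psi_per_hol g \<rho> _ z] b by (auto intro: DERIV_imp_deriv)
  define w where "w = (\<lambda>z. Ln (1 + v z))"
  have vs: "norm (v z) \<le> 1 / 4" if "z \<in> strip \<rho>" for z using WB_norm[OF \<rho> v that] r by simp
  have vs': "norm (v z) < 1 / 2" if "z \<in> strip \<rho>" for z using vs[OF that] by simp
  have wp: "per_hol \<rho> w"
  proof (rule per_holI)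
    show "w holomorphic_on strip \<rho>" unfolding w_def
      by (intro holomorphic_intros per_hol_holo[OF vp] half_not_nonpos vs')
    show "w (z + 1) = w z" if "z \<in> strip \<rho>" for z
      using per_hol_per[OF vp that] by (simp add: w_def)
  qed
  have ew: "exp (w z) = 1 + v z" if "z \<in> strip \<rho>" for z
    using half_not_nonpos(2)[OF vs'[OF that]] by (simp add: w_def)
  have nw: "norm (w z) \<le> 1 / 2" if "z \<in> strip \<rho>" for z
    using norm_Ln_le[OF vs'[OF that]] vs[OF that] by (simp add: w_def)
  have coh: "w (z + of_real \<alpha>) - w z = f z" if z: "z \<in> strip \<rho>" for z
  proof -
    \<comment> \<open>Both logarithms have norm at most 1/2 and \<open>f z\<close> at most 1, so the
      two sides differ by at most 2. This excludes a nonzero multiple of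
      \<open>2 * pi * \<i>\<close>.\<close>
    have "w (z + of_real \<alpha>) = w z + f z"
    proof (rule exp_complex_eqI)
      have "norm (f z) \<le> 2 * M / \<delta>" unfolding f_def by (rule psi_phi(5)[OF strip_widen[OF comp_mem_strip[OF g z]]])
      also have "\<dots> \<le> 1" using M2 \<delta> by (simp add: field_simps)
      finally have nf: "norm (f z) \<le> 1" .
      have "norm (w (z + of_real \<alpha>) - (w z + f z)) \<le> norm (w (z + of_real \<alpha>)) + (norm (w z) + norm (f z))"
        by (rule order_trans[OF norm_triangle_ineq4 add_left_mono[OF norm_triangle_ineq]])
      then have "norm (w (z + of_real \<alpha>) - (w z + f z)) \<le> 2"
        using nf nw[OF z] nw[OF strip_shift[OF z]] by linarith
      then have "\<bar>Im (w (z + of_real \<alpha>) - (w z + f z))\<bar> \<le> 2" by (rule order_trans[OF abs_Im_le_cmod])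
      then show "\<bar>Im (w (z + of_real \<alpha>)) - Im (w z + f z)\<bar> < 2 * pi" using pi_gt3 by simp
      show "exp (w (z + of_real \<alpha>)) = exp (w z + f z)"
        using key[OF z] by (simp add: exp_add ew[OF z] ew[OF strip_shift[OF z]] f_def psi_phi(4)[OF strip_widen[OF comp_mem_strip[OF g z]]])
    qed
    then show ?thesis by simp
  qed
  define u where "u = Uop \<alpha> (deriv (psi \<phi>)) v"
  note U = Uop_WB[OF \<rho> r(1) r_le_half b sd Q_def QM v deriv_psi_per_hol psi_phi(6)]
  have up: "per_hol \<rho> u" unfolding u_def by (rule WB_per_hol[OF U(2)])
  have fw: "(ee n (of_real \<alpha>) - 1) * fc w n = fc f n" for n
  proof -
    have "(ee n (of_real \<alpha>) - 1) * fc w n = fc (\<lambda>z. w (z + of_real \<alpha>) - w z) n"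
      by (simp add: fc_diff[OF per_hol_shift[OF wp] wp \<rho>] fc_shift_real[OF wp] algebra_simps)
    also have "\<dots> = fc f n" by (rule fc_cong) (simp add: coh \<rho>)
    finally show ?thesis .
  qed
  have fu: "fc u n = (if n = 0 then 0 else fc w n)" for n
  proof -
    have "fc u n = sdm \<alpha> n * fc (\<lambda>z. deriv (psi \<phi>) (z + Dinv v z) * (1 + v z)) n" unfolding u_def by (rule U(3))
    also have "fc (\<lambda>z. deriv (psi \<phi>) (z + Dinv v z) * (1 + v z)) n = fc (deriv f) n"
      by (rule fc_cong) (simp add: df Dv \<rho>)
    also have "\<dots> = 2 * of_real pi * \<i> * of_int n * ((ee n (of_real \<alpha>) - 1) * fc w n)" by (simp add: fc_deriv_eq[OF fp \<rho>] fw)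
    also have "sdm \<alpha> n * \<dots> = (ee n (of_real \<alpha>) - 1) * (sdm \<alpha> n * (2 * of_real pi * \<i> * of_int n * fc w n))"
      by (simp only: mult_ac)
    finally show ?thesis unfolding sdm_eq .
  qed
  \<comment> \<open>\<open>u\<close> is \<open>w\<close> without its mean, so its exponential is
    \<open>1 + v\<close> divided by \<open>c\<close>. The normalisation in \<open>Top\<close>
    divides by the mean \<open>1 / c\<close> and cancels that factor.\<close>
  define c where "c = exp (fc w 0)"
  have uw: "u z = w z - fc w 0" if z: "z \<in> strip \<rho>" for z
    by (rule per_hol_eqI[OF up per_hol_diff[OF wp per_hol_const] _ z])
      (simp add: fu fc_diff[OF wp per_hol_const \<rho>] fc_const)
  have eu: "exp (u z) = 1 / c * (1 + v z)" if z: "z \<in> strip \<rho>" for z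
    by (simp add: uw[OF z] exp_diff ew[OF z] c_def)
  have "fc (\<lambda>z. exp (u z)) 0 = fc (\<lambda>z. 1 / c * (1 + v z)) 0"
    by (rule fc_cong) (simp add: eu \<rho>)
  also have "\<dots> = 1 / c" by (simp only: fc_cmult fc_add[OF per_hol_const vp \<rho>] fc_const v0) simp
  finally show ?thesis unfolding Top_def v_def[symmetric] u_def[symmetric] using eu[OF z] by (simp add: c_def)
qed

end

text \<open>The constant is \<open>20 * Q\<close> from \<open>Top_fixed_points_near\<close> times
  \<open>2 / \<delta>\<^sup>2\<close> from \<open>psi_diff\<close>; \<open>Dinv\<close> carries the
  bound from the derivatives to the functions.\<close>

lemma sol_near:
  assumes \<phi>: "per_hol (b + 2 * \<delta>) \<phi>" "bnd (b + 2 * \<delta>) \<phi> M"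
    and \<theta>: "per_hol (b + 2 * \<delta>) \<theta>" "bnd (b + 2 * \<delta>) \<theta> M"
    and d: "bnd (b + 2 * \<delta>) (\<lambda>z. \<phi> z - \<theta> z) \<Delta>"
    and g: "sol \<alpha> \<rho> r \<phi> g l" and h: "sol \<alpha> \<rho> r \<theta> h k"
  shows "WB \<rho> (\<lambda>z. g z - h z) (40 * Q / \<delta>\<^sup>2 * \<Delta>)"
proof -
  have "WB \<rho> (\<lambda>z. deriv g z - deriv h z) (20 * Q * (2 * \<Delta> / \<delta>\<^sup>2))"
  proof (rule Top_fixed_points_near[OF \<rho> r(1) r_le_half b sd Q_def QM])
    show "WB \<rho> (deriv g) r" "WB \<rho> (deriv h) r" using g h by (auto simp: sol_def)
    show "Top \<alpha> (deriv (psi \<phi>)) (deriv g) z = deriv g z" "Top \<alpha> (deriv (psi \<theta>)) (deriv h) z = deriv h z" if "z \<in> strip \<rho>" for z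
      using sol_fixed_point[OF \<phi> g that] sol_fixed_point[OF \<theta> h that] by auto
    show "per_hol b (deriv (psi \<phi>))" "per_hol b (deriv (psi \<theta>))"
      by (rule deriv_psi_per_hol[OF \<phi>], rule deriv_psi_per_hol[OF \<theta>])
    fix z assume z: "z \<in> strip b"
    show "norm (deriv (psi \<phi>) z) \<le> 2 * M / \<delta>\<^sup>2" "norm (deriv (psi \<theta>) z) \<le> 2 * M / \<delta>\<^sup>2"
      by (rule psi(6)[OF \<phi>(1) \<delta> \<phi>(2) M2 z], rule psi(6)[OF \<theta>(1) \<delta> \<theta>(2) M2 z])
    show "norm (deriv (psi \<phi>) z - deriv (psi \<theta>) z) \<le> 2 * \<Delta> / \<delta>\<^sup>2"
      by (rule psi_diff[OF \<phi> \<theta> \<delta> M2 d z])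
  qed
  then have "WB \<rho> (\<lambda>z. Dinv (deriv g) z - Dinv (deriv h) z) (20 * Q * (2 * \<Delta> / \<delta>\<^sup>2))"
    using g h by (intro Dinv_diff \<rho>) (auto simp: sol_def)
  then have "WB \<rho> (\<lambda>z. g z - h z) (20 * Q * (2 * \<Delta> / \<delta>\<^sup>2))"
    by (rule WB_cong[OF \<rho>]) (use g h in \<open>auto simp: sol_def Dinv_deriv[OF \<rho>]\<close>)
  then show ?thesis by (simp add: algebra_simps)
qed

lemma sol_unique:
  assumes \<phi>: "per_hol (b + 2 * \<delta>) \<phi>" "bnd (b + 2 * \<delta>) \<phi> M"
    and g: "sol \<alpha> \<rho> r \<phi> g l" and h: "sol \<alpha> \<rho> r \<phi> h k"
  shows "l = k" "\<And>z. z \<in> strip \<rho> \<Longrightarrow> g z = h z"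
proof -
  have "WB \<rho> (\<lambda>z. g z - h z) (40 * Q / \<delta>\<^sup>2 * 0)"
    by (rule sol_near[OF \<phi> \<phi> _ g h]) (simp add: bnd_def)
  then show e: "g z = h z" if "z \<in> strip \<rho>" for z using WB_norm[OF \<rho> _ that] by fastforce
  have 0: "0 \<in> strip \<rho>" using \<rho> by (simp add: strip_iff)
  have "g (0 + of_real \<alpha>) - g 0 = \<phi> (0 + g 0) + l" "h (0 + of_real \<alpha>) - h 0 = \<phi> (0 + h 0) + k"
    using g h 0 unfolding sol_def by blast+
  then show "l = k" using e[OF 0] e[OF strip_shift[OF 0]] by simp
qed

end

section \<open>Rotation numbers of bounded type\<close>

lemma cf_convergent_bounds:
  assumes "\<And>i. 1 \<le> a i" "\<And>i. a i \<le> K"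
  shows "0 \<le> cf_convergent n a \<and> cf_convergent n a \<le> 1 \<and> (n \<noteq> 0 \<longrightarrow> 1 / (real K + 1) \<le> cf_convergent n a)"
  using assms
proof (induction n arbitrary: a)
  case (Suc n)
  have IH: "0 \<le> cf_convergent n (\<lambda>i. a (Suc i))" "cf_convergent n (\<lambda>i. a (Suc i)) \<le> 1"
    using Suc.IH[of "\<lambda>i. a (Suc i)"] Suc.prems by auto
  have a: "1 \<le> real (a 0)" "real (a 0) \<le> real K" using Suc.prems by (simp_all add: of_nat_le_iff[where 'a = real, of 1, simplified])
  show ?case using IH a by (auto simp: field_simps)
qed simp

lemma cf_expansion_bounds:
  assumes a: "is_cf_expansion a \<alpha>" "\<And>i. a i \<le> K"
  shows "1 / (real K + 1) \<le> \<alpha>" "\<alpha> \<le> 1"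
proof -
  have a1: "1 \<le> a i" for i using a(1) by (simp add: is_cf_expansion_def Suc_leI)
  note B = cf_convergent_bounds[of a, OF a1 a(2)]
  have "(\<lambda>n. cf_convergent (Suc n) a) \<longlonglongrightarrow> \<alpha>"
    by (rule LIMSEQ_Suc) (use a(1) in \<open>simp add: is_cf_expansion_def\<close>)
  then show "1 / (real K + 1) \<le> \<alpha>" "\<alpha> \<le> 1"
    using B by (auto intro!: LIMSEQ_le_const[of _ \<alpha>] LIMSEQ_le_const2[of _ \<alpha>] simp del: cf_convergent.simps)
qed

text \<open>One step of the Gauss map on the level of limits: the recursion of the convergents is
  solved for the tail, and the positive lower bound on \<open>\<alpha>\<close> lets the reciprocal
  pass to the limit.\<close>

lemma cf_expansion_shift:
  assumes a: "is_cf_expansion a \<alpha>" "\<And>i. a i \<le> K"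
  obtains \<alpha>' where "is_cf_expansion (\<lambda>i. a (Suc i)) \<alpha>'" "1 / \<alpha> = real (a 0) + \<alpha>'"
proof
  have \<alpha>: "0 < \<alpha>" using cf_expansion_bounds(1)[OF a] by (smt (verit) divide_pos_pos of_nat_0_le_iff)
  have a1: "1 \<le> a i" for i using a(1) by (simp add: is_cf_expansion_def Suc_leI)
  have L: "(\<lambda>n. cf_convergent (Suc n) a) \<longlonglongrightarrow> \<alpha>"
    by (rule LIMSEQ_Suc) (use a(1) in \<open>simp add: is_cf_expansion_def\<close>)
  have "(\<lambda>n. 1 / cf_convergent (Suc n) a - real (a 0)) \<longlonglongrightarrow> 1 / \<alpha> - real (a 0)"
    by (intro tendsto_intros L) (use \<alpha> in simp)
  then have "(\<lambda>n. cf_convergent n (\<lambda>i. a (Suc i))) \<longlonglongrightarrow> 1 / \<alpha> - real (a 0)" by simp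
  then show "is_cf_expansion (\<lambda>i. a (Suc i)) (1 / \<alpha> - real (a 0))"
    using a(1) by (simp add: is_cf_expansion_def)
qed simp

text \<open>Two steps of the Gauss map replace \<open>(n, m)\<close> by a smaller pair without decreasing \<open>n \<bar>n \<alpha> - m\<bar>\<close>.\<close>

lemma cf_diophantine:
  assumes "is_cf_expansion a \<alpha>" "\<And>i. a i \<le> K" "1 \<le> (n :: nat)"
  shows "1 / (real K + 2)\<^sup>2 \<le> real n * \<bar>real n * \<alpha> - of_int m\<bar>"
  using assms
proof (induction n arbitrary: a \<alpha> m rule: less_induct)
  case (less n)
  define c where "c = 1 / (real K + 2)\<^sup>2"
  have c: "c \<le> 1 / (real K + 2)" "c \<le> (1 / (real K + 1)) * (1 / (real K + 1))"
  proof -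
    have e: "c = 1 / (real K + 2) * (1 / (real K + 2))" by (simp add: c_def power2_eq_square)
    have l: "1 / (real K + 2) \<le> 1 / (real K + 1)" "1 / (real K + 2) \<le> 1" by (simp_all add: frac_le)
    show "c \<le> 1 / (real K + 2)" unfolding e using mult_right_mono[OF l(2), of "1 / (real K + 2)"] by simp
    show "c \<le> (1 / (real K + 1)) * (1 / (real K + 1))" unfolding e by (intro mult_mono l) auto
  qed
  have c': "c \<le> 1 / (real K + 1)" using c(1) by (rule order_trans) (simp add: field_simps)
  have c0: "0 \<le> c" by (simp add: c_def)
  have n1: "1 \<le> real n" using less.prems(3) by simp
  obtain \<beta> where \<beta>: "is_cf_expansion (\<lambda>i. a (Suc i)) \<beta>" "1 / \<alpha> = real (a 0) + \<beta>"
    using cf_expansion_shift[OF less.prems(1,2)] by blast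
  obtain \<gamma> where \<gamma>: "is_cf_expansion (\<lambda>i. a (Suc (Suc i))) \<gamma>" "1 / \<beta> = real (a (Suc 0)) + \<gamma>"
    using cf_expansion_shift[OF \<beta>(1) less.prems(2)] by blast
  note ba = cf_expansion_bounds[OF less.prems(1,2)] and bb = cf_expansion_bounds[OF \<beta>(1) less.prems(2)]
  have pos: "0 < 1 / (real K + 1)" by simp
  have \<alpha>0: "0 < \<alpha>" and \<beta>0: "0 < \<beta>" using ba bb pos by linarith+
  have a1: "1 \<le> real (a 0)" using less.prems(1) by (simp add: is_cf_expansion_def Suc_leI)
  have "1 + 1 / (real K + 1) \<le> 1 / \<alpha>" using \<beta>(2) a1 bb by simp
  then have "\<alpha> * (1 + 1 / (real K + 1)) \<le> 1" using \<alpha>0 by (simp add: field_simps)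
  \<comment> \<open>A first digit of at least 1 followed by a tail of at least
    \<open>1 / (K + 1)\<close> keeps \<open>\<alpha>\<close> away from 1. This settles the pairs
    with \<open>m \<ge> n\<close>.\<close>
  then have \<alpha>1: "\<alpha> \<le> 1 - 1 / (real K + 2)" by (simp add: field_simps)
  consider "m \<le> 0" | "int n \<le> m" | "0 < m" "m < int n" by linarith
  then have "c \<le> real n * \<bar>real n * \<alpha> - of_int m\<bar>"
  proof cases
    case 1
    have "1 * \<alpha> \<le> real n * \<alpha>" using n1 \<alpha>0 by (intro mult_right_mono) auto
    then have "c \<le> real n * \<alpha> - of_int m" using 1 ba c' by (simp add: of_int_le_0_iff) 
    then have "1 * c \<le> real n * \<bar>real n * \<alpha> - of_int m\<bar>" using n1 c0 by (intro mult_mono) auto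
    then show ?thesis by simp
  next
    case 2
    then have "real n \<le> of_int m" by linarith
    then have "real n * (1 - \<alpha>) \<le> \<bar>real n * \<alpha> - of_int m\<bar>" by (simp add: algebra_simps)
    moreover have "1 * (1 - \<alpha>) \<le> real n * (1 - \<alpha>)" using n1 ba by (intro mult_right_mono) auto
    moreover have "c \<le> 1 * (1 - \<alpha>)" using \<alpha>1 c(1) by simp
    ultimately have "c \<le> \<bar>real n * \<alpha> - of_int m\<bar>" by (meson order_trans)
    then have "1 * c \<le> real n * \<bar>real n * \<alpha> - of_int m\<bar>" using n1 c0 by (intro mult_mono) auto
    then show ?thesis by simp
  next
    case 3
    define m' where "m' = nat m"
    have m': "m = int m'" "m' < n" "1 \<le> m'" using 3 by (auto simp: m'_def)
    \<comment> \<open>One Gauss step leads from \<open>(n, m)\<close> to \<open>(m, p)\<close>, with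
      \<open>n * \<alpha> - m = - \<alpha> * x\<close>.\<close>
    define p where "p = int n - m * int (a 0)"
    define x where "x = real m' * \<beta> - of_int p"
    have nx: "real n = real m' / \<alpha> - x" using \<beta>(2) by (simp add: x_def p_def m'(1) algebra_simps divide_inverse)
    have eq: "real n * \<alpha> - of_int m = - \<alpha> * x" using nx \<alpha>0 by (simp add: m'(1) field_simps)
    show ?thesis
    proof (cases "x \<le> 0")
      \<comment> \<open>Here \<open>n = m / \<alpha> + \<bar>x\<bar>\<close>, so the product equals
        \<open>m * \<bar>x\<bar> + \<alpha> * x * x\<close>. It is at least the product
        \<open>m * \<bar>x\<bar>\<close> of the new pair, and one Gauss step is enough.\<close>
      case True
      have "c \<le> real m' * \<bar>x\<bar>"
        unfolding x_def c_def by (rule less.IH[OF m'(2) \<beta>(1) less.prems(2) m'(3)])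
      also have "\<dots> \<le> (real m' / \<alpha> + \<bar>x\<bar>) * (\<alpha> * \<bar>x\<bar>)" using \<alpha>0 by (simp add: field_simps)
      also have "\<dots> = real n * \<bar>real n * \<alpha> - of_int m\<bar>" unfolding eq using True \<alpha>0 by (simp add: nx abs_mult)
      finally show ?thesis .
    next
      case False
      \<comment> \<open>For this sign the product is \<open>x * (m - \<alpha> * x)\<close>, which is
        less than the product \<open>m * x\<close> of the pair \<open>(m, p)\<close>, so the bound
        for that pair does not give the claim. For \<open>p \<le> 0\<close> the lower bounds on
        \<open>\<alpha>\<close> and \<open>\<beta>\<close> settle it directly; otherwise a second
        Gauss step is made.\<close>
      then have x: "0 < x" by simp
      show ?thesis
      proof (cases "p \<le> 0")
        case True
        have "1 * \<beta> \<le> real m' * \<beta>" using m' \<beta>0 by (intro mult_right_mono) auto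
        then have "\<beta> \<le> x" using True by (simp add: x_def of_int_le_0_iff)
        have "(1 / (real K + 1)) * (1 / (real K + 1)) \<le> \<alpha> * \<beta>" using ba bb \<alpha>0 by (intro mult_mono) auto
        with c(2) have "c \<le> \<alpha> * \<beta>" by (rule order_trans)
        also have "\<dots> \<le> \<alpha> * x" using \<alpha>0 \<open>\<beta> \<le> x\<close> by (intro mult_left_mono) auto
        finally have "1 * c \<le> real n * (\<alpha> * x)" using n1 x \<alpha>0 by (intro mult_mono) (auto simp: c_def)
        then show ?thesis unfolding eq using x \<alpha>0 by (simp add: abs_mult)
      next
        case False
        define p' where "p' = nat p"
        have "real m' * \<beta> \<le> real m' * 1" using bb by (intro mult_left_mono) auto
        then have pm: "real_of_int p < real m' * 1" using x unfolding x_def by linarith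
        then have p': "p = int p'" "p' < n" "1 \<le> p'" using False m'(2) by (auto simp: p'_def)
        define q where "q = m - p * int (a (Suc 0))"
        define y where "y = real p' * \<gamma> - of_int q"
        have my: "real m' = real p' / \<beta> - y" using \<gamma>(2) by (simp add: y_def q_def m'(1) p'(1) algebra_simps divide_inverse)
        have xy: "x = - \<beta> * y" using my \<beta>0 by (simp add: x_def p'(1) field_simps)
        have y: "y < 0" using x xy \<beta>0 by (simp add: mult_less_0_iff zero_less_mult_iff)
        have "c \<le> real p' * \<bar>y\<bar>"
          unfolding y_def c_def by (rule less.IH[OF p'(2) \<gamma>(1) less.prems(2) p'(3)])
        \<comment> \<open>In terms of the second pair the original product is
          \<open>p' * \<bar>y\<bar>\<close> plus this extra term, nonnegative because
          \<open>\<alpha> * \<beta> \<le> 1\<close>; the second step recovers what the first one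
          lost.\<close>
        also have "\<dots> \<le> real p' * \<bar>y\<bar> + \<beta> * y\<^sup>2 * (1 - \<alpha> * \<beta>)"
          using \<beta>0 ba bb mult_le_one[of \<alpha> \<beta>] by simp
        also have "\<dots> = x * (real m' - \<alpha> * x)" unfolding xy my using y \<beta>0 by (simp add: field_simps power2_eq_square)
        also have "\<dots> = real n * \<bar>real n * \<alpha> - of_int m\<bar>" unfolding eq using x \<alpha>0 by (simp add: nx abs_mult field_simps)
        finally show ?thesis .
      qed
    qed
  qed
  then show ?case by (simp add: c_def)
qed

lemma bounded_type_diophantine:
  assumes "\<alpha> \<in> bounded_type K" "1 \<le> (n :: nat)"
  shows "1 \<le> (real K + 2)\<^sup>2 * real n * \<bar>real n * \<alpha> - of_int m\<bar>"
proof -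
  obtain a where "is_cf_expansion a \<alpha>" "\<And>i. a i \<le> K" using assms by (auto simp: bounded_type_def)
  from cf_diophantine[OF this assms(2), of m] show ?thesis by (simp add: field_simps)
qed

text \<open>Chord against arc. For a chord shorter than 1/2 the principal logarithm of the endpoint
  is exactly the angle \<open>2 * pi * y\<close>, since
  \<open>\<bar>2 * pi * y\<bar> \<le> pi\<close> excludes other branches, and
  \<open>norm_Ln_le\<close> bounds it by twice the chord. A longer chord exceeds
  \<open>\<bar>y\<bar>\<close> by itself.\<close>

lemma norm_ee_minus_1:
  assumes y: "\<bar>y\<bar> \<le> 1 / 2" shows "\<bar>y\<bar> \<le> norm (ee 1 (of_real y) - 1)"
proof (cases "norm (ee 1 (of_real y) - 1) < 1 / 2")
  case True
  define w where "w = ee 1 (complex_of_real y) - 1"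
  have n: "norm (Ln (1 + w)) \<le> 2 * norm w" by (rule norm_Ln_le) (use True in \<open>simp add: w_def\<close>)
  have "Ln (1 + w) = 2 * of_real pi * \<i> * of_int 1 * of_real y"
  proof (rule exp_complex_eqI)
    show "exp (Ln (1 + w)) = exp (2 * of_real pi * \<i> * of_int 1 * of_real y)" by (simp add: w_def) (simp add: ee_def)
    have "\<bar>Im (Ln (1 + w))\<bar> < 1" using abs_Im_le_cmod[of "Ln (1 + w)"] n True by (simp add: w_def)
    moreover have "pi * \<bar>y\<bar> \<le> pi * (1 / 2)" by (intro mult_left_mono y) simp
    then have "\<bar>2 * pi * y\<bar> \<le> pi" by (simp add: abs_mult)
    ultimately have "\<bar>Im (Ln (1 + w)) - 2 * pi * y\<bar> < 2 * pi" using pi_gt3 by linarith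
    then show "\<bar>Im (Ln (1 + w)) - Im (2 * of_real pi * \<i> * of_int 1 * of_real y)\<bar> < 2 * pi" by simp
  qed
  then have "2 * pi * \<bar>y\<bar> \<le> 2 * norm w" using n by (simp add: norm_mult)
  moreover have "1 * \<bar>y\<bar> \<le> pi * \<bar>y\<bar>" using pi_gt3 by (intro mult_right_mono) auto
  ultimately show ?thesis by (simp add: w_def)
qed (use y in simp)

text \<open>\<open>ee n\<close> at \<open>\<alpha>\<close> depends only on the signed distance
  \<open>y\<close> of \<open>n * \<alpha>\<close> from the nearest integer. The Diophantine bound is
  for positive \<open>n\<close>, so the sign of \<open>n\<close> is moved into
  \<open>m\<close>.\<close>

lemma bounded_type_small_div:
  assumes "\<alpha> \<in> bounded_type K"
  shows "small_div ((real K + 2)\<^sup>2) \<alpha>"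
  unfolding small_div_def
proof (intro conjI allI impI)
  show "1 \<le> (real K + 2)\<^sup>2" by (rule one_le_power) simp
  fix n :: int assume n: "n \<noteq> 0"
  define m where "m = round (of_int n * \<alpha>)"
  define y where "y = of_int n * \<alpha> - of_int m"
  have y: "\<bar>y\<bar> \<le> 1 / 2" unfolding y_def m_def using of_int_round_abs_le[of "of_int n * \<alpha>"] by (simp add: abs_minus_commute)
  have "ee n (of_real \<alpha>) = ee 1 (of_int n * of_real \<alpha>)" by (simp add: ee_def mult_ac)
  also have "\<dots> = ee 1 (of_real y)" unfolding ee_eq_iff by (simp add: y_def)
  finally have e: "\<bar>y\<bar> \<le> norm (ee n (of_real \<alpha>) - 1)" using norm_ee_minus_1[OF y] by simp
  have "1 \<le> (real K + 2)\<^sup>2 * real (nat \<bar>n\<bar>) * \<bar>real (nat \<bar>n\<bar>) * \<alpha> - of_int (sgn n * m)\<bar>"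
    by (rule bounded_type_diophantine[OF assms]) (use n in simp)
  also have "\<bar>real (nat \<bar>n\<bar>) * \<alpha> - of_int (sgn n * m)\<bar> = \<bar>y\<bar>"
    using n by (cases "n > 0") (auto simp: y_def)
  also have "(real K + 2)\<^sup>2 * real (nat \<bar>n\<bar>) * \<bar>y\<bar> \<le> (real K + 2)\<^sup>2 * \<bar>of_int n\<bar> * norm (ee n (of_real \<alpha>) - 1)"
    using e by (simp add: mult_left_mono)
  finally show "1 \<le> (real K + 2)\<^sup>2 * \<bar>of_int n\<bar> * norm (ee n (of_real \<alpha>) - 1)" .
qed

section \<open>Differentiability of the counterterm\<close>

context
  fixes \<rho> r b C \<alpha> M Q \<delta> :: real
  assumes \<rho>: "0 < \<rho>" and r: "0 < r" "r \<le> 1 / 4" and b: "\<rho> + r < b" and sd: "small_div C \<alpha>"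
    and Q_def: "Q = C * cs (b - \<rho> - r)" and \<delta>: "0 < \<delta>" and QM: "30 * Q * (2 * M / \<delta>\<^sup>2) \<le> r" and M2: "M < \<delta> / 2"
begin

lemmas smallness_assms = \<rho> r b sd Q_def \<delta> QM M2

text \<open>The inverse derivative of id + \<open>g\<close> at the rotated point. Dividing the
  linearised conjugacy equation by that derivative makes its unknown part a coboundary, so averaging
  isolates the change of the counterterm.\<close>

definition "weight g = (\<lambda>z. 1 / (1 + deriv g (z + of_real \<alpha>)))"

text \<open>\<open>lin g \<psi>\<close> is the derivative of the counterterm at the conjugacy \<open>id + g\<close> in direction \<open>\<psi>\<close>.\<close>

definition "lin g \<psi> = - fc (\<lambda>z. weight g z * \<psi> (z + g z)) 0 / fc (weight g) 0"

text \<open>A derivative of norm at most 1/4 keeps the denominator above 3/4; the weight then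
  differs from 1 by at most (1/4)/(3/4) = 1/3, which leaves a mean of at least 2/3.\<close>

lemma weight:
  assumes g: "WB \<rho> (deriv g) r"
  shows "per_hol \<rho> (weight g)" "\<And>z. z \<in> strip \<rho> \<Longrightarrow> norm (weight g z) \<le> 4 / 3" "2 / 3 \<le> norm (fc (weight g) 0)"
proof -
  have n: "norm (deriv g (z + of_real \<alpha>)) \<le> 1 / 4" if "z \<in> strip \<rho>" for z
    using WB_norm[OF \<rho> g, of "z + of_real \<alpha>"] that r by (simp add: strip_add_real)
  have l: "3 / 4 \<le> norm (1 + deriv g (z + of_real \<alpha>))" if "z \<in> strip \<rho>" for z
    using norm_triangle_ineq2[of 1 "- deriv g (z + of_real \<alpha>)"] n[OF that] by simp
  have sh: "per_hol \<rho> (\<lambda>z. 1 + deriv g (z + of_real \<alpha>))"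
    by (intro per_hol_add per_hol_const per_hol_shift[OF smallness_assms WB_per_hol[OF g]])
  show p: "per_hol \<rho> (weight g)"
  proof (rule per_holI)
    show "weight g holomorphic_on strip \<rho>" unfolding weight_def
      by (intro holomorphic_intros per_hol_holo[OF sh, THEN holomorphic_on_divide[OF holomorphic_on_const]]) (use l in force)
    show "weight g (z + 1) = weight g z" if "z \<in> strip \<rho>" for z
      using per_hol_per[OF sh that] by (simp add: weight_def)
  qed
  show "norm (weight g z) \<le> 4 / 3" if z: "z \<in> strip \<rho>" for z
  proof -
    have "1 / norm (1 + deriv g (z + of_real \<alpha>)) \<le> 1 / (3 / 4)" using l[OF z] by (intro frac_le) auto
    then show ?thesis by (simp add: weight_def norm_divide)
  qed
  have "norm (weight g z - 1) \<le> 1 / 3" if z: "z \<in> strip \<rho>" for z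
  proof -
    have nz: "1 + deriv g (z + of_real \<alpha>) \<noteq> 0" using l[OF z] by auto
    have "weight g z - 1 = - deriv g (z + of_real \<alpha>) / (1 + deriv g (z + of_real \<alpha>))"
      using nz by (simp add: weight_def field_simps)
    also have "norm \<dots> \<le> (1 / 4) / (3 / 4)"
      unfolding norm_divide norm_minus_cancel using l[OF z] n[OF z] by (intro frac_le) auto
    finally show ?thesis by simp
  qed
  then have "norm (fc (\<lambda>z. weight g z - 1) 0) \<le> 1 / 3"
    by (intro fc_norm_le[OF per_hol_diff[OF p per_hol_const] \<rho>]) (use \<rho> in auto)
  then have "norm (fc (weight g) 0 - 1) \<le> 1 / 3"
    by (simp add: fc_diff[OF p per_hol_const \<rho>] fc_const)
  then show "2 / 3 \<le> norm (fc (weight g) 0)"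
    using norm_triangle_ineq2[of 1 "fc (weight g) 0"] by (simp add: norm_minus_commute)
qed

lemma lin_linear:
  assumes g: "WB \<rho> (deriv g) r" "WB \<rho> g r" and \<psi>: "per_hol b \<psi>" "per_hol b \<theta>"
  shows "lin g (\<lambda>z. \<psi> z + \<theta> z) = lin g \<psi> + lin g \<theta>" "lin g (\<lambda>z. c * \<psi> z) = c * lin g \<psi>"
proof -
  have p: "per_hol \<rho> (\<lambda>z. weight g z * \<phi> (z + g z))" if "per_hol b \<phi>" for \<phi>
    by (intro per_hol_mult weight(1)[OF g(1)] per_hol_comp[OF \<rho> that g(2)]) (use b in simp)
  show "lin g (\<lambda>z. \<psi> z + \<theta> z) = lin g \<psi> + lin g \<theta>"
    unfolding lin_def distrib_left fc_add[OF p[OF \<psi>(1)] p[OF \<psi>(2)] \<rho>] by (simp add: diff_divide_distrib)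
  show "lin g (\<lambda>z. c * \<psi> z) = c * lin g \<psi>"
    unfolding lin_def mult.left_commute[of _ c] fc_cmult by simp
qed

lemma lin_bound:
  assumes g: "WB \<rho> (deriv g) r" "WB \<rho> g r" and \<psi>: "per_hol b \<psi>" "bnd b \<psi> B"
  shows "norm (lin g \<psi>) \<le> 2 * B"
proof -
  have B: "0 \<le> B" using order_trans[OF norm_ge_zero bndD[OF \<psi>(2), of 0]] \<rho> r b by (simp add: strip_iff)
  have p: "per_hol \<rho> (\<lambda>z. weight g z * \<psi> (z + g z))"
    by (intro per_hol_mult weight(1)[OF g(1)] per_hol_comp[OF \<rho> \<psi>(1) g(2)]) (use b in simp)
  have "norm (fc (\<lambda>z. weight g z * \<psi> (z + g z)) 0) \<le> 4 / 3 * B"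
  proof (rule fc_norm_le[OF p \<rho>])
    fix x :: real
    have x: "of_real x \<in> strip \<rho>" using \<rho> by simp
    have "of_real x + g (of_real x) \<in> strip b" using strip_add[OF x WB_norm[OF \<rho> g(2) x]] b strip_mono[of _ "\<rho> + r" b] by simp
    then show "norm (weight g (of_real x) * \<psi> (of_real x + g (of_real x))) \<le> 4 / 3 * B"
      unfolding norm_mult by (intro mult_mono weight(2)[OF g(1) x] bndD[OF \<psi>(2)]) auto
  qed
  then have "norm (lin g \<psi>) \<le> (4 / 3 * B) / (2 / 3)"
    unfolding lin_def norm_divide norm_minus_cancel using weight(3)[OF g(1)] by (intro frac_le) (use B in auto)
  then show ?thesis by simp
qed

lemma taylor_bound:
  assumes \<theta>: "per_hol (b + 2 * \<delta>) \<theta>" "bnd (b + 2 * \<delta>) \<theta> M" and z: "p \<in> strip b" "q \<in> strip b"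
  shows "norm (\<theta> q - \<theta> p - deriv \<theta> p * (q - p)) \<le> M / \<delta>\<^sup>2 * (norm (q - p))\<^sup>2"
proof -
  have e: "b + 2 * \<delta> = (b + \<delta>) + \<delta>" by simp
  have d1: "norm (deriv \<theta> z) \<le> M / \<delta>" if "z \<in> strip (b + \<delta>)" for z
    by (rule deriv_bound[OF _ \<delta> _ that]) (use per_hol_holo[OF \<theta>(1)] \<theta>(2) in \<open>simp_all add: e bnd_def\<close>)
  have pd: "per_hol (b + \<delta>) (deriv \<theta>)" by (rule per_hol_mono[OF per_hol_deriv[OF \<theta>(1)]]) (use \<delta> in simp)
  have d2: "norm (deriv (deriv \<theta>) z) \<le> M / \<delta>\<^sup>2" if "z \<in> strip b" for z
    using deriv_bound[OF per_hol_holo[OF pd] \<delta> d1 that] by (simp add: power2_eq_square)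
  have sub: "strip b \<subseteq> strip (b + 2 * \<delta>)" "strip b \<subseteq> strip (b + \<delta>)" using \<delta> by (auto intro!: strip_subset)
  have D1: "(\<theta> has_field_derivative deriv \<theta> z) (at z)" if "z \<in> strip b" for z
    using holomorphic_derivI[OF per_hol_holo[OF \<theta>(1)] open_strip, of z UNIV] that sub by auto
  have D2: "(deriv \<theta> has_field_derivative deriv (deriv \<theta>) z) (at z)" if "z \<in> strip b" for z
    using holomorphic_derivI[OF per_hol_holo[OF pd] open_strip, of z UNIV] that sub by auto
  have seg: "closed_segment p q \<subseteq> strip b" using z convex_strip by (simp add: closed_segment_subset)
  have M0: "0 \<le> M / \<delta>\<^sup>2" using order_trans[OF norm_ge_zero d2[OF z(1)]] .
  have l: "norm (deriv \<theta> w - deriv \<theta> p) \<le> M / \<delta>\<^sup>2 * norm (q - p)" if w: "w \<in> closed_segment p q" for w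
  proof -
    have "norm (deriv \<theta> w - deriv \<theta> p) \<le> M / \<delta>\<^sup>2 * norm (w - p)"
      by (rule field_differentiable_bound[OF convex_strip, where f' = "deriv (deriv \<theta>)"])
        (use D2 d2 w seg z in \<open>auto intro: has_field_derivative_at_within\<close>)
    also have "\<dots> \<le> M / \<delta>\<^sup>2 * norm (q - p)"
      using segment_bound1[OF w] M0 by (intro mult_left_mono) (auto simp: norm_minus_commute)
    finally show ?thesis .
  qed
  have "norm ((\<theta> q - deriv \<theta> p * q) - (\<theta> p - deriv \<theta> p * p)) \<le> (M / \<delta>\<^sup>2 * norm (q - p)) * norm (q - p)"
  proof (rule field_differentiable_bound[OF convex_closed_segment])
    fix w assume w: "w \<in> closed_segment p q"
    then show "((\<lambda>z. \<theta> z - deriv \<theta> p * z) has_field_derivative deriv \<theta> w - deriv \<theta> p) (at w within closed_segment p q)"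
      using D1[of w] seg DERIV_diff[OF has_field_derivative_at_within DERIV_cmult_Id[of "deriv \<theta> p"]] by blast
    show "norm (deriv \<theta> w - deriv \<theta> p) \<le> M / \<delta>\<^sup>2 * norm (q - p)" by (rule l[OF w])
  qed auto
  then show ?thesis by (simp add: algebra_simps power2_eq_square)
qed

text \<open>By \<open>sol_key\<close> the substitution \<open>Y\<close> removes the variable
  coefficient: the linear part becomes \<open>Y (z + \<alpha>) - Y z\<close>, of mean zero. After
  averaging, \<open>k - l\<close> differs from its linear prediction only by the mean of
  \<open>R\<close> over that of the weight, and \<open>R\<close> is quadratic because
  \<open>sol_near\<close> bounds the difference of the conjugacies by a multiple of
  \<open>\<Delta>\<close>.\<close>

lemma counterterm_deriv:
  assumes \<phi>: "per_hol (b + 2 * \<delta>) \<phi>" "bnd (b + 2 * \<delta>) \<phi> M"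
    and \<theta>: "per_hol (b + 2 * \<delta>) \<theta>" "bnd (b + 2 * \<delta>) \<theta> M"
    and D: "bnd (b + 2 * \<delta>) (\<lambda>z. \<theta> z - \<phi> z) \<Delta>"
    and g: "sol \<alpha> \<rho> r \<phi> g l" and h: "sol \<alpha> \<rho> r \<theta> h k"
  defines "E \<equiv> 40 * Q / \<delta>\<^sup>2"
  shows "norm (k - l - lin g (\<lambda>z. \<theta> z - \<phi> z)) \<le> 2 * (M / \<delta>\<^sup>2 * E\<^sup>2 + E / \<delta>) * \<Delta>\<^sup>2"
proof -
  have gW: "WB \<rho> g r" and hW: "WB \<rho> h r" using sol_WB[OF \<rho>] g h by auto
  have gp: "per_hol \<rho> g" and hp: "per_hol \<rho> h" using gW hW WB_per_hol by auto
  have gd: "WB \<rho> (deriv g) r" using g by (simp add: sol_def)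
  have dW: "WB \<rho> (\<lambda>z. h z - g z) (E * \<Delta>)"
    unfolding E_def by (rule sol_near[OF smallness_assms \<theta> \<phi> D h g])
  have pb: "per_hol b \<phi>" "per_hol b \<theta>" using \<phi>(1) \<theta>(1) \<delta> by (auto intro: per_hol_mono)
  define v where "v = deriv g"
  have key: "1 + v (z + of_real \<alpha>) = (1 + v z) * (1 + deriv \<phi> (z + g z))" if "z \<in> strip \<rho>" for z
    unfolding v_def by (rule sol_key[OF smallness_assms \<phi> g that])
  have nv: "1 + v z \<noteq> 0" if "z \<in> strip \<rho>" for z
    using half_not_nonpos(2)[of "v z"] WB_norm[OF \<rho> gd that] r by (simp add: v_def)
  define Y where "Y = (\<lambda>z. (h z - g z) / (1 + v z))"
  have Yp: "per_hol \<rho> Y"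
  proof (rule per_holI)
    show "Y holomorphic_on strip \<rho>" unfolding Y_def v_def
      by (intro holomorphic_intros per_hol_holo hp gp WB_per_hol[OF gd] nv[unfolded v_def])
    show "Y (z + 1) = Y z" if "z \<in> strip \<rho>" for z
      using per_hol_per[OF gp that] per_hol_per[OF hp that] per_hol_per[OF WB_per_hol[OF gd] that] by (simp add: Y_def v_def)
  qed
  define S where "S = (\<lambda>z. \<theta> (z + g z) - \<phi> (z + g z))"
  define R where "R = (\<lambda>z. (Y (z + of_real \<alpha>) - Y z) - weight g z * (S z + (k - l)))"
  have wp: "per_hol \<rho> (weight g)" by (rule weight(1)[OF gd])
  have Sp: "per_hol \<rho> S" unfolding S_def
    by (intro per_hol_diff per_hol_comp[OF \<rho> pb(1) gW] per_hol_comp[OF \<rho> pb(2) gW]) (use b in auto)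
  have Yp2: "per_hol \<rho> (\<lambda>z. Y (z + of_real \<alpha>))" by (rule per_hol_shift[OF smallness_assms Yp])
  have wSp: "per_hol \<rho> (\<lambda>z. weight g z * (S z + (k - l)))"
    by (rule per_hol_mult[OF wp per_hol_add[OF Sp per_hol_const]])
  have Rp: "per_hol \<rho> R" unfolding R_def by (rule per_hol_diff[OF per_hol_diff[OF Yp2 Yp] wSp])
  have E0: "0 \<le> E * \<Delta>" using WB_nonneg[OF dW] .
  have D0: "0 \<le> \<Delta>" using order_trans[OF norm_ge_zero bndD[OF D, of 0]] \<rho> r b \<delta> by (simp add: strip_iff)
  have Rb: "norm (R z) \<le> 4 / 3 * ((M / \<delta>\<^sup>2 * E\<^sup>2 + E / \<delta>) * \<Delta>\<^sup>2)" if z: "z \<in> strip \<rho>" for z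
  proof -
    define d where "d = h z - g z"
    have za: "z + of_real \<alpha> \<in> strip \<rho>" using z by (simp add: strip_add_real)
    have dn: "norm d \<le> E * \<Delta>" unfolding d_def by (rule WB_norm[OF \<rho> dW z])
    have mem: "z + g z \<in> strip b" "z + h z \<in> strip b"
      using strip_add[OF z WB_norm[OF \<rho> gW z]] strip_add[OF z WB_norm[OF \<rho> hW z]] b strip_mono[of _ "\<rho> + r" b] by simp_all
    have eqg: "g (z + of_real \<alpha>) - g z = \<phi> (z + g z) + l" and eqh: "h (z + of_real \<alpha>) - h z = \<theta> (z + h z) + k"
      using g h z by (auto simp: sol_def)
    have Y1: "(1 + v (z + of_real \<alpha>)) * Y (z + of_real \<alpha>) = h (z + of_real \<alpha>) - g (z + of_real \<alpha>)"
      using nv[OF za] by (simp add: Y_def)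
    have "(1 + v (z + of_real \<alpha>)) * Y z = (1 + deriv \<phi> (z + g z)) * ((1 + v z) * Y z)" by (simp add: key[OF z] mult_ac)
    also have "(1 + v z) * Y z = d" using nv[OF z] by (simp add: Y_def d_def)
    finally have Y2: "(1 + v (z + of_real \<alpha>)) * Y z = (1 + deriv \<phi> (z + g z)) * d" .
    have "(1 + v (z + of_real \<alpha>)) * R z = (1 + v (z + of_real \<alpha>)) * Y (z + of_real \<alpha>) - (1 + v (z + of_real \<alpha>)) * Y z
         - (\<theta> (z + g z) - \<phi> (z + g z) + (k - l))"
      using nv[OF za] by (simp add: R_def S_def weight_def v_def[symmetric] right_diff_distrib)
    \<comment> \<open>The difference of the two conjugacy equations leaves a second-order Taylor
      remainder of \<open>\<theta>\<close> and the change of derivative times \<open>d\<close>; both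
      are quadratic in \<open>\<Delta>\<close>.\<close>
    also have "\<dots> = (\<theta> (z + h z) - \<theta> (z + g z) - deriv \<theta> (z + g z) * ((z + h z) - (z + g z))) + (deriv \<theta> (z + g z) - deriv \<phi> (z + g z)) * d"
      unfolding Y1 Y2 using eqg eqh by (simp add: d_def algebra_simps)
    finally have R: "R z = weight g z * ((\<theta> (z + h z) - \<theta> (z + g z) - deriv \<theta> (z + g z) * ((z + h z) - (z + g z))) + (deriv \<theta> (z + g z) - deriv \<phi> (z + g z)) * d)"
      using nv[OF za] by (simp add: weight_def v_def[symmetric] field_simps)
    have M0: "0 \<le> M / \<delta>\<^sup>2"
      using order_trans[OF norm_ge_zero bndD[OF \<phi>(2), of 0]] \<rho> r b \<delta> by (simp add: strip_iff)
    have "norm (\<theta> (z + h z) - \<theta> (z + g z) - deriv \<theta> (z + g z) * ((z + h z) - (z + g z))) \<le> M / \<delta>\<^sup>2 * (norm ((z + h z) - (z + g z)))\<^sup>2"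
      by (rule taylor_bound[OF \<theta> mem])
    also have "\<dots> \<le> M / \<delta>\<^sup>2 * (E * \<Delta>)\<^sup>2"
      using dn M0 by (intro mult_left_mono power_mono) (auto simp: d_def)
    finally have 1: "norm (\<theta> (z + h z) - \<theta> (z + g z) - deriv \<theta> (z + g z) * ((z + h z) - (z + g z))) \<le> M / \<delta>\<^sup>2 * (E * \<Delta>)\<^sup>2" .
    have "norm (deriv (\<lambda>z. \<theta> z - \<phi> z) (z + g z)) \<le> \<Delta> / \<delta>"
    proof (rule deriv_bound[OF _ \<delta>])
      have e: "b + 2 * \<delta> = (b + \<delta>) + \<delta>" by simp
      show "(\<lambda>z. \<theta> z - \<phi> z) holomorphic_on strip (b + \<delta> + \<delta>)" using per_hol_holo[OF per_hol_diff[OF \<theta>(1) \<phi>(1)]] by (simp add: e)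
      show "norm (\<theta> w - \<phi> w) \<le> \<Delta>" if "w \<in> strip (b + \<delta> + \<delta>)" for w using bndD[OF D, of w] that by (simp add: e)
      show "z + g z \<in> strip (b + \<delta>)" using mem(1) \<delta> strip_mono[of _ b "b + \<delta>"] by simp
    qed
    moreover have "deriv (\<lambda>z. \<theta> z - \<phi> z) (z + g z) = deriv \<theta> (z + g z) - deriv \<phi> (z + g z)"
    proof (rule deriv_diff)
      show "\<theta> field_differentiable at (z + g z)" "\<phi> field_differentiable at (z + g z)"
        using per_hol_holo[OF pb(1)] per_hol_holo[OF pb(2)] mem(1) open_strip holomorphic_on_imp_differentiable_at by blast+
    qed
    ultimately have "norm ((deriv \<theta> (z + g z) - deriv \<phi> (z + g z)) * d) \<le> \<Delta> / \<delta> * (E * \<Delta>)"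
      unfolding norm_mult using dn D0 \<delta> by (intro mult_mono) auto
    then have "norm ((\<theta> (z + h z) - \<theta> (z + g z) - deriv \<theta> (z + g z) * ((z + h z) - (z + g z))) + (deriv \<theta> (z + g z) - deriv \<phi> (z + g z)) * d)
        \<le> M / \<delta>\<^sup>2 * (E * \<Delta>)\<^sup>2 + \<Delta> / \<delta> * (E * \<Delta>)"
      using 1 norm_triangle_le add_mono by blast
    also have "\<dots> = (M / \<delta>\<^sup>2 * E\<^sup>2 + E / \<delta>) * \<Delta>\<^sup>2" by (simp add: power2_eq_square algebra_simps)
    finally show ?thesis unfolding R norm_mult by (intro mult_mono weight(2)[OF gd z]) auto
  qed
  have "fc R 0 = - (fc (\<lambda>z. weight g z * S z) 0 + (k - l) * fc (weight g) 0)"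
  proof -
    have "fc R 0 = fc (\<lambda>z. Y (z + of_real \<alpha>) - Y z) 0 - fc (\<lambda>z. weight g z * (S z + (k - l))) 0"
      unfolding R_def by (rule fc_diff[OF per_hol_diff[OF Yp2 Yp] wSp \<rho>])
    also have "fc (\<lambda>z. Y (z + of_real \<alpha>) - Y z) 0 = 0"
      by (simp add: fc_diff[OF Yp2 Yp \<rho>] fc_shift_real[OF smallness_assms Yp])
    also have "fc (\<lambda>z. weight g z * (S z + (k - l))) 0 = fc (\<lambda>z. weight g z * S z + (k - l) * weight g z) 0"
      by (simp add: algebra_simps)
    also have "\<dots> = fc (\<lambda>z. weight g z * S z) 0 + (k - l) * fc (weight g) 0"
      by (simp add: fc_add[OF per_hol_mult[OF wp Sp] per_hol_mult[OF per_hol_const wp] \<rho>] fc_cmult)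
    finally show ?thesis by simp
  qed
  moreover have nz: "fc (weight g) 0 \<noteq> 0" using weight(3)[OF gd] by auto
  ultimately have "k - l = (- fc R 0 - fc (\<lambda>z. weight g z * S z) 0) / fc (weight g) 0"
    by (simp add: eq_divide_eq)
  moreover have "lin g (\<lambda>z. \<theta> z - \<phi> z) = - fc (\<lambda>z. weight g z * S z) 0 / fc (weight g) 0"
    by (simp add: lin_def S_def)
  ultimately have "k - l - lin g (\<lambda>z. \<theta> z - \<phi> z) = - fc R 0 / fc (weight g) 0"
    by (simp add: diff_divide_distrib)
  also have "norm \<dots> \<le> (4 / 3 * ((M / \<delta>\<^sup>2 * E\<^sup>2 + E / \<delta>) * \<Delta>\<^sup>2)) / (2 / 3)"
    unfolding norm_divide norm_minus_cancel
  proof (rule frac_le)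
    show "norm (fc R 0) \<le> 4 / 3 * ((M / \<delta>\<^sup>2 * E\<^sup>2 + E / \<delta>) * \<Delta>\<^sup>2)"
      by (rule fc_norm_le[OF Rp \<rho> Rb]) (use \<rho> in simp)
    then show "0 \<le> 4 / 3 * ((M / \<delta>\<^sup>2 * E\<^sup>2 + E / \<delta>) * \<Delta>\<^sup>2)" using norm_ge_zero order_trans by blast
  qed (use weight(3)[OF gd] in auto)
  also have "4 / 3 * X / (2 / 3) = 2 * X" for X :: real by simp
  finally show ?thesis by (simp only: mult.assoc)
qed

end

section \<open>Conjugacies far from the identity\<close>

text \<open>Translation by \<open>c\<close> multiplies mode \<open>n\<close> by at most
  \<open>wt \<bar>Im c\<bar> n\<close>. It costs the width \<open>\<bar>Im c\<bar>\<close> and no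
  constant.\<close>

lemma WB_shift:
  assumes f: "WB \<rho> f B" and \<tau>: "0 < \<tau>" "\<bar>Im c\<bar> + \<tau> \<le> \<rho>"
  shows "WB \<tau> (\<lambda>z. f (z + c)) B"
proof -
  have c: "c \<in> strip \<rho>" using \<tau> by (simp add: strip_iff)
  have fcs: "fc (\<lambda>z. f (z + c)) n = ee n c * fc f n" for n by (rule fc_shift[OF WB_per_hol[OF f] c])
  show "WB \<tau> (\<lambda>z. f (z + c)) B"
  proof (rule WB_I)
    show "per_hol \<tau> (\<lambda>z. f (z + c))" by (rule per_hol_shift_strip[OF WB_per_hol[OF f] \<tau>(2)])
    fix F :: "int set" assume F: "finite F"
    have "(\<Sum>n\<in>F. norm (fc (\<lambda>z. f (z + c)) n) * wt \<tau> n) \<le> (\<Sum>n\<in>F. norm (fc f n) * wt \<rho> n)"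
    proof (rule sum_mono)
      fix n
      have "norm (ee n c) * wt \<tau> n \<le> wt \<bar>Im c\<bar> n * wt \<tau> n" by (intro mult_right_mono norm_ee_le) auto
      also have "\<dots> = wt (\<bar>Im c\<bar> + \<tau>) n" by (rule wt_add[symmetric])
      also have "\<dots> \<le> wt \<rho> n" by (rule wt_mono[OF \<tau>(2)])
      finally have "norm (fc f n) * (norm (ee n c) * wt \<tau> n) \<le> norm (fc f n) * wt \<rho> n" by (rule mult_left_mono) simp
      then show "norm (fc (\<lambda>z. f (z + c)) n) * wt \<tau> n \<le> norm (fc f n) * wt \<rho> n"
        by (simp add: fcs norm_mult mult_ac)
    qed
    also have "\<dots> \<le> B" by (rule WB_D[OF f F])
    finally show "(\<Sum>n\<in>F. norm (fc (\<lambda>z. f (z + c)) n) * wt \<tau> n) \<le> B" .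
  qed
qed

lemma deriv_shift: 
  assumes f: "per_hol b f" and z: "z + c \<in> strip b"
  shows "deriv (\<lambda>z. f (z + c) + a) z = deriv f (z + c)"
proof -
  have "(f has_field_derivative deriv f (z + c)) (at (z + c))"
    using holomorphic_derivI[OF per_hol_holo[OF f] open_strip z, of UNIV] .
  then have "((\<lambda>z. f (z + c)) has_field_derivative deriv f (z + c)) (at z)" by (simp only: DERIV_shift)
  then have "((\<lambda>z. f (z + c) + a) has_field_derivative deriv f (z + c) + 0) (at z)" by (intro derivative_intros)
  then show ?thesis by (simp add: DERIV_imp_deriv)
qed

text \<open>An arbitrary conjugacy \<open>id + k\<close> is close to a translation, by the cohomological equation
  with a loss of domain.\<close>

lemma conjugacy_near_translation:
  assumes sd: "small_div C \<alpha>" and e: "0 < e" "0 < t"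
    and k: "per_hol (e + t) k" and \<Phi>: "per_hol (e + t) \<Phi>" "bnd (e + t) \<Phi> B"
    and eq: "\<And>z. z \<in> strip (e + t) \<Longrightarrow> k (z + of_real \<alpha>) - k z = \<Phi> z"
  shows "WB e (deriv k) (C * B * cs t)" "WB e (\<lambda>z. k z - fc k 0) (C * B * cs t)"
proof -
  have et: "0 < e + t" using e by simp
  have C: "0 \<le> C" using sd by (simp add: small_div_def)
  have B: "0 \<le> B" using order_trans[OF norm_ge_zero bndD[OF \<Phi>(2), of 0]] e by (simp add: strip_iff)
  have sh: "per_hol (e + t) (\<lambda>z. k (z + of_real \<alpha>))" by (rule per_hol_shift_strip[OF k]) simp
  have fk: "(ee n (of_real \<alpha>) - 1) * fc k n = fc \<Phi> n" for n
  proof -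
    have "fc \<Phi> n = fc (\<lambda>z. k (z + of_real \<alpha>) - k z) n" by (rule fc_cong) (simp add: eq et)
    also have "\<dots> = (ee n (of_real \<alpha>) - 1) * fc k n"
      using et by (simp add: fc_diff[OF sh k et] fc_shift[OF k] algebra_simps)
    finally show ?thesis by simp
  qed
  \<comment> \<open>The small divisor and the derivative together cost a factor quadratic in
    \<open>n\<close>, paid for by the width \<open>t\<close>. Such a loss is affordable because this
    estimate is made once and not iterated.\<close>
  have fb: "2 * pi * \<bar>of_int n\<bar> * norm (fc k n) * wt e n \<le> C * B * ((1 + 2 * pi * \<bar>of_int n\<bar>)\<^sup>2 * wt (- t) n)" for n
  proof (cases "n = 0")
    case True then show ?thesis using C B by simp
  next
    case False
    have "1 \<le> C * \<bar>of_int n\<bar> * norm (ee n (of_real \<alpha>) - 1)" using sd False by (simp add: small_div_def)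
    then have "1 * norm (fc k n) \<le> (C * \<bar>of_int n\<bar> * norm (ee n (of_real \<alpha>) - 1)) * norm (fc k n)"
      by (rule mult_right_mono) simp
    also have "\<dots> = C * \<bar>of_int n\<bar> * norm (fc \<Phi> n)" unfolding fk[symmetric] norm_mult by simp
    also have "\<dots> \<le> C * \<bar>of_int n\<bar> * (B * wt (- (e + t)) n)"
      by (intro mult_left_mono fc_bound[OF \<Phi>(1) et bndD[OF \<Phi>(2)]]) (use C in auto)
    finally have 1: "norm (fc k n) \<le> C * \<bar>of_int n\<bar> * (B * wt (- (e + t)) n)" by simp
    have "2 * pi * \<bar>of_int n\<bar> * norm (fc k n) * wt e n \<le> 2 * pi * \<bar>of_int n\<bar> * (C * \<bar>of_int n\<bar> * (B * wt (- (e + t)) n)) * wt e n"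
      by (intro mult_right_mono mult_left_mono 1) auto
    also have "\<dots> = C * B * ((2 * pi * \<bar>of_int n\<bar> * \<bar>of_int n\<bar>) * (wt (- (e + t)) n * wt e n))" by (simp add: mult_ac)
    also have "wt (- (e + t)) n * wt e n = wt (- t) n" by (simp flip: wt_add)
    also have "C * B * ((2 * pi * \<bar>of_int n\<bar> * \<bar>of_int n\<bar>) * wt (- t) n) \<le> C * B * ((1 + 2 * pi * \<bar>of_int n\<bar>)\<^sup>2 * wt (- t) n)"
    proof (intro mult_left_mono mult_right_mono)
      have "(2 * pi * \<bar>real_of_int n\<bar>) * \<bar>of_int n\<bar> \<le> (1 + 2 * pi * \<bar>of_int n\<bar>) * (1 + 2 * pi * \<bar>of_int n\<bar>)"
      proof (intro mult_mono)
        have "1 * \<bar>real_of_int n\<bar> \<le> 2 * pi * \<bar>of_int n\<bar>" using pi_gt3 by (intro mult_right_mono) auto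
        then show "\<bar>real_of_int n\<bar> \<le> 1 + 2 * pi * \<bar>of_int n\<bar>" by simp
      qed auto
      then show "2 * pi * \<bar>real_of_int n\<bar> * \<bar>of_int n\<bar> \<le> (1 + 2 * pi * \<bar>of_int n\<bar>)\<^sup>2" by (simp add: power2_eq_square)
    qed (use C B in auto)
    finally show ?thesis .
  qed
  have ke: "per_hol e k" by (rule per_hol_mono[OF k]) (use e in simp)
  have sum: "(\<Sum>n\<in>F. 2 * pi * \<bar>of_int n\<bar> * norm (fc k n) * wt e n) \<le> C * B * cs t" if F: "finite F" for F
  proof -
    have "(\<Sum>n\<in>F. 2 * pi * \<bar>of_int n\<bar> * norm (fc k n) * wt e n) \<le> (\<Sum>n\<in>F. C * B * ((1 + 2 * pi * \<bar>of_int n\<bar>)\<^sup>2 * wt (- t) n))"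
      by (rule sum_mono[OF fb])
    also have "\<dots> \<le> C * B * cs t"
      unfolding sum_distrib_left[symmetric] by (intro mult_left_mono weight_sum_le e F) (use C B in auto)
    finally show ?thesis .
  qed
  show 1: "WB e (deriv k) (C * B * cs t)"
  proof (rule WB_I[OF per_hol_deriv[OF ke]])
    fix F :: "int set" assume F: "finite F"
    show "(\<Sum>n\<in>F. norm (fc (deriv k) n) * wt e n) \<le> C * B * cs t"
      using sum[OF F] by (simp add: fc_deriv_eq[OF ke e(1)] norm_mult)
  qed
  have p: "per_hol e (\<lambda>z. k z - fc k 0)" by (intro per_hol_diff ke per_hol_const)
  show "WB e (\<lambda>z. k z - fc k 0) (C * B * cs t)"
  proof (rule WB_cong[OF e(1) Dinv_WB[OF e(1) 1]])
    fix z assume z: "z \<in> strip e"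
    show "Dinv (deriv k) z = k z - fc k 0"
      by (rule per_hol_eqI[OF WB_per_hol[OF Dinv_WB[OF e(1) 1]] p _ z])
        (simp add: Dinv_fc[OF e(1) 1] fc_deriv_eq[OF ke e(1)] fc_diff[OF ke per_hol_const e(1)] fc_const)
  qed
qed

text \<open>A conjugacy \<open>id + k\<close> need not be close to the identity: its domain is a strip around a line \<open>Im z = s\<close>.
  It is compared with the solution \<open>g\<close> on the strip of half-width \<open>\<epsilon>/16\<close> around the line \<open>Im z = s / 2\<close>,
  which lies in both domains.\<close>

lemma conjugacy_imp_counterterm:
  fixes \<epsilon> \<kappa> C r :: real
  defines "\<delta> \<equiv> \<epsilon> / 16"
  defines "Q \<equiv> C * cs (8 * \<delta> - \<delta> - r)"
  assumes \<epsilon>: "0 < \<epsilon>" and sd: "small_div C \<alpha>" and r: "0 < r" "r \<le> 1 / 4" "r \<le> \<delta>"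
    and \<kappa>1: "30 * Q * (2 * (2 * \<kappa>) / \<delta>\<^sup>2) \<le> r" and \<kappa>2: "2 * \<kappa> < \<delta> / 2" and \<kappa>3: "C * \<kappa> * cs \<delta> \<le> r"
    and \<phi>: "per_hol \<epsilon> \<phi>" "bnd \<epsilon> \<phi> \<kappa>"
    and k: "per_hol (\<epsilon> / 2) k" "\<And>z. z \<in> strip (\<epsilon> / 2) \<Longrightarrow> z + k z \<in> strip \<epsilon>"
      "\<And>z. z \<in> strip (\<epsilon> / 2) \<Longrightarrow> k (z + of_real \<alpha>) - k z = \<phi> (z + k z)"
    and m: "norm m \<le> \<kappa>" and g: "sol \<alpha> (10 * \<delta>) r (\<lambda>z. \<phi> z - m) g l"
  shows "l = m"
proof -
  have \<delta>: "0 < \<delta>" and \<epsilon>\<delta>: "\<epsilon> = 16 * \<delta>" using \<epsilon> by (simp_all add: \<delta>_def)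
  have half: "\<epsilon> / 2 = 7 * \<delta> + \<delta>" by (simp add: \<epsilon>\<delta>)
  define \<Phi> where "\<Phi> = (\<lambda>z. \<phi> (z + k z))"
  have \<Phi>: "per_hol (7 * \<delta> + \<delta>) \<Phi>" unfolding half[symmetric]
  proof (rule per_holI)
    have "(\<phi> \<circ> (\<lambda>z. z + k z)) holomorphic_on strip (\<epsilon> / 2)"
      by (rule holomorphic_on_compose_gen[OF _ per_hol_holo[OF \<phi>(1)]]) (use k(2) in \<open>auto intro!: holomorphic_intros per_hol_holo[OF k(1)]\<close>)
    then show "\<Phi> holomorphic_on strip (\<epsilon> / 2)" by (simp add: \<Phi>_def o_def)
    show "\<Phi> (z + 1) = \<Phi> z" if "z \<in> strip (\<epsilon> / 2)" for z
      using per_hol_per[OF \<phi>(1) k(2)[OF that]] per_hol_per[OF k(1) that] by (simp add: \<Phi>_def add_ac)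
  qed
  define s where "s = fc k 0"
  define V where "V = C * \<kappa> * cs \<delta>"
  have kW: "WB (7 * \<delta>) (deriv k) V" "WB (7 * \<delta>) (\<lambda>z. k z - s) V"
  proof -
    have "bnd (7 * \<delta> + \<delta>) \<Phi> \<kappa>" using k(2) \<phi>(2) by (simp add: bnd_def \<Phi>_def half[symmetric])
    then show "WB (7 * \<delta>) (deriv k) V" "WB (7 * \<delta>) (\<lambda>z. k z - s) V"
      unfolding V_def s_def
      using conjugacy_near_translation[OF sd _ \<delta> k(1)[unfolded half] \<Phi>, of \<kappa>] k(3) \<delta> by (simp_all add: \<Phi>_def half[symmetric])
  qed
  have V: "V \<le> r" "V \<le> \<delta>" using \<kappa>3 r by (auto simp: V_def)
  \<comment> \<open>The point at height \<open>y\<close> is mapped into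
    \<open>strip (16 * \<delta>)\<close>, and \<open>k\<close> stays within \<open>\<delta>\<close>
    of its mean \<open>s\<close>. Applying this at the heights \<open>6 * \<delta>\<close> and
    \<open>- 6 * \<delta>\<close> bounds \<open>Im s\<close> by
    \<open>11 * \<delta>\<close>.\<close>
  have Ims: "\<bar>y + Im s\<bar> \<le> 17 * \<delta>" if y: "\<bar>y\<bar> < 7 * \<delta>" for y
  proof -
    have z: "\<i> * of_real y \<in> strip (7 * \<delta>)" using y by (simp add: strip_iff)
    then have "\<i> * of_real y \<in> strip (\<epsilon> / 2)" by (rule strip_mono) (use \<delta> half in simp)
    from k(2)[OF this] have "\<bar>y + Im (k (\<i> * of_real y))\<bar> < 16 * \<delta>" by (simp add: strip_iff \<epsilon>\<delta>)
    moreover have "\<bar>Im (k (\<i> * of_real y)) - Im s\<bar> \<le> \<delta>"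
      using abs_Im_le_cmod[of "k (\<i> * of_real y) - s"] WB_norm[OF _ kW(2) z] \<delta> V by simp
    ultimately show ?thesis by linarith
  qed
  have Ims': "\<bar>Im s\<bar> \<le> 11 * \<delta>" using Ims[of "6 * \<delta>"] Ims[of "- 6 * \<delta>"] \<delta> by (simp add: abs_le_iff)
  \<comment> \<open>The imaginary displacement is shared equally: \<open>k\<close> is recentred at
    height \<open>- \<sigma>\<close>, while \<open>g\<close> and \<open>\<phi>\<close> are recentred
    at height \<open>\<sigma>\<close>. With \<open>\<sigma>\<close> at most 5.5 times
    \<open>\<delta>\<close> a strip of half-width \<open>\<delta>\<close> fits into both domains, of
    half-widths 7 and 10 times \<open>\<delta>\<close>.\<close>
  define \<sigma> where "\<sigma> = Im s / 2"
  have \<sigma>: "\<bar>\<sigma>\<bar> \<le> 11 / 2 * \<delta>" using Ims' by (simp add: \<sigma>_def)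
  define \<theta> where "\<theta> = (\<lambda>z. \<phi> (z + \<i> * of_real \<sigma>) - m)"
  define c where "c = \<i> * of_real \<sigma> - s"
  have c: "\<bar>Im c\<bar> \<le> 11 / 2 * \<delta>" using \<sigma> by (simp add: c_def \<sigma>_def)
  have \<theta>: "per_hol (8 * \<delta> + 2 * \<delta>) \<theta>" unfolding \<theta>_def
    by (intro per_hol_diff per_hol_const per_hol_shift_strip[OF \<phi>(1)]) (use \<sigma> \<delta> in \<open>simp add: \<epsilon>\<delta>\<close>)
  have \<theta>b: "bnd (8 * \<delta> + 2 * \<delta>) \<theta> (2 * \<kappa>)"
    unfolding bnd_def
  proof
    fix z assume z: "z \<in> strip (8 * \<delta> + 2 * \<delta>)"
    have "z + \<i> * of_real \<sigma> \<in> strip \<epsilon>" using z \<sigma> \<delta> by (simp add: strip_iff \<epsilon>\<delta>)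
    from bndD[OF \<phi>(2) this] show "norm (\<theta> z) \<le> 2 * \<kappa>"
      using norm_triangle_ineq4[of "\<phi> (z + \<i> * of_real \<sigma>)" m] m by (simp add: \<theta>_def)
  qed
  define G1 where "G1 = (\<lambda>z. g (z + \<i> * of_real \<sigma>) + 0)"
  define G2 where "G2 = (\<lambda>z. k (z + c) + (- s))"
  have gp: "per_hol (10 * \<delta>) g" and gd: "WB (10 * \<delta>) (deriv g) r" and g0: "fc g 0 = 0"
    and geq: "\<And>z. z \<in> strip (10 * \<delta>) \<Longrightarrow> g (z + of_real \<alpha>) - g z = \<phi> (z + g z) - m + l"
    using g by (auto simp: sol_def)
  have i\<sigma>: "\<bar>Im (\<i> * complex_of_real \<sigma>)\<bar> + \<delta> \<le> 10 * \<delta>" using \<sigma> \<delta> by simp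
  have c\<delta>: "\<bar>Im c\<bar> + \<delta> \<le> 7 * \<delta>" using c \<delta> by simp
  have mem1: "z + \<i> * of_real \<sigma> \<in> strip (10 * \<delta>)" if "z \<in> strip \<delta>" for z using that i\<sigma> by (auto simp: strip_iff)
  have mem2: "z + c \<in> strip (7 * \<delta>)" "z + c \<in> strip (\<epsilon> / 2)" if "z \<in> strip \<delta>" for z
    using that c\<delta> \<delta> half by (auto simp: strip_iff)
  have S1: "sol \<alpha> \<delta> r \<theta> G1 l"
    unfolding sol_def
  proof (intro conjI ballI)
    show "per_hol \<delta> G1" unfolding G1_def by (intro per_hol_add per_hol_const per_hol_shift_strip[OF gp i\<sigma>])
    have "\<i> * of_real \<sigma> \<in> strip (10 * \<delta>)" using i\<sigma> \<delta> by (simp add: strip_iff)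
    then show "fc G1 0 = 0" unfolding G1_def using fc_shift[OF gp, of "\<i> * of_real \<sigma>" 0] g0 by simp
    show "WB \<delta> (deriv G1) r"
      by (rule WB_cong[OF \<delta> WB_shift[OF gd \<delta> i\<sigma>]]) (simp only: G1_def deriv_shift[OF gp mem1])
    show "G1 (z + of_real \<alpha>) - G1 z = \<theta> (z + G1 z) + l" if z: "z \<in> strip \<delta>" for z
      using geq[OF mem1[OF z]] by (simp add: G1_def \<theta>_def add_ac)
  qed
  have k8: "per_hol (\<epsilon> / 2) k" by (rule k(1))
  \<comment> \<open>\<open>k\<close> solves the equation for \<open>\<phi>\<close> without a
    constant, and \<open>\<theta>\<close> has \<open>m\<close> subtracted, so its counterterm is
    \<open>m\<close>. Subtracting \<open>s\<close> gives \<open>G2\<close> mean zero; the choice of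
    \<open>c\<close> places \<open>z + G2 z\<close> at the point where \<open>\<theta>\<close>
    expects it.\<close>
  have S2: "sol \<alpha> \<delta> r \<theta> G2 m"
    unfolding sol_def
  proof (intro conjI ballI)
    have p: "per_hol \<delta> (\<lambda>z. k (z + c))" by (rule per_hol_shift_strip[OF k8]) (use c\<delta> \<delta> half in simp)
    show "per_hol \<delta> G2" unfolding G2_def by (intro per_hol_add per_hol_const p)
    have "c \<in> strip (\<epsilon> / 2)" using c\<delta> \<delta> half by (simp add: strip_iff)
    from fc_shift[OF k8 this, of 0] have "fc (\<lambda>z. k (z + c)) 0 = s" by (simp add: s_def)
    moreover have "fc G2 0 = fc (\<lambda>z. k (z + c)) 0 + fc (\<lambda>_. - s) 0"
      unfolding G2_def by (rule fc_add[OF p per_hol_const \<delta>])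
    ultimately show "fc G2 0 = 0" by (simp add: fc_const)
    show "WB \<delta> (deriv G2) r"
      by (rule WB_mono[OF WB_cong[OF \<delta> WB_shift[OF kW(1) \<delta> c\<delta>]] V(1)]) (simp only: G2_def deriv_shift[OF k8 mem2(2)])
    show "G2 (z + of_real \<alpha>) - G2 z = \<theta> (z + G2 z) + m" if z: "z \<in> strip \<delta>" for z
    proof -
      have 1: "z + G2 z + \<i> * of_real \<sigma> = z + c + k (z + c)" by (simp add: G2_def c_def)
      have 2: "z + of_real \<alpha> + c = z + c + of_real \<alpha>" by simp
      have "G2 (z + of_real \<alpha>) - G2 z = k (z + c + of_real \<alpha>) - k (z + c)" by (simp only: G2_def 2) simp
      also have "\<dots> = \<theta> (z + G2 z) + m" unfolding k(3)[OF mem2(2)[OF z]] \<theta>_def 1 by simp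
      finally show ?thesis .
    qed
  qed
  show "l = m"
    by (rule sol_unique(1)[OF \<delta> r(1,2) _ sd _ \<delta> \<kappa>1 \<kappa>2 \<theta> \<theta>b S1 S2]) (use r(3) \<delta> in \<open>simp_all add: Q_def\<close>)
qed

section \<open>Lifting from the cylinder to the strip\<close>

lemma cyl_of_eq_iff: "cyl_of z = cyl_of w \<longleftrightarrow> z - w \<in> \<int>"
  by transfer simp

lemma cyl_of_surj: obtains z where "p = cyl_of z"
proof -
  have "p = cyl_of (rep_cyl p)" by (metis Quotient3_abs_rep Quotient3_cyl cyl_of.abs_eq id_apply)
  then show ?thesis by (rule that)
qed

lemma cyl_of_add: "cyl_of (z + w) = cyl_of z + cyl_of w"
  by transfer simp

lemma cyl_of_diff: "cyl_of (z - w) = cyl_of z - cyl_of w"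
  by transfer simp

lemma Im_cyl_of [simp]: "Im_cyl (cyl_of z) = Im z"
  by transfer simp

lemma cyl_of_0 [simp]: "cyl_of 0 = 0"
  by transfer simp

lemma cyl_of_plus_1 [simp]: "cyl_of (z + 1) = cyl_of z"
  by (simp add: cyl_of_eq_iff)

lemma annulus_iff: "cyl_of z \<in> annulus \<epsilon> \<longleftrightarrow> z \<in> strip \<epsilon>"
  by (simp add: annulus_def strip_iff)

lemma dist_cyl_of: "dist (cyl_of z) (cyl_of w) = infdist (z - w) \<int>"
  by transfer simp

lemma dist_cyl_of_le: "dist (cyl_of z) (cyl_of w) \<le> norm (z - w)"
  using infdist_le[of 0 \<int> "z - w"] by (simp add: dist_cyl_of)

lemma dist_cyl_diff: "dist p q = dist (p - q) (0 :: cyl)"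
proof -
  obtain z w where "p = cyl_of z" "q = cyl_of w" by (metis cyl_of_surj)
  then show ?thesis using dist_cyl_of[of "z - w" 0] by (simp add: dist_cyl_of cyl_of_diff)
qed

lemma dist_cyl_diff_diff: "dist (a - b) (c - d) \<le> dist a c + dist b (d :: cyl)"
proof -
  have "dist (a - b) (c - d) \<le> dist (a - b) (c - b) + dist (c - b) (c - d)" by (rule dist_triangle)
  moreover have "dist (a - b) (c - b) = dist a c"
    using dist_cyl_diff[of "a - b" "c - b"] dist_cyl_diff[of a c] by simp
  moreover have "dist (c - b) (c - d) = dist b d"
    using dist_cyl_diff[of "c - b" "c - d"] dist_cyl_diff[of d b] by (simp add: dist_commute)
  ultimately show ?thesis by simp
qed

lemma infdist_Ints_small:
  assumes "norm (w :: complex) \<le> 1 / 2" shows "infdist w \<int> = norm w"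
proof (rule antisym)
  show "infdist w \<int> \<le> norm w" using infdist_le[of 0 \<int> w] by simp
  obtain a where a: "a \<in> \<int>" "infdist w \<int> = dist w a"
    using infdist_attains_inf[OF closed_Ints, of w] by blast
  show "norm w \<le> infdist w \<int>"
  proof (cases "a = 0")
    case False
    obtain n where n: "a = of_int n" using a(1) by (rule Ints_cases)
    then have "1 \<le> norm a" using False by simp
    then have "1 - norm w \<le> norm (w - a)" using norm_triangle_ineq2[of a w] by (simp add: norm_minus_commute)
    then show ?thesis using assms a by (simp add: dist_norm)
  qed (use a in simp)
qed

definition srep :: "cyl \<Rightarrow> complex"
  where "srep q = (SOME z. q = cyl_of z \<and> norm z = dist q 0)"

lemma srep: "q = cyl_of (srep q)" "norm (srep q) = dist q 0"
proof -
  have "\<exists>z. q = cyl_of z \<and> norm z = dist q 0"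
  proof -
    obtain w where w: "q = cyl_of w" by (rule cyl_of_surj)
    obtain a where a: "a \<in> \<int>" "infdist w \<int> = dist w a"
      using infdist_attains_inf[OF closed_Ints, of w] by blast
    have "q = cyl_of (w - a)" using a(1) by (simp add: w cyl_of_eq_iff)
    moreover have "norm (w - a) = dist q 0" using a(2) dist_cyl_of[of w 0] by (simp add: w dist_norm)
    ultimately show ?thesis by blast
  qed
  from someI_ex[OF this] show "q = cyl_of (srep q)" "norm (srep q) = dist q 0" unfolding srep_def by auto
qed

text \<open>Two representatives of norm at most 1/4 differ by at most 1/2, where 0 is a nearest
  integer. The bound 1/4 in \<open>map_lift\<close> comes from here.\<close>

lemma dist_srep:
  assumes "dist p 0 \<le> 1 / 4" "dist q 0 \<le> 1 / 4"
  shows "dist (srep p) (srep q) = dist p q"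
proof -
  have "norm (srep p - srep q) \<le> norm (srep p) + norm (srep q)" by (rule norm_triangle_ineq4)
  also have "\<dots> \<le> 1 / 2" using assms by (simp add: srep(2))
  finally have "infdist (srep p - srep q) \<int> = norm (srep p - srep q)" by (rule infdist_Ints_small)
  then show ?thesis using dist_cyl_of[of "srep p" "srep q"] by (simp add: dist_norm flip: srep(1))
qed

lemma small_Int_eq_0:
  assumes "z \<in> \<int>" "norm (z :: complex) < 1" shows "z = 0"
proof -
  obtain n where n: "z = of_int n" using assms(1) by (rule Ints_cases)
  then have "\<bar>real_of_int n\<bar> < 1" using assms(2) by simp
  then have "n = 0" by linarith
  then show ?thesis using n by simp
qed

text \<open>Settles the integer ambiguity of a lift for the whole connected domain at once.\<close>

lemma continuous_Int_const:
  fixes D :: "'a :: topological_space \<Rightarrow> complex"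
  assumes c: "continuous_on A D" and i: "\<And>z. z \<in> A \<Longrightarrow> D z \<in> \<int>" and A: "connected A"
  obtains m where "\<And>z. z \<in> A \<Longrightarrow> D z = of_int m"
proof (cases "A = {}")
  case False
  have "D constant_on A"
  proof (rule continuous_discrete_range_constant[OF A c])
    fix x assume x: "x \<in> A"
    have "1 \<le> norm (D y - D x)" if "y \<in> A" "D y \<noteq> D x" for y :: 'a
      using small_Int_eq_0[OF Ints_diff[OF i[OF that(1)] i[OF x]]] that by force
    then show "\<exists>e>0. \<forall>y. y \<in> A \<and> D y \<noteq> D x \<longrightarrow> e \<le> norm (D y - D x)" by (intro exI[of _ 1]) auto
  qed
  then obtain c where c: "\<And>z. z \<in> A \<Longrightarrow> D z = c" unfolding constant_on_def by blast
  obtain z where z: "z \<in> A" using False by blast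
  then obtain m where "c = of_int m" using i[OF z] c[OF z] by (auto elim: Ints_cases)
  then show ?thesis using c that by blast
qed (use that in blast)

text \<open>The exponential coordinate on the cylinder, independent of the representative picked by
  \<open>rep_cyl\<close>. It turns a map into the cylinder into an ordinary nonvanishing
  function.\<close>

definition expc :: "cyl \<Rightarrow> complex" where "expc p = ee 1 (rep_cyl p)"

lemma expc_cyl_of: "expc (cyl_of z) = ee 1 z"
proof -
  have "cyl_of (rep_cyl (cyl_of z)) = cyl_of z" by (metis Quotient3_abs_rep Quotient3_cyl cyl_of.abs_eq id_apply)
  then show ?thesis unfolding expc_def by (simp add: ee_eq_iff cyl_of_eq_iff)
qed

lemma expc_eq_iff: "expc p = expc q \<longleftrightarrow> p = q"
proof -
  obtain z w where "p = cyl_of z" "q = cyl_of w" by (metis cyl_of_surj)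
  then show ?thesis by (simp add: expc_cyl_of ee_eq_iff cyl_of_eq_iff)
qed

text \<open>In the exponential coordinate the map is a nonvanishing holomorphic function on a convex
  strip, and a logarithm of it is a global lift. This replaces gluing the local lifts.\<close>

lemma cyl_holomorphic_lift:
  assumes f: "cyl_holomorphic_on f (annulus b)" and b: "0 < b"
  obtains H where "H holomorphic_on strip b" "\<And>z. z \<in> strip b \<Longrightarrow> f (cyl_of z) = cyl_of (H z)"
proof -
  define X where "X = (\<lambda>z. expc (f (cyl_of z)))"
  have "X field_differentiable at z" if z: "z \<in> strip b" for z
  proof -
    obtain r g where r: "r > 0" "g holomorphic_on ball z r" "\<And>w. w \<in> ball z r \<Longrightarrow> f (cyl_of w) = cyl_of (g w)"
      using f z unfolding cyl_holomorphic_on_def annulus_iff by metis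
    have "(\<lambda>w. ee 1 (g w)) holomorphic_on ball z r" by (intro holomorphic_intros r)
    then have "X holomorphic_on ball z r"
      by (rule holomorphic_transform) (simp add: X_def r(3) expc_cyl_of)
    then show ?thesis using r(1) holomorphic_on_imp_differentiable_at by force
  qed
  then have "X holomorphic_on strip b" by (simp add: holomorphic_on_def field_differentiable_at_within)
  moreover have "X z \<noteq> 0" for z by (simp add: X_def expc_def)
  ultimately obtain L where L: "L holomorphic_on strip b" "\<And>z. z \<in> strip b \<Longrightarrow> exp (L z) = X z"
    using holomorphic_logarithm_exists[OF convex_strip open_strip, of X b 0] b by (auto simp: strip_iff)
  show ?thesis
  proof
    show "(\<lambda>z. L z / (2 * of_real pi * \<i>)) holomorphic_on strip b" by (intro holomorphic_intros L) auto
    fix z assume z: "z \<in> strip b"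
    have "expc (cyl_of (L z / (2 * of_real pi * \<i>))) = exp (L z)" by (simp add: expc_cyl_of ee_def)
    also have "\<dots> = expc (f (cyl_of z))" by (simp add: L(2)[OF z] X_def)
    finally show "f (cyl_of z) = cyl_of (L z / (2 * of_real pi * \<i>))" by (simp add: expc_eq_iff)
  qed
qed

lemma continuous_cyl_of: "continuous_on A cyl_of"
proof (rule continuous_on_iff[THEN iffD2], intro ballI allI impI)
  fix x and e :: real assume "0 < e"
  then show "\<exists>d>0. \<forall>x'\<in>A. dist x' x < d \<longrightarrow> dist (cyl_of x') (cyl_of x) < e"
    by (intro exI[of _ e]) (auto simp: dist_norm intro: le_less_trans[OF dist_cyl_of_le])
qed

lemma Im_cyl_rotation [simp]: "Im_cyl (rotation \<alpha> p) = Im_cyl p"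
proof -
  obtain z where "p = cyl_of z" by (rule cyl_of_surj)
  then show ?thesis by (simp add: rotation_def flip: cyl_of_add)
qed

lemma rotation_cyl_of: "rotation \<alpha> (cyl_of z) = cyl_of (z + of_real \<alpha>)"
  by (simp add: rotation_def cyl_of_add)

lemma dist_rotation [simp]: "dist (rotation \<alpha> p) (rotation \<alpha> q) = dist p q"
  using dist_cyl_diff[of "rotation \<alpha> p" "rotation \<alpha> q"] dist_cyl_diff[of p q] by (simp add: rotation_def)

lemma bounded_annulus: "bounded (annulus b)"
proof -
  have "dist 0 p \<le> 1 + b" if p: "p \<in> annulus b" for p
  proof -
    obtain z where z: "p = cyl_of z" by (rule cyl_of_surj)
    have "p = cyl_of (z - of_int \<lfloor>Re z\<rfloor>)" by (simp add: z cyl_of_eq_iff)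
    then have "dist 0 p \<le> norm (z - of_int \<lfloor>Re z\<rfloor>)" using dist_cyl_of_le[of "z - of_int \<lfloor>Re z\<rfloor>" 0] by (simp add: dist_commute)
    also have "\<dots> \<le> \<bar>Re (z - of_int \<lfloor>Re z\<rfloor>)\<bar> + \<bar>Im (z - of_int \<lfloor>Re z\<rfloor>)\<bar>" by (rule cmod_le)
    also have "\<dots> \<le> 1 + b" using p by (simp add: z annulus_iff strip_iff) linarith
    finally show ?thesis .
  qed
  then show ?thesis unfolding bounded_def by blast
qed

lemma rotation_map_annulus: "p \<in> annulus \<epsilon> \<Longrightarrow> rotation_map \<epsilon> \<alpha> p = rotation \<alpha> p"
  by (simp add: rotation_map_def)

lemma rotation_annulus [simp]: "rotation \<alpha> p \<in> annulus \<epsilon> \<longleftrightarrow> p \<in> annulus \<epsilon>"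
  by (simp add: annulus_def)

lemma map_distD:
  assumes f: "f \<in> map_space \<epsilon>" and d: "map_dist \<epsilon> f (rotation_map \<epsilon> \<alpha>) \<le> \<kappa>" and p: "p \<in> annulus \<epsilon>"
  shows "dist (f p) (rotation \<alpha> p) \<le> \<kappa>"
proof -
  have "bounded (f ` annulus \<epsilon> \<union> annulus \<epsilon>)" using f bounded_annulus by (simp add: map_space_def)
  then obtain B where B: "\<And>x y. x \<in> f ` annulus \<epsilon> \<union> annulus \<epsilon> \<Longrightarrow> y \<in> f ` annulus \<epsilon> \<union> annulus \<epsilon> \<Longrightarrow> dist x y \<le> B"
    unfolding bounded_two_points by blast
  have "dist (f p) (rotation_map \<epsilon> \<alpha> p) \<le> map_dist \<epsilon> f (rotation_map \<epsilon> \<alpha>)"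
    unfolding map_dist_def
  proof (rule cSUP_upper[OF p])
    show "bdd_above ((\<lambda>p. dist (f p) (rotation_map \<epsilon> \<alpha> p)) ` annulus \<epsilon>)"
      by (rule bdd_aboveI[of _ B]) (auto simp: rotation_map_annulus intro!: B)
  qed
  then show ?thesis using d p by (simp add: rotation_map_annulus)
qed

lemma annulus_nonempty: "0 < \<epsilon> \<Longrightarrow> annulus \<epsilon> \<noteq> {}"
  using annulus_iff[of 0 \<epsilon>] by (auto simp: strip_iff)

lemma continuous_on_cyl_diff:
  fixes g h :: "'a :: topological_space \<Rightarrow> cyl"
  assumes "continuous_on A g" "continuous_on A h"
  shows "continuous_on A (\<lambda>p. g p - h p)"
  unfolding continuous_on_def
proof
  fix x assume x: "x \<in> A"
  have "((\<lambda>p. dist (g p) (g x) + dist (h p) (h x)) \<longlongrightarrow> 0 + 0) (at x within A)"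
    using assms x unfolding continuous_on_def tendsto_dist_iff[of g] tendsto_dist_iff[of h] by (intro tendsto_add) auto
  then have L: "((\<lambda>p. dist (g p) (g x) + dist (h p) (h x)) \<longlongrightarrow> 0) (at x within A)" by simp
  have "((\<lambda>p. dist (g p - h p) (g x - h x)) \<longlongrightarrow> 0) (at x within A)"
    by (rule Lim_null_comparison[OF _ L]) (auto intro!: always_eventually dist_cyl_diff_diff)
  then show "((\<lambda>p. g p - h p) \<longlongrightarrow> g x - h x) (at x within A)"
    unfolding tendsto_dist_iff[of "\<lambda>p. g p - h p"] .
qed

lemma continuous_on_rotation: "continuous_on A (rotation \<alpha>)"
  unfolding continuous_on_iff by auto

lemma continuous_on_srep: "continuous_on {q. dist q 0 \<le> 1 / 4} srep"
  unfolding continuous_on_iff by (auto simp: dist_srep)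

text \<open>Close to the rotation, the difference from it has a shortest representative that depends
  continuously on the point; this is \<open>\<phi>\<close>. Holomorphy comes from a global lift
  \<open>H\<close>, from which \<open>\<phi>\<close> differs by the explicit affine part and a
  continuous integer, hence a constant one.\<close>

lemma map_lift:
  assumes \<epsilon>: "0 < \<epsilon>" and \<kappa>: "\<kappa> \<le> 1 / 4" and f: "f \<in> map_space \<epsilon>" and d: "map_dist \<epsilon> f (rotation_map \<epsilon> \<alpha>) \<le> \<kappa>"
  obtains \<phi> where "\<phi> \<in> model_space \<epsilon>" "model_norm \<epsilon> \<phi> \<le> \<kappa>" "f = displace \<epsilon> (rotation_map \<epsilon> \<alpha>) \<phi>"
proof -
  define \<phi> where "\<phi> = (\<lambda>p. if p \<in> annulus \<epsilon> then srep (f p - rotation \<alpha> p) else 0)"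
  note fd = map_distD[OF f d]
  have n: "norm (\<phi> p) \<le> \<kappa>" if "p \<in> annulus \<epsilon>" for p
    using fd[OF that] that by (simp add: \<phi>_def srep(2) flip: dist_cyl_diff)
  have fe: "f p = rotation \<alpha> p + cyl_of (\<phi> p)" if "p \<in> annulus \<epsilon>" for p
    using that srep(1)[of "f p - rotation \<alpha> p"] by (simp add: \<phi>_def algebra_simps)
  obtain g where g: "continuous_on (closed_annulus \<epsilon>) g" "\<And>p. p \<in> annulus \<epsilon> \<Longrightarrow> g p = f p"
    using f by (auto simp: map_space_def)
  \<comment> \<open>The distance bound has to reach the boundary circles, so that
    \<open>srep\<close> is continuous along the extension \<open>g\<close> as well. Boundary points
    are approached by the points \<open>w n\<close> with slightly reduced imaginary part.\<close>
  have gd: "dist (g p) (rotation \<alpha> p) \<le> \<kappa>" if p: "p \<in> closed_annulus \<epsilon>" for p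
  proof -
    obtain z where z: "p = cyl_of z" by (rule cyl_of_surj)
    have Iz: "\<bar>Im z\<bar> \<le> \<epsilon>" using p by (simp add: z closed_annulus_def)
    define w where "w = (\<lambda>n::nat. Complex (Re z) ((1 - inverse (real (Suc n))) * Im z))"
    have "w \<longlonglongrightarrow> Complex (Re z) ((1 - 0) * Im z)"
      unfolding w_def by (intro tendsto_Complex tendsto_intros LIMSEQ_inverse_real_of_nat)
    then have "w \<longlonglongrightarrow> z" by simp
    then have wc: "(\<lambda>n. cyl_of (w n)) \<longlonglongrightarrow> p"
      unfolding z by (intro continuous_on_tendsto_compose[OF continuous_cyl_of[of UNIV]]) auto
    have wa: "cyl_of (w n) \<in> annulus \<epsilon>" for n
    proof -
      have "(1 - inverse (real (Suc n))) * \<bar>Im z\<bar> \<le> (1 - inverse (real (Suc n))) * \<epsilon>"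
        using Iz by (intro mult_left_mono) (auto simp: field_simps)
      also have "\<dots> < \<epsilon>" using \<epsilon> by (simp add: field_simps)
      finally show ?thesis by (simp add: annulus_iff strip_iff w_def abs_mult field_simps)
    qed
    have sub: "annulus \<epsilon> \<subseteq> closed_annulus \<epsilon>" by (auto simp: annulus_def closed_annulus_def)
    have "(\<lambda>n. g (cyl_of (w n))) \<longlonglongrightarrow> g p"
      by (rule continuous_on_tendsto_compose[OF g(1) wc p always_eventually]) (use wa sub in blast)
    moreover have "(\<lambda>n. rotation \<alpha> (cyl_of (w n))) \<longlonglongrightarrow> rotation \<alpha> p"
      by (rule continuous_on_tendsto_compose[OF continuous_on_rotation[of UNIV] wc]) auto
    ultimately have "(\<lambda>n. dist (g (cyl_of (w n))) (rotation \<alpha> (cyl_of (w n)))) \<longlonglongrightarrow> dist (g p) (rotation \<alpha> p)"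
      by (rule tendsto_dist)
    then show ?thesis by (rule LIMSEQ_le_const2) (use wa g(2) fd in auto)
  qed
  define \<psi> where "\<psi> = (\<lambda>p. srep (g p - rotation \<alpha> p))"
  have \<psi>c: "continuous_on (closed_annulus \<epsilon>) \<psi>"
    unfolding \<psi>_def
  proof (rule continuous_on_compose2[OF continuous_on_srep continuous_on_cyl_diff[OF g(1) continuous_on_rotation]])
    show "(\<lambda>p. g p - rotation \<alpha> p) ` closed_annulus \<epsilon> \<subseteq> {q. dist q 0 \<le> 1 / 4}"
      using gd \<kappa> by (force simp flip: dist_cyl_diff)
  qed
  have \<psi>\<phi>: "\<psi> p = \<phi> p" if "p \<in> annulus \<epsilon>" for p using that g(2) by (simp add: \<psi>_def \<phi>_def)
  have "cyl_holomorphic_on f (annulus \<epsilon>)" using f by (simp add: map_space_def)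
  then obtain H where H: "H holomorphic_on strip \<epsilon>" "\<And>z. z \<in> strip \<epsilon> \<Longrightarrow> f (cyl_of z) = cyl_of (H z)"
    using cyl_holomorphic_lift \<epsilon> by metis
  define D where "D = (\<lambda>z. \<psi> (cyl_of z) - (H z - z - of_real \<alpha>))"
  have Dc: "continuous_on (strip \<epsilon>) D"
    unfolding D_def
    by (intro continuous_intros holomorphic_on_imp_continuous_on[OF H(1)] continuous_on_compose2[OF \<psi>c continuous_cyl_of])
      (auto simp: closed_annulus_def strip_iff)
  have Di: "D z \<in> \<int>" if z: "z \<in> strip \<epsilon>" for z
  proof -
    have za: "cyl_of z \<in> annulus \<epsilon>" using z by (simp add: annulus_iff)
    have "cyl_of (H z) = cyl_of (z + of_real \<alpha> + \<psi> (cyl_of z))"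
      using fe[OF za] H(2)[OF z] \<psi>\<phi>[OF za] by (simp add: rotation_cyl_of cyl_of_add)
    then have "H z - (z + of_real \<alpha> + \<psi> (cyl_of z)) \<in> \<int>" by (simp add: cyl_of_eq_iff)
    then have "- (H z - (z + of_real \<alpha> + \<psi> (cyl_of z))) \<in> \<int>" by (rule Ints_minus)
    then show ?thesis by (simp add: D_def algebra_simps)
  qed
  obtain m where m: "\<And>z. z \<in> strip \<epsilon> \<Longrightarrow> D z = of_int m"
    using continuous_Int_const[OF Dc Di convex_connected[OF convex_strip]] by blast
  have "(\<lambda>z. H z - z - of_real \<alpha> + of_int m) holomorphic_on strip \<epsilon>" by (intro holomorphic_intros H)
  then have hol: "(\<lambda>z. \<phi> (cyl_of z)) holomorphic_on strip \<epsilon>"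
    by (rule holomorphic_transform) (use m \<psi>\<phi> in \<open>simp add: D_def annulus_iff algebra_simps\<close>)
  have "\<phi> \<in> model_space \<epsilon>"
    unfolding model_space_def
  proof (intro CollectI conjI allI impI)
    show "\<phi> p = 0" if "p \<notin> annulus \<epsilon>" for p using that by (simp add: \<phi>_def)
    show "(\<lambda>z. \<phi> (cyl_of z)) holomorphic_on {z. \<bar>Im z\<bar> < \<epsilon>}" using hol by (simp add: strip_def)
    show "bounded (\<phi> ` annulus \<epsilon>)" unfolding bounded_iff using n by blast
    show "\<exists>g. continuous_on (closed_annulus \<epsilon>) g \<and> (\<forall>p\<in>annulus \<epsilon>. g p = \<phi> p)" using \<psi>c \<psi>\<phi> by blast
  qed
  moreover have "model_norm \<epsilon> \<phi> \<le> \<kappa>"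
    unfolding model_norm_def by (rule cSUP_least[OF annulus_nonempty[OF \<epsilon>] n])
  moreover have "f = displace \<epsilon> (rotation_map \<epsilon> \<alpha>) \<phi>"
  proof
    fix p show "f p = displace \<epsilon> (rotation_map \<epsilon> \<alpha>) \<phi> p"
      using f fe by (cases "p \<in> annulus \<epsilon>") (auto simp: displace_def rotation_map_annulus map_space_def extensional_def)
  qed
  ultimately show ?thesis by (rule that)
qed

section \<open>Conjugacies on the strip and on the annulus\<close>

abbreviation (input) "lft \<phi> \<equiv> \<lambda>z. \<phi> (cyl_of z)"

lemma model_per_hol: "\<phi> \<in> model_space \<epsilon> \<Longrightarrow> per_hol \<epsilon> (lft \<phi>)"
  by (intro per_holI) (auto simp: model_space_def strip_def)

lemma model_norm_ge:
  assumes "\<phi> \<in> model_space \<epsilon>" "p \<in> annulus \<epsilon>" shows "norm (\<phi> p) \<le> model_norm \<epsilon> \<phi>"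
proof -
  have "bounded (\<phi> ` annulus \<epsilon>)" using assms by (simp add: model_space_def)
  then obtain B where "\<And>p. p \<in> annulus \<epsilon> \<Longrightarrow> norm (\<phi> p) \<le> B" unfolding bounded_iff by blast
  then show ?thesis unfolding model_norm_def by (intro cSUP_upper assms bdd_aboveI[of _ B]) auto
qed

lemma model_bnd: "\<phi> \<in> model_space \<epsilon> \<Longrightarrow> model_norm \<epsilon> \<phi> \<le> B \<Longrightarrow> bnd \<epsilon> (lft \<phi>) B"
  unfolding bnd_def using model_norm_ge annulus_iff order_trans by blast

lemma displace_rotation:
  assumes "z \<in> strip \<epsilon>"
  shows "displace \<epsilon> (rotation_map \<epsilon> \<alpha>) \<phi> (cyl_of z) = cyl_of (z + of_real \<alpha> + \<phi> (cyl_of z))"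
  using assms by (simp add: displace_def annulus_iff rotation_map_annulus rotation_cyl_of cyl_of_add)

text \<open>The derivative bound \<open>r \<le> 1 / 4\<close> makes id + \<open>g\<close> injective,
  \<open>\<epsilon> / 2 \<le> \<rho>\<close> covers the domain of the conjugacy, and
  \<open>r \<le> \<epsilon> / 2\<close> keeps the image in the annulus.\<close>

lemma sol_imp_conjugate:
  assumes \<epsilon>: "0 < \<epsilon>" and \<rho>: "\<epsilon> / 2 \<le> \<rho>" and r: "r \<le> \<epsilon> / 2" "r \<le> 1 / 4"
    and s: "sol \<alpha> \<rho> r (\<lambda>z. \<phi> (cyl_of z) - l) g l"
  shows "analytically_conjugate \<epsilon> (displace \<epsilon> (rotation_map \<epsilon> \<alpha>) \<phi>) \<alpha>"
proof -
  have \<rho>0: "0 < \<rho>" using \<epsilon> \<rho> by simp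
  have g: "WB \<rho> g r" by (rule sol_WB[OF \<rho>0 s])
  have gp: "per_hol \<rho> g" by (rule WB_per_hol[OF g])
  have gd: "WB \<rho> (deriv g) r" and eq: "\<And>z. z \<in> strip \<rho> \<Longrightarrow> g (z + of_real \<alpha>) - g z = \<phi> (cyl_of (z + g z))"
    using s by (auto simp: sol_def)
  define \<xi> where "\<xi> = (\<lambda>p. cyl_of (rep_cyl p + g (rep_cyl p)))"
  have \<xi>: "\<xi> (cyl_of z) = cyl_of (z + g z)" if z: "z \<in> strip \<rho>" for z
  proof -
    have "cyl_of (rep_cyl (cyl_of z)) = cyl_of z" by (metis Quotient3_abs_rep Quotient3_cyl cyl_of.abs_eq id_apply)
    then obtain n where n: "rep_cyl (cyl_of z) = z + of_int n"
      by (auto simp: cyl_of_eq_iff diff_eq_eq add.commute elim!: Ints_cases)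
    show ?thesis unfolding \<xi>_def n by (simp add: cyl_of_eq_iff per_hol_of_int[OF gp z])
  qed
  have half: "z \<in> strip \<rho>" if "z \<in> strip (\<epsilon> / 2)" for z by (rule strip_mono[OF that \<rho>])
  have mem: "z + g z \<in> strip \<epsilon>" if z: "z \<in> strip (\<epsilon> / 2)" for z
    using strip_add[OF z WB_norm[OF \<rho>0 g half[OF z]]] r strip_mono by fastforce
  show ?thesis
    unfolding analytically_conjugate_def
  proof (intro exI[of _ \<xi>] conjI ballI)
    show "cyl_holomorphic_on \<xi> (annulus (\<epsilon> / 2))"
      unfolding cyl_holomorphic_on_def annulus_iff
    proof (intro allI impI)
      fix z assume "z \<in> strip (\<epsilon> / 2)"
      then obtain d where d: "d > 0" "ball z d \<subseteq> strip (\<epsilon> / 2)" using open_strip by (meson open_contains_ball)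
      have "(\<lambda>w. w + g w) holomorphic_on ball z d"
        by (intro holomorphic_intros holomorphic_on_subset[OF per_hol_holo[OF gp]]) (use d half in auto)
      then show "\<exists>r>0. \<exists>ga. ga holomorphic_on ball z r \<and> (\<forall>w\<in>ball z r. w \<in> strip (\<epsilon> / 2) \<and> \<xi> (cyl_of w) = cyl_of (ga w))"
        using d \<xi> half by blast
    qed
    show "inj_on \<xi> (annulus (\<epsilon> / 2))"
    proof (rule inj_onI)
      fix p q assume pq: "p \<in> annulus (\<epsilon> / 2)" "q \<in> annulus (\<epsilon> / 2)" "\<xi> p = \<xi> q"
      obtain z w where zw: "p = cyl_of z" "q = cyl_of w" by (metis cyl_of_surj)
      have z: "z \<in> strip \<rho>" "w \<in> strip \<rho>" using pq half by (auto simp: zw annulus_iff)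
      then have "(z + g z) - (w + g w) \<in> \<int>" using pq(3) by (simp add: zw \<xi> cyl_of_eq_iff)
      then obtain n where n: "(z + g z) - (w + g w) = of_int n" by (rule Ints_cases)
      \<comment> \<open>Equality in the cylinder is equality up to an integer; periodicity of
        \<open>g\<close> allows this integer to be moved into the second point.\<close>
      define w' where "w' = w + of_int n"
      have w': "w' \<in> strip \<rho>" using z by (simp add: w'_def strip_iff)
      have "g w' = g w" unfolding w'_def by (rule per_hol_of_int[OF gp z(2)])
      then have e: "z - w' = - (g z - g w')" using n by (simp add: w'_def algebra_simps)
      have "norm (g z - g w') \<le> r * norm (z - w')"
      proof (rule field_differentiable_bound[OF convex_strip])
        show "(g has_field_derivative deriv g u) (at u within strip \<rho>)" if "u \<in> strip \<rho>" for u
          using holomorphic_derivI[OF per_hol_holo[OF gp] open_strip that] .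
        show "norm (deriv g u) \<le> r" if "u \<in> strip \<rho>" for u by (rule WB_norm[OF \<rho>0 gd that])
      qed (use z w' in auto)
      also have "\<dots> \<le> 1 / 4 * norm (z - w')" using r by (intro mult_right_mono) auto
      finally have "norm (z - w') \<le> 1 / 4 * norm (z - w')" by (subst (1) e) (simp add: norm_minus_commute)
      then have "z = w'" by simp
      then show "p = q" by (simp add: zw w'_def cyl_of_eq_iff)
    qed
    show "\<xi> ` annulus (\<epsilon> / 2) \<subseteq> annulus \<epsilon>"
    proof
      fix q assume "q \<in> \<xi> ` annulus (\<epsilon> / 2)"
      then obtain p where p: "p \<in> annulus (\<epsilon> / 2)" "q = \<xi> p" by blast
      obtain z where z: "p = cyl_of z" by (rule cyl_of_surj)
      show "q \<in> annulus \<epsilon>" using p mem half by (simp add: z annulus_iff \<xi>)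
    qed
    fix p assume p: "p \<in> annulus (\<epsilon> / 2)"
    obtain z where z: "p = cyl_of z" by (rule cyl_of_surj)
    have zs: "z \<in> strip (\<epsilon> / 2)" using p by (simp add: z annulus_iff)
    have "z + of_real \<alpha> \<in> strip \<rho>" using half[OF zs] by (simp add: strip_add_real)
    then have "\<xi> (rotation \<alpha> p) = cyl_of (z + of_real \<alpha> + g (z + of_real \<alpha>))" by (simp add: z rotation_cyl_of \<xi>)
    also have "z + of_real \<alpha> + g (z + of_real \<alpha>) = (z + g z) + of_real \<alpha> + \<phi> (cyl_of (z + g z))"
      using eq[OF half[OF zs]] by (simp add: algebra_simps)
    finally show "displace \<epsilon> (rotation_map \<epsilon> \<alpha>) \<phi> (\<xi> p) = \<xi> (rotation \<alpha> p)"
      by (simp add: z \<xi>[OF half[OF zs]] displace_rotation[OF mem[OF zs]])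
  qed
qed

text \<open>The degree of an injective conjugacy is at most one in absolute value; degrees \<open>0\<close> and \<open>-1\<close> would force
  \<open>\<alpha>\<close> or \<open>2 \<alpha>\<close> to be close to an integer.\<close>

lemma conjugate_lift:
  assumes \<epsilon>: "0 < \<epsilon>" and \<phi>: "\<phi> \<in> model_space \<epsilon>" "model_norm \<epsilon> \<phi> \<le> \<kappa>"
    and conj: "analytically_conjugate \<epsilon> (displace \<epsilon> (rotation_map \<epsilon> \<alpha>) \<phi>) \<alpha>"
    and dio: "\<And>n m. 1 \<le> n \<Longrightarrow> 1 \<le> c * real n * \<bar>real n * \<alpha> - of_int m\<bar>" and \<kappa>: "2 * c * \<kappa> < 1" "\<kappa> < 1" "0 \<le> c"
  obtains k where "per_hol (\<epsilon> / 2) k" "\<And>z. z \<in> strip (\<epsilon> / 2) \<Longrightarrow> z + k z \<in> strip \<epsilon>"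
    "\<And>z. z \<in> strip (\<epsilon> / 2) \<Longrightarrow> k (z + of_real \<alpha>) - k z = \<phi> (cyl_of (z + k z))"
proof -
  have e2: "0 < \<epsilon> / 2" using \<epsilon> by simp
  obtain \<xi> where \<xi>: "cyl_holomorphic_on \<xi> (annulus (\<epsilon> / 2))" "inj_on \<xi> (annulus (\<epsilon> / 2))" "\<xi> ` annulus (\<epsilon> / 2) \<subseteq> annulus \<epsilon>"
    "\<And>p. p \<in> annulus (\<epsilon> / 2) \<Longrightarrow> displace \<epsilon> (rotation_map \<epsilon> \<alpha>) \<phi> (\<xi> p) = \<xi> (rotation \<alpha> p)"
    using conj unfolding analytically_conjugate_def by blast
  obtain X where X: "X holomorphic_on strip (\<epsilon> / 2)" "\<And>z. z \<in> strip (\<epsilon> / 2) \<Longrightarrow> \<xi> (cyl_of z) = cyl_of (X z)"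
    using cyl_holomorphic_lift[OF \<xi>(1) e2] by blast
  have Xc: "continuous_on (strip (\<epsilon> / 2)) X" using X(1) by (rule holomorphic_on_imp_continuous_on)
  have Xm: "X z \<in> strip \<epsilon>" if z: "z \<in> strip (\<epsilon> / 2)" for z
  proof -
    have "\<xi> (cyl_of z) \<in> annulus \<epsilon>" using \<xi>(3) z annulus_iff by blast
    then show ?thesis by (simp add: X(2)[OF z] annulus_iff)
  qed
  have sh: "z + of_real a \<in> strip (\<epsilon> / 2)" if "z \<in> strip (\<epsilon> / 2)" for z and a :: real
    using that by (simp add: strip_add_real)
  have sh1: "z + 1 \<in> strip (\<epsilon> / 2)" if "z \<in> strip (\<epsilon> / 2)" for z
    using that by (simp add: strip_add_real)
  have conn: "connected (strip (\<epsilon> / 2))" by (rule convex_connected[OF convex_strip])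
  have "continuous_on (strip (\<epsilon> / 2)) (\<lambda>z. X (z + 1) - X z)"
    by (intro continuous_intros Xc continuous_on_compose2[OF Xc]) (auto simp: sh1)
  moreover have "X (z + 1) - X z \<in> \<int>" if z: "z \<in> strip (\<epsilon> / 2)" for z
    using X(2)[OF z] X(2)[OF sh1[OF z]] by (simp flip: cyl_of_eq_iff)
  ultimately obtain d where d: "\<And>z. z \<in> strip (\<epsilon> / 2) \<Longrightarrow> X (z + 1) - X z = of_int d"
    using continuous_Int_const[OF _ _ conn] by blast
  have real_mem: "complex_of_real x \<in> strip (\<epsilon> / 2)" for x using e2 by simp
  \<comment> \<open>By injectivity the real circle is mapped, in the exponential coordinate, to a
    simple closed curve that avoids 0. Its winding number about 0 is \<open>d\<close>, and for a
    simple closed curve it is -1, 0 or 1.\<close>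
  have "d \<in> {-1, 0, 1}"
  proof -
    define p where "p = (\<lambda>t::real. 2 * of_real pi * \<i> * X (of_real t))"
    have pp: "path p" unfolding path_def p_def
      by (intro continuous_intros continuous_on_compose2[OF Xc]) (use real_mem in auto)
    have ep: "(exp \<circ> p) t = ee 1 (X (of_real t))" for t by (simp add: p_def ee_def)
    have "X 1 - X 0 = of_int d" using d[OF real_mem[of 0]] by simp
    then have "winding_number (exp \<circ> p) 0 = of_int d"
      using winding_number_compose_exp[OF pp] by (simp add: p_def pathfinish_def pathstart_def flip: right_diff_distrib)
    moreover have "winding_number (exp \<circ> p) 0 \<in> {-1, 0, 1}"
    proof (rule simple_closed_path_winding_number_cases)
      have "path (exp \<circ> p)" using pp unfolding path_def by (intro continuous_on_compose continuous_intros) auto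
      moreover have "loop_free (exp \<circ> p)"
        unfolding loop_free_def
      proof (intro ballI impI)
        fix x y :: real assume xy: "x \<in> {0..1}" "y \<in> {0..1}" "(exp \<circ> p) x = (exp \<circ> p) y"
        have "expc (\<xi> (cyl_of (of_real x))) = expc (\<xi> (cyl_of (of_real y)))"
          using xy(3) unfolding ep by (simp add: X(2)[OF real_mem] expc_cyl_of)
        then have "\<xi> (cyl_of (of_real x)) = \<xi> (cyl_of (of_real y))" by (simp add: expc_eq_iff)
        then have "cyl_of (of_real x) = cyl_of (of_real y)"
          using inj_onD[OF \<xi>(2)] real_mem by (simp add: annulus_iff)
        then have "complex_of_real x - of_real y \<in> \<int>" by (simp add: cyl_of_eq_iff)
        then obtain n where "complex_of_real x - of_real y = of_int n" by (rule Ints_cases)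
        then have "x - y = of_int n" by (metis Re_complex_of_real minus_complex.sel(1) complex_Re_of_int)
        moreover from this have "n \<in> {-1, 0, 1}" using xy(1,2) by auto
        ultimately show "x = y \<or> x = 0 \<and> y = 1 \<or> x = 1 \<and> y = 0" using xy(1,2) by auto
      qed
      ultimately show "simple_path (exp \<circ> p)" by (simp add: simple_path_def)
      show "pathfinish (exp \<circ> p) = pathstart (exp \<circ> p)"
        using d[OF real_mem[of 0]] ee_eq_iff[of "X 1" "X 0"] by (simp add: pathfinish_def pathstart_def ep[unfolded o_def] o_def)
      show "0 \<notin> path_image (exp \<circ> p)" by (auto simp: path_image_def)
    qed
    ultimately have "complex_of_int d \<in> {-1, 0, 1}" by simp
    then show ?thesis by (auto simp: of_int_eq_1_iff of_int_eq_0_iff) (metis of_int_eq_iff of_int_minus of_int_1)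
  qed
  define P where "P = (\<lambda>z. \<phi> (cyl_of (X z)))"
  have \<phi>p: "per_hol \<epsilon> (lft \<phi>)" by (rule model_per_hol[OF \<phi>(1)])
  have Pp: "per_hol (\<epsilon> / 2) P"
  proof (rule per_holI)
    have "(lft \<phi> \<circ> X) holomorphic_on strip (\<epsilon> / 2)"
      by (rule holomorphic_on_compose_gen[OF X(1) per_hol_holo[OF \<phi>p]]) (use Xm in auto)
    then show "P holomorphic_on strip (\<epsilon> / 2)" by (simp add: P_def o_def)
    fix z assume z: "z \<in> strip (\<epsilon> / 2)"
    have "X (z + 1) = X z + of_int d" using d[OF z] by (simp add: algebra_simps)
    then show "P (z + 1) = P z" using per_hol_of_int[OF \<phi>p Xm[OF z]] by (simp add: P_def)
  qed
  have "continuous_on (strip (\<epsilon> / 2)) (\<lambda>z. X (z + of_real \<alpha>) - X z - of_real \<alpha> - P z)"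
    by (intro continuous_intros Xc continuous_on_compose2[OF Xc] holomorphic_on_imp_continuous_on[OF per_hol_holo[OF Pp]])
      (auto simp: sh)
  moreover have "X (z + of_real \<alpha>) - X z - of_real \<alpha> - P z \<in> \<int>" if z: "z \<in> strip (\<epsilon> / 2)" for z
  proof -
    have "cyl_of (X (z + of_real \<alpha>)) = cyl_of (X z + of_real \<alpha> + \<phi> (cyl_of (X z)))"
      using \<xi>(4)[of "cyl_of z"] z by (simp add: annulus_iff rotation_cyl_of X(2) sh displace_rotation[OF Xm])
    then show ?thesis by (simp add: cyl_of_eq_iff P_def algebra_simps)
  qed
  ultimately obtain m where m: "\<And>z. z \<in> strip (\<epsilon> / 2) \<Longrightarrow> X (z + of_real \<alpha>) - X z - of_real \<alpha> - P z = of_int m"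
    using continuous_Int_const[OF _ _ conn] by blast
  define k where "k = (\<lambda>z. X z - of_int d * z)"
  have kp: "per_hol (\<epsilon> / 2) k"
    by (rule per_holI) (use d in \<open>auto simp: k_def algebra_simps intro!: holomorphic_intros X(1)\<close>)
  have kp': "per_hol (\<epsilon> / 2) (\<lambda>z. k (z + of_real \<alpha>))" by (rule per_hol_shift_strip[OF kp]) simp
  have keq: "k (z + of_real \<alpha>) - k z = P z + (of_real ((1 - of_int d) * \<alpha>) + of_int m)" if z: "z \<in> strip (\<epsilon> / 2)" for z
    using m[OF z] by (simp add: k_def algebra_simps)
  \<comment> \<open>A coboundary has mean zero, so the constant in \<open>keq\<close> is minus the
    mean of \<open>P\<close>, of norm at most \<open>\<kappa>\<close>. This one relation excludes
    the wrong degrees and, for \<open>d = 1\<close>, forces the integer \<open>m\<close> to be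
    0.\<close>
  have "0 = fc (\<lambda>z. k (z + of_real \<alpha>) - k z) 0"
    by (simp add: fc_diff[OF kp' kp e2] fc_shift[OF kp real_mem])
  also have "\<dots> = fc (\<lambda>z. P z + (of_real ((1 - of_int d) * \<alpha>) + of_int m)) 0"
    by (rule fc_cong) (rule keq[OF real_mem])
  also have "\<dots> = fc P 0 + (of_real ((1 - of_int d) * \<alpha>) + of_int m)"
    by (simp only: fc_add[OF Pp per_hol_const e2] fc_const) simp
  finally have "complex_of_real ((1 - of_int d) * \<alpha> + of_int m) = - fc P 0" by (simp add: eq_neg_iff_add_eq_0 add_ac)
  then have "\<bar>(1 - of_int d) * \<alpha> + of_int m\<bar> = norm (fc P 0)" by (metis norm_minus_cancel norm_of_real)
  also have "\<dots> \<le> \<kappa>"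
    by (rule fc_norm_le[OF Pp e2]) (use Xm[OF real_mem] bndD[OF model_bnd[OF \<phi>]] in \<open>simp add: P_def\<close>)
  finally have small: "\<bar>(1 - of_int d) * \<alpha> + of_int m\<bar> \<le> \<kappa>" .
  have \<kappa>0: "0 \<le> \<kappa>" using small by (rule order_trans[OF abs_ge_zero])
  have "d \<noteq> 0"
  proof
    assume "d = 0"
    then have "\<bar>\<alpha> + of_int m\<bar> \<le> \<kappa>" using small by simp
    then have "c * \<bar>\<alpha> + of_int m\<bar> \<le> c * \<kappa>" by (rule mult_left_mono[OF _ \<kappa>(3)])
    moreover have "0 \<le> c * \<kappa>" using \<kappa>(3) \<kappa>0 by simp
    ultimately show False using dio[of 1 "- m"] \<kappa>(1) by simp
  qed
  moreover have "d \<noteq> - 1"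
  proof
    assume "d = - 1"
    then have "\<bar>2 * \<alpha> + of_int m\<bar> \<le> \<kappa>" using small by simp
    then have "2 * c * \<bar>2 * \<alpha> + of_int m\<bar> \<le> 2 * c * \<kappa>" using \<kappa>(3) by (intro mult_left_mono) auto
    then show False using dio[of 2 "- m"] \<kappa>(1) by (simp add: mult_ac)
  qed
  ultimately have d1: "d = 1" using \<open>d \<in> {-1, 0, 1}\<close> by blast
  have "\<bar>real_of_int m\<bar> < 1" using small \<kappa>(2) by (simp add: d1)
  then have m0: "m = 0" by linarith
  have Xk: "X z = z + k z" for z by (simp add: k_def d1)
  show ?thesis
  proof (rule that[OF kp])
    show "z + k z \<in> strip \<epsilon>" if "z \<in> strip (\<epsilon> / 2)" for z using Xm[OF that] by (simp add: Xk)
    show "k (z + of_real \<alpha>) - k z = \<phi> (cyl_of (z + k z))" if "z \<in> strip (\<epsilon> / 2)" for z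
      using keq[OF that] by (simp add: d1 m0 P_def Xk)
  qed
qed

section \<open>The hypersurface\<close>

lemma model_norm_le: "0 < \<epsilon> \<Longrightarrow> (\<And>p. p \<in> annulus \<epsilon> \<Longrightarrow> norm (\<phi> p) \<le> B) \<Longrightarrow> model_norm \<epsilon> \<phi> \<le> B"
  unfolding model_norm_def by (rule cSUP_least[OF annulus_nonempty])

section \<open>The splitting of the model space into constants and functions of mean zero\<close>

definition cst :: "real \<Rightarrow> complex \<Rightarrow> cyl \<Rightarrow> complex"
  where "cst \<epsilon> c = (\<lambda>p. if p \<in> annulus \<epsilon> then c else 0)"

definition mean :: "(cyl \<Rightarrow> complex) \<Rightarrow> complex"
  where "mean \<phi> = fc (\<lambda>z. \<phi> (cyl_of z)) 0"

definition prj :: "real \<Rightarrow> (cyl \<Rightarrow> complex) \<Rightarrow> cyl \<Rightarrow> complex"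
  where "prj \<epsilon> \<phi> = \<phi> - cst \<epsilon> (mean \<phi>)"

lemma model_spaceI:
  assumes "\<And>p. p \<notin> annulus \<epsilon> \<Longrightarrow> \<phi> p = 0" "(\<lambda>z. \<phi> (cyl_of z)) holomorphic_on strip \<epsilon>"
    "\<And>p. p \<in> annulus \<epsilon> \<Longrightarrow> norm (\<phi> p) \<le> B" "continuous_on (closed_annulus \<epsilon>) g" "\<And>p. p \<in> annulus \<epsilon> \<Longrightarrow> g p = \<phi> p"
  shows "\<phi> \<in> model_space \<epsilon>"
  unfolding model_space_def bounded_iff using assms unfolding strip_def by blast

lemma model_spaceE:
  assumes "\<phi> \<in> model_space \<epsilon>"
  obtains g where "continuous_on (closed_annulus \<epsilon>) g" "\<And>p. p \<in> annulus \<epsilon> \<Longrightarrow> g p = \<phi> p"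
  using assms by (auto simp: model_space_def)

lemma model_outside: "\<phi> \<in> model_space \<epsilon> \<Longrightarrow> p \<notin> annulus \<epsilon> \<Longrightarrow> \<phi> p = 0"
  by (simp add: model_space_def)

lemma model_hol: "\<phi> \<in> model_space \<epsilon> \<Longrightarrow> (\<lambda>z. \<phi> (cyl_of z)) holomorphic_on strip \<epsilon>"
  by (simp add: model_space_def strip_def)

context
  fixes \<epsilon> :: real
  assumes \<epsilon>: "0 < \<epsilon>"
begin

lemma model_add:
  assumes "\<phi> \<in> model_space \<epsilon>" "\<psi> \<in> model_space \<epsilon>"
  shows "\<phi> + \<psi> \<in> model_space \<epsilon>" "model_norm \<epsilon> (\<phi> + \<psi>) \<le> model_norm \<epsilon> \<phi> + model_norm \<epsilon> \<psi>" "mean (\<phi> + \<psi>) = mean \<phi> + mean \<psi>"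
proof -
  have n: "norm ((\<phi> + \<psi>) p) \<le> model_norm \<epsilon> \<phi> + model_norm \<epsilon> \<psi>" if "p \<in> annulus \<epsilon>" for p
    using norm_triangle_le[of "\<phi> p" "\<psi> p"] add_mono[OF model_norm_ge[OF assms(1) that] model_norm_ge[OF assms(2) that]] by simp
  then show "model_norm \<epsilon> (\<phi> + \<psi>) \<le> model_norm \<epsilon> \<phi> + model_norm \<epsilon> \<psi>" by (rule model_norm_le[OF \<epsilon>])
  obtain g where g: "continuous_on (closed_annulus \<epsilon>) g" "\<And>p. p \<in> annulus \<epsilon> \<Longrightarrow> g p = \<phi> p"
    by (rule model_spaceE[OF assms(1)]) blast
  obtain h where h: "continuous_on (closed_annulus \<epsilon>) h" "\<And>p. p \<in> annulus \<epsilon> \<Longrightarrow> h p = \<psi> p"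
    by (rule model_spaceE[OF assms(2)]) blast
  show "\<phi> + \<psi> \<in> model_space \<epsilon>"
  proof (rule model_spaceI[OF _ _ n])
    show "continuous_on (closed_annulus \<epsilon>) (\<lambda>p. g p + h p)" by (intro continuous_intros g h)
    show "(\<lambda>z. (\<phi> + \<psi>) (cyl_of z)) holomorphic_on strip \<epsilon>"
      using holomorphic_on_add[OF model_hol[OF assms(1)] model_hol[OF assms(2)]] by simp
  qed (use assms g h in \<open>auto simp: model_outside\<close>)
  show "mean (\<phi> + \<psi>) = mean \<phi> + mean \<psi>"
    using fc_add[OF model_per_hol[OF assms(1)] model_per_hol[OF assms(2)] \<epsilon>] by (simp add: mean_def)
qed

lemma model_cscale:
  assumes "\<phi> \<in> model_space \<epsilon>"
  shows "cscale c \<phi> \<in> model_space \<epsilon>" "model_norm \<epsilon> (cscale c \<phi>) \<le> norm c * model_norm \<epsilon> \<phi>" "mean (cscale c \<phi>) = c * mean \<phi>"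
proof -
  have n: "norm (cscale c \<phi> p) \<le> norm c * model_norm \<epsilon> \<phi>" if "p \<in> annulus \<epsilon>" for p
    by (simp add: cscale_def norm_mult mult_left_mono model_norm_ge[OF assms that])
  then show "model_norm \<epsilon> (cscale c \<phi>) \<le> norm c * model_norm \<epsilon> \<phi>" by (rule model_norm_le[OF \<epsilon>])
  obtain g where g: "continuous_on (closed_annulus \<epsilon>) g" "\<And>p. p \<in> annulus \<epsilon> \<Longrightarrow> g p = \<phi> p"
    using assms by (rule model_spaceE) blast
  show "cscale c \<phi> \<in> model_space \<epsilon>"
  proof (rule model_spaceI[OF _ _ n])
    show "continuous_on (closed_annulus \<epsilon>) (\<lambda>p. c * g p)" by (intro continuous_intros g)
    show "(\<lambda>z. cscale c \<phi> (cyl_of z)) holomorphic_on strip \<epsilon>"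
      unfolding cscale_def by (intro holomorphic_intros model_hol[OF assms])
  qed (use assms g in \<open>auto simp: model_outside cscale_def\<close>)
  show "mean (cscale c \<phi>) = c * mean \<phi>" by (simp add: mean_def cscale_def fc_cmult)
qed

lemma model_cst: "cst \<epsilon> c \<in> model_space \<epsilon>" "model_norm \<epsilon> (cst \<epsilon> c) \<le> norm c" "mean (cst \<epsilon> c) = c"
proof -
  show "model_norm \<epsilon> (cst \<epsilon> c) \<le> norm c" by (rule model_norm_le[OF \<epsilon>]) (simp add: cst_def)
  show "cst \<epsilon> c \<in> model_space \<epsilon>"
  proof (rule model_spaceI)
    show "continuous_on (closed_annulus \<epsilon>) (\<lambda>_. c)" by (intro continuous_intros)
    show "(\<lambda>z. cst \<epsilon> c (cyl_of z)) holomorphic_on strip \<epsilon>"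
      by (rule holomorphic_transform[of "\<lambda>_. c"]) (auto simp: cst_def annulus_iff)
    show "norm (cst \<epsilon> c p) \<le> norm c" for p by (simp add: cst_def)
  qed (auto simp: cst_def)
  have "mean (cst \<epsilon> c) = fc (\<lambda>_. c) 0"
    unfolding mean_def by (rule fc_cong) (use \<epsilon> in \<open>simp add: cst_def annulus_iff\<close>)
  then show "mean (cst \<epsilon> c) = c" by (simp add: fc_const)
qed

lemma minus_eq_cscale: "\<phi> - \<psi> = \<phi> + cscale (- 1) \<psi>"
  by (rule ext) (simp add: cscale_def)

lemma model_diff:
  assumes "\<phi> \<in> model_space \<epsilon>" "\<psi> \<in> model_space \<epsilon>"
  shows "\<phi> - \<psi> \<in> model_space \<epsilon>" "model_norm \<epsilon> (\<phi> - \<psi>) \<le> model_norm \<epsilon> \<phi> + model_norm \<epsilon> \<psi>" "mean (\<phi> - \<psi>) = mean \<phi> - mean \<psi>"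
  using model_add[OF assms(1) model_cscale(1)[OF assms(2)], of "- 1"] model_cscale(2,3)[OF assms(2), of "- 1"]
  by (simp_all add: minus_eq_cscale)

lemma model_norm_nonneg: "\<phi> \<in> model_space \<epsilon> \<Longrightarrow> 0 \<le> model_norm \<epsilon> \<phi>"
  using annulus_nonempty[OF \<epsilon>] model_norm_ge norm_ge_zero order_trans by blast

lemma model_zero: "0 \<in> model_space \<epsilon>" "model_norm \<epsilon> 0 \<le> 0" "mean 0 = 0"
proof -
  have "cst \<epsilon> 0 = 0" by (auto simp: cst_def)
  with model_cst[of 0] show "0 \<in> model_space \<epsilon>" "model_norm \<epsilon> 0 \<le> 0" "mean 0 = 0" by auto
qed

lemma norm_mean: "\<phi> \<in> model_space \<epsilon> \<Longrightarrow> norm (mean \<phi>) \<le> model_norm \<epsilon> \<phi>"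
  unfolding mean_def by (rule fc_norm_le[OF model_per_hol \<epsilon>]) (use \<epsilon> in \<open>auto intro: model_norm_ge simp: annulus_iff\<close>)

lemma cst_add: "cst \<epsilon> (a + b) = cst \<epsilon> a + cst \<epsilon> b"
  and cst_diff: "cst \<epsilon> (a - b) = cst \<epsilon> a - cst \<epsilon> b"
  and cst_mult: "cst \<epsilon> (a * b) = cscale a (cst \<epsilon> b)"
  by (auto simp: cst_def cscale_def)

lemma prj:
  assumes "\<phi> \<in> model_space \<epsilon>"
  shows "prj \<epsilon> \<phi> \<in> model_space \<epsilon>" "model_norm \<epsilon> (prj \<epsilon> \<phi>) \<le> 2 * model_norm \<epsilon> \<phi>" "mean (prj \<epsilon> \<phi>) = 0"
  using model_diff[OF assms model_cst(1)[of "mean \<phi>"]] model_cst(2,3)[of "mean \<phi>"] norm_mean[OF assms]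
  by (simp_all add: prj_def)

lemma prj_add: "\<phi> \<in> model_space \<epsilon> \<Longrightarrow> \<psi> \<in> model_space \<epsilon> \<Longrightarrow> prj \<epsilon> (\<phi> + \<psi>) = prj \<epsilon> \<phi> + prj \<epsilon> \<psi>"
  by (simp add: prj_def model_add(3) cst_add algebra_simps)

lemma prj_cscale: "\<phi> \<in> model_space \<epsilon> \<Longrightarrow> prj \<epsilon> (cscale c \<phi>) = cscale c (prj \<epsilon> \<phi>)"
  by (rule ext, simp add: prj_def model_cscale(3), simp add: cst_def cscale_def algebra_simps)

lemma prj_cst: "prj \<epsilon> (cst \<epsilon> c) = 0"
  by (simp add: prj_def model_cst)

lemma prj_add_cst: "\<phi> \<in> model_space \<epsilon> \<Longrightarrow> prj \<epsilon> (\<phi> + cst \<epsilon> c) = prj \<epsilon> \<phi>"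
  by (simp add: prj_add model_cst prj_cst)

lemma prj_diff_cst: "\<phi> \<in> model_space \<epsilon> \<Longrightarrow> prj \<epsilon> (\<phi> - cst \<epsilon> c) = prj \<epsilon> \<phi>"
  using prj_add_cst[of "\<phi> - cst \<epsilon> c" c] by (simp add: model_diff model_cst)

text \<open>\<open>mean\<close> is a functional of norm at most one, so the ball of radius
  \<open>norm (mean \<phi>)\<close> about \<open>\<phi>\<close> avoids its kernel. The constants are
  a complement, with \<open>prj\<close> as the projection.\<close>

lemma closed_hyperplane_mean: "closed_hyperplane (model_space \<epsilon>) (model_norm \<epsilon>) {\<phi> \<in> model_space \<epsilon>. mean \<phi> = 0}"
  unfolding closed_hyperplane_def
proof (intro conjI allI ballI)
  let ?E = "model_space \<epsilon>" and ?H = "{\<phi> \<in> model_space \<epsilon>. mean \<phi> = 0}"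
  show "norm_open ?E (model_norm \<epsilon>) (?E - ?H)"
    unfolding norm_open_def
  proof (intro conjI ballI)
    fix \<phi> assume "\<phi> \<in> ?E - ?H"
    then have \<phi>: "\<phi> \<in> ?E" "mean \<phi> \<noteq> 0" by auto
    have "\<psi> \<in> ?E - ?H" if \<psi>: "\<psi> \<in> ?E" "model_norm \<epsilon> (\<psi> - \<phi>) < norm (mean \<phi>)" for \<psi>
    proof -
      have "norm (mean (\<psi> - \<phi>)) < norm (mean \<phi>)" using norm_mean[OF model_diff(1)[OF \<psi>(1) \<phi>(1)]] \<psi>(2) by simp
      then show ?thesis using \<psi>(1) \<phi>(1) by (auto simp: model_diff)
    qed
    then show "\<exists>r>0. \<forall>\<psi>\<in>?E. model_norm \<epsilon> (\<psi> - \<phi>) < r \<longrightarrow> \<psi> \<in> ?E - ?H" using \<phi>(2) by (intro exI[of _ "norm (mean \<phi>)"]) auto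
  qed auto
  have "cst \<epsilon> 1 \<in> ?E - ?H" by (simp add: model_cst)
  moreover have "\<exists>c. \<exists>\<psi>\<in>?H. \<phi> = \<psi> + cscale c (cst \<epsilon> 1)" if "\<phi> \<in> ?E" for \<phi>
    by (rule exI[of _ "mean \<phi>"], rule bexI[of _ "prj \<epsilon> \<phi>"]) (use prj[OF that] in \<open>auto simp: prj_def cst_mult[symmetric]\<close>)
  ultimately show "\<exists>v\<in>?E - ?H. \<forall>\<phi>\<in>?E. \<exists>c. \<exists>\<psi>\<in>?H. \<phi> = \<psi> + cscale c v" by blast
qed (auto simp: model_zero model_add model_cscale)

section \<open>Graphs of a differentiable functional over the functions of mean zero\<close>

context
  fixes lam :: "(cyl \<Rightarrow> complex) \<Rightarrow> complex" and R B :: real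
  assumes R: "0 < R" "R \<le> 1 / 4" and B: "0 \<le> B"
    and lam: "\<And>\<phi>. \<phi> \<in> model_space \<epsilon> \<Longrightarrow> model_norm \<epsilon> \<phi> < R \<Longrightarrow> \<exists>l.
      (\<forall>h\<in>model_space \<epsilon>. \<forall>k\<in>model_space \<epsilon>. l (h + k) = l h + l k) \<and>
      (\<forall>c. \<forall>h\<in>model_space \<epsilon>. l (cscale c h) = c * l h) \<and>
      (\<forall>h\<in>model_space \<epsilon>. norm (l h) \<le> 2 * model_norm \<epsilon> h) \<and>
      (\<forall>h\<in>model_space \<epsilon>. model_norm \<epsilon> (\<phi> + h) < R \<longrightarrow> norm (lam (\<phi> + h) - lam \<phi> - l h) \<le> B * (model_norm \<epsilon> h)\<^sup>2)"
begin

abbreviation (input) "E \<equiv> model_space \<epsilon>"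
abbreviation (input) "N \<equiv> model_norm \<epsilon>"
abbreviation (input) "P \<equiv> prj \<epsilon>"

text \<open>The chain rule with the linear map \<open>prj\<close>, of norm at most 2: this doubles
  the bound of the derivative and quadruples that of the remainder.\<close>

lemma lam_prj_frechet:
  assumes \<phi>: "\<phi> \<in> E" "N (P \<phi>) < R"
  shows "\<exists>l. (\<forall>h\<in>E. \<forall>k\<in>E. l (h + k) = l h + l k) \<and> (\<forall>c. \<forall>h\<in>E. l (cscale c h) = c * l h) \<and>
      (\<forall>h\<in>E. norm (l h) \<le> 4 * N h) \<and>
      (\<forall>h\<in>E. N (P (\<phi> + h)) < R \<longrightarrow> norm (lam (P (\<phi> + h)) - lam (P \<phi>) - l h) \<le> 4 * B * (N h)\<^sup>2)"
proof -
  obtain l where l0: "(\<forall>h\<in>E. \<forall>k\<in>E. l (h + k) = l h + l k) \<and> (\<forall>c. \<forall>h\<in>E. l (cscale c h) = c * l h) \<and>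
      (\<forall>h\<in>E. norm (l h) \<le> 2 * N h) \<and>
      (\<forall>h\<in>E. N (P \<phi> + h) < R \<longrightarrow> norm (lam (P \<phi> + h) - lam (P \<phi>) - l h) \<le> B * (N h)\<^sup>2)"
    using lam[OF prj(1)[OF \<phi>(1)] \<phi>(2)] by (elim exE)
  have l: "\<And>h k. h \<in> E \<Longrightarrow> k \<in> E \<Longrightarrow> l (h + k) = l h + l k" "\<And>c h. h \<in> E \<Longrightarrow> l (cscale c h) = c * l h"
    "\<And>h. h \<in> E \<Longrightarrow> norm (l h) \<le> 2 * N h"
    "\<And>h. h \<in> E \<Longrightarrow> N (P \<phi> + h) < R \<Longrightarrow> norm (lam (P \<phi> + h) - lam (P \<phi>) - l h) \<le> B * (N h)\<^sup>2"
    using l0 by simp_all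
  show ?thesis
  proof (intro exI[of _ "\<lambda>h. l (P h)"] conjI ballI allI impI)
    show "l (P (h + k)) = l (P h) + l (P k)" if "h \<in> E" "k \<in> E" for h k
      using that by (simp add: prj_add l(1) prj(1))
    show "l (P (cscale c h)) = c * l (P h)" if "h \<in> E" for c h
      using that by (simp add: prj_cscale l(2) prj(1))
    show "norm (l (P h)) \<le> 4 * N h" if "h \<in> E" for h
      using l(3)[OF prj(1)[OF that]] prj(2)[OF that] by simp
    show "norm (lam (P (\<phi> + h)) - lam (P \<phi>) - l (P h)) \<le> 4 * B * (N h)\<^sup>2" if h: "h \<in> E" "N (P (\<phi> + h)) < R" for h
    proof -
      have "norm (lam (P (\<phi> + h)) - lam (P \<phi>) - l (P h)) \<le> B * (N (P h))\<^sup>2"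
        using l(4)[OF prj(1)[OF h(1)]] h(2) by (simp add: prj_add[OF \<phi>(1) h(1)])
      also have "\<dots> \<le> B * (2 * N h)\<^sup>2"
        by (intro mult_left_mono power_mono prj(2) h B model_norm_nonneg prj(1))
      finally show ?thesis by (simp add: power_mult_distrib)
    qed
  qed
qed

lemma lam_prj_continuous:
  assumes \<phi>: "\<phi> \<in> E" "N (P \<phi>) < R" and e: "0 < e"
  shows "\<exists>d>0. \<forall>\<psi>\<in>E. N (\<psi> - \<phi>) < d \<longrightarrow> N (P \<psi>) < R \<and> norm (lam (P \<psi>) - lam (P \<phi>)) < e"
proof -
  obtain l where l0: "(\<forall>h\<in>E. \<forall>k\<in>E. l (h + k) = l h + l k) \<and> (\<forall>c. \<forall>h\<in>E. l (cscale c h) = c * l h) \<and>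
      (\<forall>h\<in>E. norm (l h) \<le> 4 * N h) \<and>
      (\<forall>h\<in>E. N (P (\<phi> + h)) < R \<longrightarrow> norm (lam (P (\<phi> + h)) - lam (P \<phi>) - l h) \<le> 4 * B * (N h)\<^sup>2)"
    using lam_prj_frechet[OF \<phi>] by (elim exE)
  have l: "\<And>h. h \<in> E \<Longrightarrow> norm (l h) \<le> 4 * N h"
    "\<And>h. h \<in> E \<Longrightarrow> N (P (\<phi> + h)) < R \<Longrightarrow> norm (lam (P (\<phi> + h)) - lam (P \<phi>) - l h) \<le> 4 * B * (N h)\<^sup>2"
    using l0 by simp_all
  define d where "d = Min {1, (R - N (P \<phi>)) / 2, e / (4 + 4 * B)}"
  have d: "0 < d" "d \<le> 1" "d \<le> (R - N (P \<phi>)) / 2" "d \<le> e / (4 + 4 * B)"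
    using \<phi>(2) e B by (simp add: d_def, unfold d_def, (intro Min.coboundedI; simp)+)
  show ?thesis
  proof (intro exI[of _ d] conjI ballI impI d(1))
    fix \<psi> assume \<psi>: "\<psi> \<in> E" "N (\<psi> - \<phi>) < d"
    define h where "h = \<psi> - \<phi>"
    have h: "h \<in> E" "N h < d" "\<psi> = \<phi> + h" using \<psi> \<phi>(1) by (auto simp: h_def model_diff)
    have "N (P \<psi>) \<le> N (P \<phi>) + N (P h)" unfolding h(3) prj_add[OF \<phi>(1) h(1)] by (rule model_add(2)[OF prj(1)[OF \<phi>(1)] prj(1)[OF h(1)]])
    then have NR: "N (P \<psi>) < R" using prj(2)[OF h(1)] h(2) d(3) by simp
    then show "N (P \<psi>) < R" .
    have N0: "0 \<le> N h" by (rule model_norm_nonneg[OF h(1)])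
    have "norm (lam (P \<psi>) - lam (P \<phi>)) \<le> norm (lam (P \<psi>) - lam (P \<phi>) - l h) + norm (l h)"
      using norm_triangle_ineq[of "lam (P \<psi>) - lam (P \<phi>) - l h" "l h"] by simp
    also have "\<dots> \<le> 4 * B * (N h)\<^sup>2 + 4 * N h" using l(2)[OF h(1)] NR l(1)[OF h(1)] by (simp add: h(3) add_mono)
    also have "(N h)\<^sup>2 \<le> N h" using N0 h(2) d(2) by (simp add: power2_eq_square mult_left_le)
    then have "4 * B * (N h)\<^sup>2 + 4 * N h \<le> (4 + 4 * B) * N h" using B mult_left_mono[of "(N h)\<^sup>2" "N h" "4 * B"] by (simp add: algebra_simps)
    also have "\<dots> < (4 + 4 * B) * (e / (4 + 4 * B))" using h(2) d(4) B by (intro mult_strict_left_mono) auto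
    also have "\<dots> = e" using B by simp
    finally show "norm (lam (P \<psi>) - lam (P \<phi>)) < e" .
  qed
qed

text \<open>One statement for both directions of a shear along the constants: \<open>s = - 1\<close>
  with offsets \<open>f\<close> gives the chart, \<open>s = 1\<close> with \<open>b = 0\<close> its
  inverse.\<close>

lemma graph_frechet:
  assumes a: "a \<in> E" and b: "b \<in> E" and s: "norm s = 1" and U: "\<And>\<phi>. \<phi> \<in> U \<Longrightarrow> \<phi> \<in> E \<and> N (P (b + \<phi>)) < R"
    and F: "\<And>\<phi>. \<phi> \<in> U \<Longrightarrow> F \<phi> = (a + \<phi>) + cst \<epsilon> (s * lam (P (b + \<phi>)))"
  shows "frechet_holomorphic_on E N F U"
  unfolding frechet_holomorphic_on_def
proof (intro ballI conjI)
  fix \<phi> assume \<phi>U: "\<phi> \<in> U"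
  then have \<phi>: "\<phi> \<in> E" "N (P (b + \<phi>)) < R" using U by auto
  show "F \<phi> \<in> E" unfolding F[OF \<phi>U] by (intro model_add(1) model_cst(1) a \<phi>)
  obtain l where l0: "(\<forall>h\<in>E. \<forall>k\<in>E. l (h + k) = l h + l k) \<and> (\<forall>c. \<forall>h\<in>E. l (cscale c h) = c * l h) \<and>
      (\<forall>h\<in>E. norm (l h) \<le> 4 * N h) \<and>
      (\<forall>h\<in>E. N (P (b + \<phi> + h)) < R \<longrightarrow> norm (lam (P (b + \<phi> + h)) - lam (P (b + \<phi>)) - l h) \<le> 4 * B * (N h)\<^sup>2)"
    using lam_prj_frechet[OF model_add(1)[OF b \<phi>(1)] \<phi>(2)] by (elim exE)
  have l: "\<And>h k. h \<in> E \<Longrightarrow> k \<in> E \<Longrightarrow> l (h + k) = l h + l k" "\<And>c h. h \<in> E \<Longrightarrow> l (cscale c h) = c * l h"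
    "\<And>h. h \<in> E \<Longrightarrow> norm (l h) \<le> 4 * N h"
    "\<And>h. h \<in> E \<Longrightarrow> N (P (b + \<phi> + h)) < R \<Longrightarrow> norm (lam (P (b + \<phi> + h)) - lam (P (b + \<phi>)) - l h) \<le> 4 * B * (N h)\<^sup>2"
    using l0 by simp_all
  define L where "L = (\<lambda>h. h + cst \<epsilon> (s * l h))"
  show "\<exists>L. bounded_clinear_on E N L \<and> (\<forall>e>0. \<exists>d>0. \<forall>h\<in>E. \<phi> + h \<in> U \<and> N h < d \<longrightarrow> N (F (\<phi> + h) - F \<phi> - L h) \<le> e * N h)"
  proof (intro exI[of _ L] conjI allI impI)
    show "bounded_clinear_on E N L"
      unfolding bounded_clinear_on_def
    proof (intro conjI ballI allI exI[of _ 5])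
      show "L h \<in> E" if "h \<in> E" for h unfolding L_def by (intro model_add(1) model_cst(1) that)
      show "L (h + k) = L h + L k" if "h \<in> E" "k \<in> E" for h k
        unfolding L_def by (simp add: l(1)[OF that] distrib_left cst_add add_ac)
      show "L (cscale c h) = cscale c (L h)" if "h \<in> E" for c h
        by (rule ext, simp add: L_def l(2)[OF that], simp add: cst_def cscale_def algebra_simps)
      show "N (L h) \<le> 5 * N h" if "h \<in> E" for h
        using model_add(2)[OF that model_cst(1)[of "s * l h"]] model_cst(2)[of "s * l h"] l(3)[OF that] s
        by (simp add: L_def norm_mult)
    qed
    fix e :: real assume e: "0 < e"
    define d where "d = e / (4 * B + 1)"
    have d: "0 < d" using e B by (simp add: d_def)
    have "N (F (\<phi> + h) - F \<phi> - L h) \<le> e * N h" if h: "h \<in> E" "\<phi> + h \<in> U" "N h < d" for h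
    proof -
      let ?x = "lam (P (b + \<phi> + h)) - lam (P (b + \<phi>)) - l h"
      have N0: "0 \<le> N h" by (rule model_norm_nonneg[OF h(1)])
      have "F (\<phi> + h) - F \<phi> - L h = cst \<epsilon> (s * ?x)"
        unfolding F[OF \<phi>U] F[OF h(2)] L_def by (rule ext) (simp add: cst_def algebra_simps)
      then have "N (F (\<phi> + h) - F \<phi> - L h) \<le> norm ?x" using model_cst(2)[of "s * ?x"] s by (simp add: norm_mult)
      also have "\<dots> \<le> 4 * B * (N h)\<^sup>2" by (rule l(4)[OF h(1)]) (use U[OF h(2)] in \<open>simp add: add.assoc\<close>)
      also have "\<dots> = (4 * B * N h) * N h" by (simp add: power2_eq_square)
      also have "\<dots> \<le> e * N h"
      proof (intro mult_right_mono N0)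
        have "4 * B * N h \<le> (4 * B + 1) * d" using h(3) B N0 by (intro mult_mono) auto
        then show "4 * B * N h \<le> e" using B by (simp add: d_def)
      qed
      finally show ?thesis .
    qed
    then show "\<exists>d>0. \<forall>h\<in>E. \<phi> + h \<in> U \<and> N h < d \<longrightarrow> N (F (\<phi> + h) - F \<phi> - L h) \<le> e * N h" using d by blast
  qed
qed

text \<open>\<open>\<Psi>\<close> subtracts a constant that depends only on the projection, and
  \<open>prj\<close> does not see constants, so adding the same constant inverts it. In the new
  coordinate the graph condition says that the mean vanishes. The radius \<open>R / 2\<close> in
  \<open>U\<close> keeps projections in the ball of radius \<open>R\<close> where \<open>lam\<close>
  is controlled.\<close>

lemma graph_chart:
  assumes f: "f \<in> E" "N f < R / 2"
  defines "U \<equiv> {\<phi> \<in> E. N (f + \<phi>) < R / 2}"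
  defines "V \<equiv> {\<zeta> \<in> E. N (P \<zeta>) < R \<and> N (\<zeta> + cst \<epsilon> (lam (P \<zeta>))) < R / 2}"
  defines "\<Psi> \<equiv> \<lambda>\<phi>. (f + \<phi>) - cst \<epsilon> (lam (P (f + \<phi>)))"
  shows "0 \<in> U" "biholomorphic_between E N \<Psi> U V"
    "\<Psi> ` {\<phi> \<in> U. mean (f + \<phi>) = lam (P (f + \<phi>))} = V \<inter> {\<phi> \<in> E. mean \<phi> = 0}"
proof -
  show "0 \<in> U" using f by (simp add: U_def model_zero)
  define \<Theta> where "\<Theta> = (\<lambda>\<zeta>. \<zeta> + cst \<epsilon> (lam (P \<zeta>)) - f)"
  have fE: "f + \<phi> \<in> E" if "\<phi> \<in> E" for \<phi> by (rule model_add(1)[OF f(1) that])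
  have UR: "N (P (f + \<phi>)) < R" if "\<phi> \<in> U" for \<phi>
    using prj(2)[OF fE, of \<phi>] that by (auto simp: U_def)
  have PPsi: "P (\<Psi> \<phi>) = P (f + \<phi>)" if "\<phi> \<in> E" for \<phi> unfolding \<Psi>_def by (rule prj_diff_cst[OF fE[OF that]])
  have UV: "\<Psi> \<phi> \<in> V \<and> \<Theta> (\<Psi> \<phi>) = \<phi>" if \<phi>: "\<phi> \<in> U" for \<phi>
  proof -
    have \<phi>E: "\<phi> \<in> E" using \<phi> by (simp add: U_def)
    have "\<Psi> \<phi> + cst \<epsilon> (lam (P (\<Psi> \<phi>))) = f + \<phi>" unfolding PPsi[OF \<phi>E] by (simp add: \<Psi>_def)
    then show ?thesis using \<phi> UR[OF \<phi>] PPsi[OF \<phi>E] model_diff(1)[OF fE[OF \<phi>E] model_cst(1)]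
      by (auto simp: V_def U_def \<Theta>_def) (simp add: \<Psi>_def)
  qed
  have VU: "\<Theta> \<zeta> \<in> U \<and> \<Psi> (\<Theta> \<zeta>) = \<zeta>" if \<zeta>: "\<zeta> \<in> V" for \<zeta>
  proof -
    have \<zeta>E: "\<zeta> \<in> E" using \<zeta> by (simp add: V_def)
    have 1: "f + \<Theta> \<zeta> = \<zeta> + cst \<epsilon> (lam (P \<zeta>))" by (simp add: \<Theta>_def)
    have 2: "P (f + \<Theta> \<zeta>) = P \<zeta>" unfolding 1 by (rule prj_add_cst[OF \<zeta>E])
    have "\<Theta> \<zeta> \<in> E" unfolding \<Theta>_def by (intro model_diff(1) model_add(1) model_cst(1) \<zeta>E f)
    moreover have "N (f + \<Theta> \<zeta>) < R / 2" unfolding 1 using \<zeta> by (simp add: V_def)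
    moreover have "\<Psi> (\<Theta> \<zeta>) = \<zeta>" unfolding \<Psi>_def 2 unfolding 1 by simp
    ultimately show ?thesis by (simp add: U_def)
  qed
  have bij: "bij_betw \<Psi> U V"
    by (rule bij_betw_byWitness[of U \<Theta>]) (use UV VU in auto)
  have inv: "inv_into U \<Psi> \<zeta> = \<Theta> \<zeta>" if "\<zeta> \<in> V" for \<zeta>
    by (rule inv_into_f_eq) (use bij VU[OF that] in \<open>auto simp: bij_betw_def\<close>)
  have oU: "norm_open E N U"
    unfolding norm_open_def
  proof (intro conjI ballI)
    fix \<phi> assume \<phi>: "\<phi> \<in> U"
    have "\<psi> \<in> U" if \<psi>: "\<psi> \<in> E" "N (\<psi> - \<phi>) < R / 2 - N (f + \<phi>)" for \<psi>
    proof -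
      have \<phi>E: "\<phi> \<in> E" using \<phi> by (simp add: U_def)
      have "N (f + \<psi>) \<le> N (f + \<phi>) + N (\<psi> - \<phi>)"
        using model_add(2)[OF fE[OF \<phi>E] model_diff(1)[OF \<psi>(1) \<phi>E]] by simp
      then show ?thesis using \<psi> by (simp add: U_def)
    qed
    then show "\<exists>r>0. \<forall>\<psi>\<in>E. N (\<psi> - \<phi>) < r \<longrightarrow> \<psi> \<in> U"
      using \<phi> by (intro exI[of _ "R / 2 - N (f + \<phi>)"]) (auto simp: U_def)
  qed (auto simp: U_def)
  have oV: "norm_open E N V"
    unfolding norm_open_def
  proof (intro conjI ballI)
    fix \<phi> assume \<phi>: "\<phi> \<in> V"
    let ?G = "\<lambda>\<phi>. \<phi> + cst \<epsilon> (lam (P \<phi>))"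
    \<comment> \<open>Half of the remaining distance each for the displacement of
      \<open>\<phi>\<close> and for the change of \<open>lam\<close>.\<close>
    define e where "e = (R / 2 - N (?G \<phi>)) / 2"
    have \<phi>E: "\<phi> \<in> E" "N (P \<phi>) < R" and e: "0 < e" using \<phi> by (auto simp: V_def e_def)
    obtain d where d: "0 < d" "\<And>\<psi>. \<psi> \<in> E \<Longrightarrow> N (\<psi> - \<phi>) < d \<Longrightarrow> N (P \<psi>) < R \<and> norm (lam (P \<psi>) - lam (P \<phi>)) < e"
      using lam_prj_continuous[OF \<phi>E e] by auto
    have "\<psi> \<in> V" if \<psi>: "\<psi> \<in> E" "N (\<psi> - \<phi>) < min d e" for \<psi>
    proof -
      have 1: "N (P \<psi>) < R" "norm (lam (P \<psi>) - lam (P \<phi>)) < e" using d(2)[of \<psi>] \<psi> by auto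
      have "?G \<psi> = ?G \<phi> + ((\<psi> - \<phi>) + cst \<epsilon> (lam (P \<psi>) - lam (P \<phi>)))" by (simp add: cst_diff)
      then have "N (?G \<psi>) = N (?G \<phi> + ((\<psi> - \<phi>) + cst \<epsilon> (lam (P \<psi>) - lam (P \<phi>))))" by (rule arg_cong)
      also have "\<dots> \<le> N (?G \<phi>) + N ((\<psi> - \<phi>) + cst \<epsilon> (lam (P \<psi>) - lam (P \<phi>)))"
        by (rule model_add(2)) (use \<phi>E \<psi> in \<open>simp_all only: model_add(1) model_diff(1) model_cst(1)\<close>)
      also have "\<dots> \<le> N (?G \<phi>) + (N (\<psi> - \<phi>) + norm (lam (P \<psi>) - lam (P \<phi>)))"
        using model_add(2)[OF model_diff(1)[OF \<psi>(1) \<phi>E(1)] model_cst(1)] model_cst(2) by (meson add_left_mono order_trans)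
      also have "\<dots> < R / 2" using 1(2) \<psi>(2) by (simp add: e_def)
      finally show ?thesis using 1 \<psi> by (simp add: V_def)
    qed
    then show "\<exists>r>0. \<forall>\<psi>\<in>E. N (\<psi> - \<phi>) < r \<longrightarrow> \<psi> \<in> V"
      using d(1) e by (intro exI[of _ "min d e"]) auto
  qed (auto simp: V_def)
  have "frechet_holomorphic_on E N \<Psi> U"
  proof (rule graph_frechet[OF f(1) f(1), of "- 1"])
    show "\<phi> \<in> E \<and> N (P (f + \<phi>)) < R" if "\<phi> \<in> U" for \<phi> using UR[OF that] that by (simp add: U_def)
    show "\<Psi> \<phi> = f + \<phi> + cst \<epsilon> (- 1 * lam (P (f + \<phi>)))" for \<phi>
      by (rule ext) (simp add: \<Psi>_def cst_def)
  qed simp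
  moreover have "frechet_holomorphic_on E N (inv_into U \<Psi>) V"
  proof (rule graph_frechet[OF model_diff(1)[OF model_zero(1) f(1)] model_zero(1), of 1])
    show "\<phi> \<in> E \<and> N (P (0 + \<phi>)) < R" if "\<phi> \<in> V" for \<phi> using that by (simp add: V_def)
    show "inv_into U \<Psi> \<phi> = 0 - f + \<phi> + cst \<epsilon> (1 * lam (P (0 + \<phi>)))" if "\<phi> \<in> V" for \<phi>
      unfolding inv[OF that] by (simp add: \<Theta>_def)
  qed simp
  ultimately show "biholomorphic_between E N \<Psi> U V"
    unfolding biholomorphic_between_def using oU oV bij by blast
  have mP: "mean (\<Psi> \<phi>) = mean (f + \<phi>) - lam (P (f + \<phi>))" if "\<phi> \<in> U" for \<phi>
    using that unfolding \<Psi>_def by (simp add: model_diff(3)[OF fE model_cst(1)] model_cst(3) U_def)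
  show "\<Psi> ` {\<phi> \<in> U. mean (f + \<phi>) = lam (P (f + \<phi>))} = V \<inter> {\<phi> \<in> E. mean \<phi> = 0}"
  proof (intro equalityI subsetI)
    fix \<zeta> assume "\<zeta> \<in> \<Psi> ` {\<phi> \<in> U. mean (f + \<phi>) = lam (P (f + \<phi>))}"
    then show "\<zeta> \<in> V \<inter> {\<phi> \<in> E. mean \<phi> = 0}" using UV mP by (auto simp: V_def)
  next
    fix \<zeta> assume \<zeta>: "\<zeta> \<in> V \<inter> {\<phi> \<in> E. mean \<phi> = 0}"
    then have "mean (f + \<Theta> \<zeta>) = lam (P (f + \<Theta> \<zeta>))" using mP[of "\<Theta> \<zeta>"] VU[of \<zeta>] by simp
    then show "\<zeta> \<in> \<Psi> ` {\<phi> \<in> U. mean (f + \<phi>) = lam (P (f + \<phi>))}"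
      using \<zeta> VU[of \<zeta>] by (intro image_eqI[of _ _ "\<Theta> \<zeta>"]) auto
  qed
qed

end

end

section \<open>The maps conjugate to the rotation as a graph\<close>

lemma displace_map_space:
  assumes \<phi>: "\<phi> \<in> model_space \<epsilon>"
  shows "displace \<epsilon> (rotation_map \<epsilon> \<alpha>) \<phi> \<in> map_space \<epsilon>"
proof -
  define f where "f = displace \<epsilon> (rotation_map \<epsilon> \<alpha>) \<phi>"
  have f: "f p = rotation \<alpha> p + cyl_of (\<phi> p)" if "p \<in> annulus \<epsilon>" for p
    using that by (simp add: f_def displace_def rotation_map_annulus)
  have "f \<in> extensional (annulus \<epsilon>)" by (simp add: f_def displace_def)
  moreover have "cyl_holomorphic_on f (annulus \<epsilon>)"
    unfolding cyl_holomorphic_on_def annulus_iff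
  proof (intro allI impI)
    fix z assume "z \<in> strip \<epsilon>"
    then obtain d where d: "d > 0" "ball z d \<subseteq> strip \<epsilon>" using open_strip by (meson open_contains_ball)
    have "(\<lambda>w. w + of_real \<alpha> + \<phi> (cyl_of w)) holomorphic_on ball z d"
      by (intro holomorphic_intros holomorphic_on_subset[OF model_hol[OF \<phi>] d(2)])
    moreover have "f (cyl_of w) = cyl_of (w + of_real \<alpha> + \<phi> (cyl_of w))" if "w \<in> ball z d" for w
      unfolding f_def by (rule displace_rotation) (use d that in blast)
    ultimately show "\<exists>r>0. \<exists>g. g holomorphic_on ball z r \<and> (\<forall>w\<in>ball z r. w \<in> strip \<epsilon> \<and> f (cyl_of w) = cyl_of (g w))"
      using d by blast
  qed
  moreover have "bounded (f ` annulus \<epsilon>)"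
  proof (rule bounded_subset[OF bounded_annulus[of "\<epsilon> + model_norm \<epsilon> \<phi>"]], rule image_subsetI)
    fix p assume p: "p \<in> annulus \<epsilon>"
    obtain z where z: "p = cyl_of z" by (rule cyl_of_surj)
    have "norm (\<phi> p) \<le> model_norm \<epsilon> \<phi>" by (rule model_norm_ge[OF \<phi> p])
    then have "z + \<phi> p \<in> strip (\<epsilon> + model_norm \<epsilon> \<phi>)" using p by (intro strip_add) (simp_all add: z annulus_iff)
    then show "f p \<in> annulus (\<epsilon> + model_norm \<epsilon> \<phi>)"
      using p by (simp add: f z rotation_cyl_of annulus_iff strip_iff flip: cyl_of_add)
  qed
  moreover have "\<exists>g. continuous_on (closed_annulus \<epsilon>) g \<and> (\<forall>p\<in>annulus \<epsilon>. g p = f p)"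
  proof -
    obtain g where g: "continuous_on (closed_annulus \<epsilon>) g" "\<And>p. p \<in> annulus \<epsilon> \<Longrightarrow> g p = \<phi> p"
      using \<phi> by (rule model_spaceE) blast
    have "continuous_on (closed_annulus \<epsilon>) (\<lambda>p. rotation \<alpha> p - cyl_of (- g p))"
      by (intro continuous_on_cyl_diff continuous_on_rotation continuous_on_compose2[OF continuous_cyl_of[of UNIV]] continuous_intros g) auto
    moreover have "rotation \<alpha> p - cyl_of (- g p) = f p" if "p \<in> annulus \<epsilon>" for p
      using cyl_of_diff[of 0 "g p"] g(2)[OF that] by (simp add: f[OF that])
    ultimately show ?thesis by blast
  qed
  ultimately show ?thesis unfolding map_space_def f_def by blast
qed

lemma displace_displace: "displace \<epsilon> (displace \<epsilon> f \<phi>) \<psi> = displace \<epsilon> f (\<phi> + \<psi>)"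
  by (rule ext) (simp add: displace_def cyl_of_add restrict_def add.assoc)

lemma displace_inj:
  assumes \<phi>: "\<phi> \<in> model_space \<epsilon>" "model_norm \<epsilon> \<phi> < 1 / 2" and \<psi>: "\<psi> \<in> model_space \<epsilon>" "model_norm \<epsilon> \<psi> < 1 / 2"
    and eq: "displace \<epsilon> f \<phi> = displace \<epsilon> f \<psi>"
  shows "\<phi> = \<psi>"
proof
  fix p show "\<phi> p = \<psi> p"
  proof (cases "p \<in> annulus \<epsilon>")
    case True
    have "displace \<epsilon> f \<phi> p = displace \<epsilon> f \<psi> p" by (simp add: eq)
    then have "\<phi> p - \<psi> p \<in> \<int>" using True by (simp add: displace_def cyl_of_eq_iff)
    moreover have "norm (\<phi> p - \<psi> p) < 1"
      using norm_triangle_ineq4[of "\<phi> p" "\<psi> p"] model_norm_ge[OF \<phi>(1) True] model_norm_ge[OF \<psi>(1) True] \<phi>(2) \<psi>(2) by linarith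
    ultimately show ?thesis using small_Int_eq_0 by fastforce
  qed (use \<phi> \<psi> in \<open>simp add: model_outside\<close>)
qed

lemma sol_cong:
  assumes s: "sol \<alpha> \<rho> r \<phi> g l" and \<rho>: "0 < \<rho>" and eq: "\<And>z. z \<in> strip (\<rho> + r) \<Longrightarrow> \<phi> z = \<psi> z"
  shows "sol \<alpha> \<rho> r \<psi> g l"
  using s strip_add[OF _ WB_norm[OF \<rho> sol_WB[OF \<rho> s]]] eq by (auto simp: sol_def)

text \<open>Here \<open>\<rho> = 10 * \<delta>\<close> and \<open>b = 14 * \<delta>\<close>, so that
  \<open>b + 2 * \<delta> = \<epsilon>\<close>. Uniqueness of the counterterm turns the choice made
  by \<open>SOME\<close> into a function, and the quadratic remainder bound is uniform over the ball
  of radius \<open>R\<close>.\<close>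

lemma counterterm_frechet:
  fixes \<epsilon> \<delta> R C \<alpha> r Q :: real
  assumes \<epsilon>: "0 < \<epsilon>" and eps: "\<epsilon> = 16 * \<delta>" and sd: "small_div C \<alpha>" and r: "0 < r" "r \<le> 1 / 4" "r \<le> \<delta>"
    and Q: "Q = C * cs (14 * \<delta> - 10 * \<delta> - r)" and R1: "30 * Q * (2 * R / \<delta>\<^sup>2) \<le> r" and R2: "R < \<delta> / 2"
  shows "\<exists>lam B. 0 \<le> B \<and>
    (\<forall>\<phi>\<in>model_space \<epsilon>. model_norm \<epsilon> \<phi> < R \<longrightarrow> (\<exists>g. sol \<alpha> (10 * \<delta>) r (\<lambda>z. \<phi> (cyl_of z)) g (lam \<phi>))) \<and>
    (\<forall>\<phi>\<in>model_space \<epsilon>. \<forall>g l. model_norm \<epsilon> \<phi> < R \<longrightarrow> sol \<alpha> (10 * \<delta>) r (\<lambda>z. \<phi> (cyl_of z)) g l \<longrightarrow> l = lam \<phi>) \<and>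
    (\<forall>\<phi>\<in>model_space \<epsilon>. model_norm \<epsilon> \<phi> < R \<longrightarrow> (\<exists>l.
      (\<forall>h\<in>model_space \<epsilon>. \<forall>k\<in>model_space \<epsilon>. l (h + k) = l h + l k) \<and>
      (\<forall>c. \<forall>h\<in>model_space \<epsilon>. l (cscale c h) = c * l h) \<and>
      (\<forall>h\<in>model_space \<epsilon>. norm (l h) \<le> 2 * model_norm \<epsilon> h) \<and>
      (\<forall>h\<in>model_space \<epsilon>. model_norm \<epsilon> (\<phi> + h) < R \<longrightarrow> norm (lam (\<phi> + h) - lam \<phi> - l h) \<le> B * (model_norm \<epsilon> h)\<^sup>2)))"
proof -
  have \<delta>: "0 < \<delta>" and \<epsilon>\<delta>: "14 * \<delta> + 2 * \<delta> = \<epsilon>" using \<epsilon> by (simp_all add: eps)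
  have \<rho>: "0 < 10 * \<delta>" and b: "10 * \<delta> + r < 14 * \<delta>" using \<delta> r by auto
  note ctx = \<rho> r(1,2) b sd Q \<delta> R1 R2
  have per: "per_hol (14 * \<delta> + 2 * \<delta>) (lft \<phi>)" if "\<phi> \<in> model_space \<epsilon>" for \<phi>
    unfolding \<epsilon>\<delta> by (rule model_per_hol[OF that])
  have bd: "bnd (14 * \<delta> + 2 * \<delta>) (lft \<phi>) B" if "\<phi> \<in> model_space \<epsilon>" "model_norm \<epsilon> \<phi> \<le> B" for \<phi> B
    unfolding \<epsilon>\<delta> by (rule model_bnd[OF that])
  define lam where "lam \<phi> = (SOME l. \<exists>g. sol \<alpha> (10 * \<delta>) r (lft \<phi>) g l)" for \<phi>
  have ex: "\<exists>g. sol \<alpha> (10 * \<delta>) r (lft \<phi>) g (lam \<phi>)" if "\<phi> \<in> model_space \<epsilon>" "model_norm \<epsilon> \<phi> < R" for \<phi>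
  proof -
    have "\<exists>g l. sol \<alpha> (10 * \<delta>) r (lft \<phi>) g l"
      by (rule sol_exists[OF ctx per bd]) (use that in auto)
    then have "\<exists>l g. sol \<alpha> (10 * \<delta>) r (lft \<phi>) g l" by blast
    then show ?thesis unfolding lam_def by (rule someI_ex)
  qed
  have uniq: "l = lam \<phi>" if \<phi>: "\<phi> \<in> model_space \<epsilon>" "model_norm \<epsilon> \<phi> < R" and g: "sol \<alpha> (10 * \<delta>) r (lft \<phi>) g l" for \<phi> g l
  proof -
    obtain h where h: "sol \<alpha> (10 * \<delta>) r (lft \<phi>) h (lam \<phi>)" using ex[OF \<phi>] by blast
    show ?thesis by (rule sol_unique(1)[OF ctx per bd g h]) (use \<phi> in auto)
  qed
  define T where "T = 40 * Q / \<delta>\<^sup>2"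
  define B where "B = 2 * (R / \<delta>\<^sup>2 * T\<^sup>2 + T / \<delta>)"
  have Q0: "0 \<le> Q"
    unfolding Q using sd cs_ge1[of "14 * \<delta> - 10 * \<delta> - r"] b by (intro mult_nonneg_nonneg) (auto simp: small_div_def)
  have main: "\<exists>l.
      (\<forall>h\<in>model_space \<epsilon>. \<forall>k\<in>model_space \<epsilon>. l (h + k) = l h + l k) \<and>
      (\<forall>c. \<forall>h\<in>model_space \<epsilon>. l (cscale c h) = c * l h) \<and>
      (\<forall>h\<in>model_space \<epsilon>. norm (l h) \<le> 2 * model_norm \<epsilon> h) \<and>
      (\<forall>h\<in>model_space \<epsilon>. model_norm \<epsilon> (\<phi> + h) < R \<longrightarrow> norm (lam (\<phi> + h) - lam \<phi> - l h) \<le> \<bar>B\<bar> * (model_norm \<epsilon> h)\<^sup>2)"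
    if \<phi>: "\<phi> \<in> model_space \<epsilon>" "model_norm \<epsilon> \<phi> < R" for \<phi>
  proof -
    obtain g where g: "sol \<alpha> (10 * \<delta>) r (lft \<phi>) g (lam \<phi>)" using ex[OF \<phi>] by blast
    have gd: "WB (10 * \<delta>) (deriv g) r" using g by (simp add: sol_def)
    have gW: "WB (10 * \<delta>) g r" by (rule sol_WB[OF \<rho> g])
    have pb: "per_hol (14 * \<delta>) (lft h)" if "h \<in> model_space \<epsilon>" for h
      by (rule per_hol_mono[OF per[OF that]]) (use \<delta> in simp)
    show ?thesis
    proof (intro exI[of _ "\<lambda>h. lin \<alpha> g (lft h)"] conjI ballI allI impI)
      fix h assume h: "h \<in> model_space \<epsilon>"
      show "lin \<alpha> g (lft (h + k)) = lin \<alpha> g (lft h) + lin \<alpha> g (lft k)" if k: "k \<in> model_space \<epsilon>" for k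
        using lin_linear(1)[OF ctx gd gW pb[OF h] pb[OF k]] by simp
      show "lin \<alpha> g (lft (cscale c h)) = c * lin \<alpha> g (lft h)" for c
        using lin_linear(2)[OF ctx gd gW pb[OF h] pb[OF h]] by (simp add: cscale_def)
      have "bnd (14 * \<delta>) (lft h) (model_norm \<epsilon> h)"
        using bd[OF h order_refl] strip_mono[of _ "14 * \<delta>" "14 * \<delta> + 2 * \<delta>"] \<delta> by (auto simp: bnd_def)
      then show "norm (lin \<alpha> g (lft h)) \<le> 2 * model_norm \<epsilon> h" by (rule lin_bound[OF ctx gd gW pb[OF h]])
      assume h': "model_norm \<epsilon> (\<phi> + h) < R"
      have \<phi>h: "\<phi> + h \<in> model_space \<epsilon>" by (rule model_add(1)[OF \<epsilon> \<phi>(1) h])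
      obtain k where k: "sol \<alpha> (10 * \<delta>) r (lft (\<phi> + h)) k (lam (\<phi> + h))" using ex[OF \<phi>h h'] by blast
      have e: "(\<lambda>z. (\<phi> + h) (cyl_of z) - \<phi> (cyl_of z)) = lft h" by simp
      have "norm (lam (\<phi> + h) - lam \<phi> - lin \<alpha> g (\<lambda>z. (\<phi> + h) (cyl_of z) - \<phi> (cyl_of z)))
          \<le> 2 * (R / \<delta>\<^sup>2 * (40 * Q / \<delta>\<^sup>2)\<^sup>2 + 40 * Q / \<delta>\<^sup>2 / \<delta>) * (model_norm \<epsilon> h)\<^sup>2"
        by (rule counterterm_deriv[OF ctx per[OF \<phi>(1)] bd[OF \<phi>(1)] per[OF \<phi>h] bd[OF \<phi>h] _ g k])
          (use \<phi>(2) h' bd[OF h order_refl] in \<open>simp_all add: e\<close>)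
      also have "\<dots> \<le> \<bar>B\<bar> * (model_norm \<epsilon> h)\<^sup>2" unfolding B_def T_def by (intro mult_right_mono abs_ge_self) auto
      finally show "norm (lam (\<phi> + h) - lam \<phi> - lin \<alpha> g (lft h)) \<le> \<bar>B\<bar> * (model_norm \<epsilon> h)\<^sup>2" unfolding e .
    qed
  qed
  show ?thesis
    by (intro exI[of _ lam] exI[of _ "\<bar>B\<bar>"] conjI ballI allI impI ex uniq main abs_ge_zero)
qed

text \<open>Three nested radii: \<open>lam\<close> is controlled up to \<open>R\<close>, the
  hypersurface lives in the open ball of radius \<open>R / 2\<close> so that it is a graph around
  each of its points, and the comparison with all conjugate maps is made in the closed ball of
  radius \<open>R / 4\<close>.\<close>

lemma hypersurface_of_conjugates:
  fixes \<epsilon> \<delta> R C \<alpha> r :: real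
  assumes \<epsilon>: "0 < \<epsilon>" and eps: "\<epsilon> = 16 * \<delta>" and sd: "small_div C \<alpha>" and r: "0 < r" "r \<le> 1 / 4" "r \<le> \<delta>"
    and dio: "\<And>n m. 1 \<le> n \<Longrightarrow> 1 \<le> C * real n * \<bar>real n * \<alpha> - of_int m\<bar>"
    and R: "0 < R" "R \<le> 1 / 4" "R < \<delta> / 2" "30 * (C * cs (14 * \<delta> - 10 * \<delta> - r)) * (2 * R / \<delta>\<^sup>2) \<le> r"
      "30 * (C * cs (8 * \<delta> - \<delta> - r)) * (2 * R / \<delta>\<^sup>2) \<le> r" "C * R * cs \<delta> \<le> r" "C * R \<le> 1"
  shows "\<exists>S. embedded_analytic_hypersurface \<epsilon> S \<and> rotation_map \<epsilon> \<alpha> \<in> S \<and>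
      {f\<in>map_space \<epsilon>. analytically_conjugate \<epsilon> f \<alpha> \<and> map_dist \<epsilon> f (rotation_map \<epsilon> \<alpha>) \<le> R / 4} =
      {f\<in>S. map_dist \<epsilon> f (rotation_map \<epsilon> \<alpha>) \<le> R / 4}"
proof -
  let ?E = "model_space \<epsilon>" and ?N = "model_norm \<epsilon>" and ?P = "prj \<epsilon>" and ?D = "displace \<epsilon> (rotation_map \<epsilon> \<alpha>)"
  have \<delta>: "0 < \<delta>" and \<epsilon>16: "\<epsilon> / 16 = \<delta>" using \<epsilon> by (simp_all add: eps)
  note \<epsilon>\<delta> = eps
  have C1: "1 \<le> C" using sd by (simp add: small_div_def)
  obtain lam B where lamB: "0 \<le> B \<and> (\<forall>\<phi>\<in>?E. ?N \<phi> < R \<longrightarrow> (\<exists>g. sol \<alpha> (10 * \<delta>) r (lft \<phi>) g (lam \<phi>))) \<and>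
    (\<forall>\<phi>\<in>?E. \<forall>g l. ?N \<phi> < R \<longrightarrow> sol \<alpha> (10 * \<delta>) r (lft \<phi>) g l \<longrightarrow> l = lam \<phi>) \<and>
    (\<forall>\<phi>\<in>?E. ?N \<phi> < R \<longrightarrow> (\<exists>l.
      (\<forall>h\<in>?E. \<forall>k\<in>?E. l (h + k) = l h + l k) \<and> (\<forall>c. \<forall>h\<in>?E. l (cscale c h) = c * l h) \<and>
      (\<forall>h\<in>?E. norm (l h) \<le> 2 * ?N h) \<and>
      (\<forall>h\<in>?E. ?N (\<phi> + h) < R \<longrightarrow> norm (lam (\<phi> + h) - lam \<phi> - l h) \<le> B * (?N h)\<^sup>2)))"
    using counterterm_frechet[OF \<epsilon> eps sd r refl R(4,3)] by (elim exE)
  have B: "0 \<le> B"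
    and lam1: "\<And>\<phi>. \<phi> \<in> ?E \<Longrightarrow> ?N \<phi> < R \<Longrightarrow> \<exists>g. sol \<alpha> (10 * \<delta>) r (lft \<phi>) g (lam \<phi>)"
    and lam2: "\<And>\<phi> g l. \<phi> \<in> ?E \<Longrightarrow> ?N \<phi> < R \<Longrightarrow> sol \<alpha> (10 * \<delta>) r (lft \<phi>) g l \<Longrightarrow> l = lam \<phi>"
    using lamB by simp_all
  have lam3: "\<exists>l.
      (\<forall>h\<in>?E. \<forall>k\<in>?E. l (h + k) = l h + l k) \<and> (\<forall>c. \<forall>h\<in>?E. l (cscale c h) = c * l h) \<and>
      (\<forall>h\<in>?E. norm (l h) \<le> 2 * ?N h) \<and>
      (\<forall>h\<in>?E. ?N (\<phi> + h) < R \<longrightarrow> norm (lam (\<phi> + h) - lam \<phi> - l h) \<le> B * (?N h)\<^sup>2)"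
    if "\<phi> \<in> ?E" "?N \<phi> < R" for \<phi>
    by (rule lamB[THEN conjunct2, THEN conjunct2, THEN conjunct2, THEN bspec, THEN mp, OF that])
  define S where "S = ?D ` {\<phi> \<in> ?E. ?N \<phi> < R / 2 \<and> mean \<phi> = lam (?P \<phi>)}"
  have PE: "?P \<phi> \<in> ?E" "?N (?P \<phi>) < R" if "\<phi> \<in> ?E" "?N \<phi> < R / 2" for \<phi>
    using prj[OF \<epsilon> that(1)] that(2) by auto
  have S_iff: "?D \<phi> \<in> S \<longleftrightarrow> mean \<phi> = lam (?P \<phi>)" if \<phi>: "\<phi> \<in> ?E" "?N \<phi> < R / 2" for \<phi>
  proof
    assume "?D \<phi> \<in> S"
    then obtain \<psi> where \<psi>: "\<psi> \<in> ?E" "?N \<psi> < R / 2" "mean \<psi> = lam (?P \<psi>)" "?D \<phi> = ?D \<psi>" by (auto simp: S_def)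
    have "\<phi> = \<psi>" by (rule displace_inj[OF \<phi>(1) _ \<psi>(1) _ \<psi>(4)]) (use \<phi> \<psi> R in auto)
    then show "mean \<phi> = lam (?P \<phi>)" using \<psi> by simp
  qed (use \<phi> in \<open>auto simp: S_def\<close>)
  \<comment> \<open>Subtracting the mean from \<open>\<phi>\<close> and then meeting the counterterm
    \<open>mean \<phi>\<close> restores the conjugacy equation of \<open>\<phi>\<close> itself. This
    is why the graph condition \<open>mean \<phi> = lam (?P \<phi>)\<close> describes
    conjugacy.\<close>
  have solP: "sol \<alpha> (10 * \<delta>) r (lft (?P \<phi>)) g l \<longleftrightarrow> sol \<alpha> (10 * \<delta>) r (\<lambda>z. \<phi> (cyl_of z) - mean \<phi>) g l" for \<phi> g l
  proof -
    have e: "?P \<phi> (cyl_of z) = \<phi> (cyl_of z) - mean \<phi>" if "z \<in> strip (10 * \<delta> + r)" for z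
    proof -
      have "z \<in> strip \<epsilon>" by (rule strip_mono[OF that]) (use r \<delta> \<epsilon>\<delta> in simp)
      then show ?thesis by (simp add: prj_def cst_def annulus_iff)
    qed
    have \<rho>: "0 < 10 * \<delta>" using \<delta> by simp
    show ?thesis by (rule iffI; erule sol_cong[OF _ \<rho>]; simp add: e)
  qed
  have S_conj: "analytically_conjugate \<epsilon> (?D \<phi>) \<alpha>" if \<phi>: "\<phi> \<in> ?E" "?N \<phi> < R / 2" "mean \<phi> = lam (?P \<phi>)" for \<phi>
  proof -
    obtain g where "sol \<alpha> (10 * \<delta>) r (lft (?P \<phi>)) g (lam (?P \<phi>))" using lam1[OF PE[OF \<phi>(1,2)]] by blast
    then have "sol \<alpha> (10 * \<delta>) r (\<lambda>z. \<phi> (cyl_of z) - mean \<phi>) g (mean \<phi>)" unfolding \<phi>(3)[symmetric] solP .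
    then show ?thesis by (rule sol_imp_conjugate[OF \<epsilon>, rotated 3]) (use r \<delta> \<epsilon>\<delta> in auto)
  qed
  have conj_S: "mean \<phi> = lam (?P \<phi>)" if \<phi>: "\<phi> \<in> ?E" "?N \<phi> \<le> R / 4" "analytically_conjugate \<epsilon> (?D \<phi>) \<alpha>" for \<phi>
  proof -
    have \<phi>R: "?N \<phi> < R / 2" using \<phi>(2) R(1) by simp
    have small: "2 * C * (R / 4) < 1" "R / 4 < 1" "0 \<le> C" using R C1 by auto
    obtain k where k: "per_hol (\<epsilon> / 2) k" "\<And>z. z \<in> strip (\<epsilon> / 2) \<Longrightarrow> z + k z \<in> strip \<epsilon>"
      "\<And>z. z \<in> strip (\<epsilon> / 2) \<Longrightarrow> k (z + of_real \<alpha>) - k z = \<phi> (cyl_of (z + k z))"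
      using conjugate_lift[OF \<epsilon> \<phi> dio small] by blast
    obtain g where g: "sol \<alpha> (10 * \<delta>) r (lft (?P \<phi>)) g (lam (?P \<phi>))" using lam1[OF PE[OF \<phi>(1) \<phi>R]] by blast
    then have g': "sol \<alpha> (10 * \<delta>) r (\<lambda>z. \<phi> (cyl_of z) - mean \<phi>) g (lam (?P \<phi>))" unfolding solP .
    have "lam (?P \<phi>) = mean \<phi>"
    proof (rule conjugacy_imp_counterterm[where \<epsilon> = \<epsilon>, unfolded \<epsilon>16, OF \<epsilon> sd r _ _ _ model_per_hol[OF \<phi>(1)] model_bnd[OF \<phi>(1,2)] k _ g'])
      show "norm (mean \<phi>) \<le> R / 4" using norm_mean[OF \<epsilon> \<phi>(1)] \<phi>(2) by simp
      have c0: "0 \<le> cs (8 * \<delta> - \<delta> - r)" "0 \<le> cs \<delta>" using cs_ge1[of "8 * \<delta> - \<delta> - r"] cs_ge1[of \<delta>] r \<delta> by auto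
      have "30 * (C * cs (8 * \<delta> - \<delta> - r)) * (2 * (2 * (R / 4)) / \<delta>\<^sup>2) \<le> 30 * (C * cs (8 * \<delta> - \<delta> - r)) * (2 * R / \<delta>\<^sup>2)"
        using c0 C1 R(1) by (intro mult_left_mono divide_right_mono mult_nonneg_nonneg) auto
      then show "30 * (C * cs (8 * \<delta> - \<delta> - r)) * (2 * (2 * (R / 4)) / \<delta>\<^sup>2) \<le> r"
        using R(5) by linarith
      show "2 * (R / 4) < \<delta> / 2" using R(1,3) by simp
      have "C * (R / 4) * cs \<delta> \<le> C * R * cs \<delta>" using c0 C1 R(1) by (intro mult_right_mono) auto
      then show "C * (R / 4) * cs \<delta> \<le> r" using R(6) by linarith
    qed
    then show ?thesis by simp
  qed
  have "embedded_analytic_hypersurface \<epsilon> S"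
    unfolding embedded_analytic_hypersurface_def
  proof (intro conjI ballI)
    show "S \<subseteq> map_space \<epsilon>" using displace_map_space by (auto simp: S_def)
    fix f assume "f \<in> S"
    then obtain \<phi> where \<phi>: "\<phi> \<in> ?E" "?N \<phi> < R / 2" "f = ?D \<phi>" by (auto simp: S_def)
    note ch = graph_chart[where lam = lam, OF \<epsilon> R(1,2) B lam3 \<phi>(1,2)]
    let ?U = "{\<psi> \<in> ?E. ?N (\<phi> + \<psi>) < R / 2}"
    have "{\<psi> \<in> ?U. displace \<epsilon> f \<psi> \<in> S} = {\<psi> \<in> ?U. mean (\<phi> + \<psi>) = lam (?P (\<phi> + \<psi>))}"
      using S_iff[OF model_add(1)[OF \<epsilon> \<phi>(1)]] by (auto simp: \<phi>(3) displace_displace)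
    then show "\<exists>U V \<Psi> H. 0 \<in> U \<and> biholomorphic_between ?E ?N \<Psi> U V \<and> closed_hyperplane ?E ?N H \<and>
        \<Psi> ` {\<psi> \<in> U. displace \<epsilon> f \<psi> \<in> S} = V \<inter> H"
      using ch closed_hyperplane_mean[OF \<epsilon>] by (intro exI conjI) (assumption | simp only:)+
  qed
  moreover have "rotation_map \<epsilon> \<alpha> \<in> S"
  proof -
    have "?D 0 = rotation_map \<epsilon> \<alpha>" by (rule ext) (simp add: displace_def rotation_map_def restrict_def)
    moreover have "?D 0 \<in> S"
    proof -
      have z: "0 \<in> ?E" "?N 0 < R / 2" "mean 0 = 0" using model_zero[OF \<epsilon>] R(1) by auto
      have P0: "?P 0 = 0" using z(3) by (auto simp: prj_def cst_def)
      \<comment> \<open>The identity conjugates the rotation to itself, so uniqueness makes the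
        counterterm of 0 equal to 0.\<close>
      have "sol \<alpha> (10 * \<delta>) r (lft 0) (\<lambda>_. 0) 0"
        using WB_mono[OF WB_0[of "10 * \<delta>"], of r] \<delta> r(1) by (simp add: sol_def per_hol_const fc_const deriv_const[abs_def])
      from lam2[where \<phi> = 0, OF z(1) _ this] have "0 = lam 0" using z(2) R(1) by simp
      then show ?thesis using S_iff[OF z(1,2)] z(3) P0 by simp
    qed
    ultimately show ?thesis by simp
  qed
  moreover have "{f\<in>map_space \<epsilon>. analytically_conjugate \<epsilon> f \<alpha> \<and> map_dist \<epsilon> f (rotation_map \<epsilon> \<alpha>) \<le> R / 4} =
      {f\<in>S. map_dist \<epsilon> f (rotation_map \<epsilon> \<alpha>) \<le> R / 4}"
  proof (intro equalityI subsetI)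
    fix f assume f: "f \<in> {f\<in>map_space \<epsilon>. analytically_conjugate \<epsilon> f \<alpha> \<and> map_dist \<epsilon> f (rotation_map \<epsilon> \<alpha>) \<le> R / 4}"
    have "R / 4 \<le> 1 / 4" using R(2) by simp
    then obtain \<phi> where \<phi>: "\<phi> \<in> ?E" "?N \<phi> \<le> R / 4" "f = ?D \<phi>" using map_lift[OF \<epsilon>, of "R / 4" f \<alpha>] f by blast
    have "f \<in> S" unfolding \<phi>(3) by (subst S_iff) (use \<phi> R(1) f conj_S[OF \<phi>(1,2)] in auto)
    then show "f \<in> {f\<in>S. map_dist \<epsilon> f (rotation_map \<epsilon> \<alpha>) \<le> R / 4}" using f by simp
  next
    fix f assume "f \<in> {f\<in>S. map_dist \<epsilon> f (rotation_map \<epsilon> \<alpha>) \<le> R / 4}"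
    then show "f \<in> {f\<in>map_space \<epsilon>. analytically_conjugate \<epsilon> f \<alpha> \<and> map_dist \<epsilon> f (rotation_map \<epsilon> \<alpha>) \<le> R / 4}"
      using S_conj displace_map_space by (auto simp: S_def)
  qed
  ultimately show ?thesis by blast
qed

theorem theorem1p2:
  fixes K :: nat and \<epsilon> :: real
  assumes "\<epsilon> > 0"
  shows "\<exists>\<kappa>>0. \<forall>\<alpha>\<in>bounded_type K.
    (\<exists>S. embedded_analytic_hypersurface \<epsilon> S \<and> rotation_map \<epsilon> \<alpha> \<in> S \<and>
      {f\<in>map_space \<epsilon>. analytically_conjugate \<epsilon> f \<alpha> \<and>
          map_dist \<epsilon> f (rotation_map \<epsilon> \<alpha>) \<le> \<kappa>} =
      {f\<in>S. map_dist \<epsilon> f (rotation_map \<epsilon> \<alpha>) \<le> \<kappa>})"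
proof -
  define \<delta> where "\<delta> = \<epsilon> / 16"
  \<comment> \<open>Depends on \<open>K\<close> only, and is the only trace of
    \<open>\<alpha>\<close> in the constants below.\<close>
  define C where "C = (real K + 2)\<^sup>2"
  define r where "r = min \<delta> (1 / 4)"
  define c where "c = Max {cs (14 * \<delta> - 10 * \<delta> - r), cs (8 * \<delta> - \<delta> - r), cs \<delta>}"
  \<comment> \<open>In this order: lifting by shortest representatives; staying away from the cut of
    \<open>Ln\<close>; the contraction condition on both pairs of strips; closeness of an arbitrary
    conjugacy to a translation; exclusion of the degrees 0 and -1.\<close>
  define R where "R = Min {1 / 4, \<delta> / 4, r * \<delta>\<^sup>2 / (60 * (C * c)), r / (C * c), 1 / C}"
  have \<delta>: "0 < \<delta>" using assms by (simp add: \<delta>_def)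
  have r: "0 < r" "r \<le> 1 / 4" "r \<le> \<delta>" using \<delta> by (auto simp: r_def)
  have C: "1 \<le> C" unfolding C_def by (rule one_le_power) simp
  have c: "cs (14 * \<delta> - 10 * \<delta> - r) \<le> c" "cs (8 * \<delta> - \<delta> - r) \<le> c" "cs \<delta> \<le> c"
    unfolding c_def by (intro Max_ge; simp)+
  have c1: "1 \<le> c" using cs_ge1[OF \<delta>] c(3) by linarith
  have Cc: "0 < C * c" using C c1 by simp
  have R0: "0 < R" using \<delta> r(1) Cc C by (simp add: R_def)
  have Rl: "R \<le> 1 / 4" "R \<le> \<delta> / 4" "R \<le> r * \<delta>\<^sup>2 / (60 * (C * c))" "R \<le> r / (C * c)" "R \<le> 1 / C"
    unfolding R_def by (intro Min.coboundedI; simp)+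
  have big: "30 * (C * x) * (2 * R / \<delta>\<^sup>2) \<le> r" if "x \<le> c" for x
  proof -
    have "30 * (C * x) * (2 * R / \<delta>\<^sup>2) \<le> 30 * (C * c) * (2 * R / \<delta>\<^sup>2)"
      using that C R0 by (intro mult_right_mono mult_left_mono) auto
    also have "\<dots> \<le> r" using Rl(3) Cc \<delta> by (simp add: field_simps)
    finally show ?thesis .
  qed
  have "C * R * cs \<delta> \<le> C * R * c" using c(3) C R0 by (intro mult_left_mono) auto
  also have "\<dots> \<le> r" using Rl(4) Cc by (simp add: field_simps)
  finally have R6: "C * R * cs \<delta> \<le> r" .
  have R7: "C * R \<le> 1" using Rl(5) C by (simp add: field_simps)
  show ?thesis
  proof (intro exI[of _ "R / 4"] conjI ballI)
    show "0 < R / 4" using R0 by simp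
    fix \<alpha> assume \<alpha>: "\<alpha> \<in> bounded_type K"
    show "\<exists>S. embedded_analytic_hypersurface \<epsilon> S \<and> rotation_map \<epsilon> \<alpha> \<in> S \<and>
      {f\<in>map_space \<epsilon>. analytically_conjugate \<epsilon> f \<alpha> \<and> map_dist \<epsilon> f (rotation_map \<epsilon> \<alpha>) \<le> R / 4} =
      {f\<in>S. map_dist \<epsilon> f (rotation_map \<epsilon> \<alpha>) \<le> R / 4}"
    proof (rule hypersurface_of_conjugates[where C = C and r = r and \<delta> = \<delta>])
      show "\<epsilon> = 16 * \<delta>" by (simp add: \<delta>_def)
      show "small_div C \<alpha>" unfolding C_def by (rule bounded_type_small_div[OF \<alpha>])
      show "1 \<le> C * real n * \<bar>real n * \<alpha> - of_int m\<bar>" if "1 \<le> n" for n m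
        unfolding C_def by (rule bounded_type_diophantine[OF \<alpha> that])
      show "R < \<delta> / 2" using Rl(2) \<delta> by simp
    qed (use assms r R0 Rl(1) R6 R7 big c in auto)
  qed
qed

end
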